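(* Let $R$ be a commutative ring, let $M$ be an $R$-module and let $S$ be a multiplicatively closed subset of $R$. (1) If $M$ is Laskerian and quasi-prime-embedding, then every quasi-prime submodule of $M$ is primary. (2) Let $R$ be a serial ring. Then $M$ is a multiplication module if and only if $M$ is quasi-prime-embedding. (3) If $M$ is quasi-prime-embedding, then $S^{-1}M$ is a quasi-prime-embedding $S^{-1}R$-module. (4) If $M$ is free, then $M$ is quasi-prime-embedding if and only if $M$ is cyclic. (5) If $M$ is projective and quasi-prime-embedding, then $M$ is locally cyclic. (6) If $R$ is an arithmetical ring and $M$ is quasi-prime-embedding, then $M$ is locally cyclic. (7) Let $R$ be a semi-local arithmetical ring. Then $M$ is cyclic if and only if $M$ is quasi-prime-embedding. (8) If $M$ is finitely generated, then the following are equivalent: $M$ is locally cyclic; $M$ is a multiplication module; $M$ is quasi-prime-embedding. (9) Let $R$ be a Dedekind domain and let $M$ be a non-faithful quasi-prime-embedding $R$-module. Then $M$ is cyclic.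
   Context: All rings are commutative with nonzero identity and all modules are unital. For a submodule $N$ of an $R$-module $M$, $(N:M)=\{r\in R\mid rM\subseteq N\}$ and $\mathrm{Ann}(M)=(\mathbf{0}:M)$; $M$ is faithful if $\mathrm{Ann}(M)=(0)$. A proper ideal $I$ of a ring is quasi-prime if for all ideals $A,B$, $A\cap B\subseteq I$ implies $A\subseteq I$ or $B\subseteq I$. A proper submodule $N$ of $M$ is quasi-prime if $(N:M)$ is a quasi-prime ideal of $R$; $q\mathrm{Spec}(M)$ is the set of all quasi-prime submodules of $M$. $M$ is quasi-prime-embedding if the natural map $\psi: q\mathrm{Spec}(M)\to q\mathrm{Spec}(R/\mathrm{Ann}(M))$, $\psi(L)=(L:M)/\mathrm{Ann}(M)$, is injective. A submodule $Q\neq M$ is primary if $rm\in Q$ ($r\in R$, $m\in M$) implies $m\in Q$ or $r\in\sqrt{(Q:M)}$. $M$ is Laskerian if every proper submodule of $M$ has a primary decomposition (is a finite intersection of primary submodules). $M$ is a multiplication module if every submodule of $M$ has the form $IM$ for some ideal $I$ of $R$. $M$ is locally cyclic if $M_{\mathfrak p}$ is a cyclic $R_{\mathfrak p}$-module for every prime ideal $\mathfrak p$ of $R$. A ring is serial if its ideals are linearly ordered by inclusion; $R$ is arithmetical if $R_{\mathfrak p}$ is serial for every maximal ideal $\mathfrak p$ of $R$. Semi-local means having only finitely many maximal ideals. *)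

theory Defs
  imports "HOL-Algebra.Module" "HOL-Algebra.QuotRing" "HOL-Algebra.Ring_Divisibility"
    "HOL-Algebra.Polynomials"
begin

section \<open>Submodules, colon ideals and quasi-prime submodules\<close>

definition colon :: "('a, 'r) ring_scheme \<Rightarrow> ('a, 'b, 'm) module_scheme \<Rightarrow> 'b set \<Rightarrow> 'a set"
  where "colon R M N = {r \<in> carrier R. \<forall>x \<in> carrier M. r \<odot>\<^bsub>M\<^esub> x \<in> N}"

definition module_annihilator :: "('a, 'r) ring_scheme \<Rightarrow> ('a, 'b, 'm) module_scheme \<Rightarrow> 'a set"
  where "module_annihilator R M = colon R M {\<zero>\<^bsub>M\<^esub>}"

definition faithful_module :: "('a, 'r) ring_scheme \<Rightarrow> ('a, 'b, 'm) module_scheme \<Rightarrow> bool"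
  where "faithful_module R M \<longleftrightarrow> module_annihilator R M = {\<zero>\<^bsub>R\<^esub>}"

definition quasi_prime_ideal :: "'a set \<Rightarrow> ('a, 'r) ring_scheme \<Rightarrow> bool"
  where "quasi_prime_ideal I R \<longleftrightarrow> ideal I R \<and> I \<noteq> carrier R \<and>
    (\<forall>A B. ideal A R \<and> ideal B R \<and> A \<inter> B \<subseteq> I \<longrightarrow> A \<subseteq> I \<or> B \<subseteq> I)"

definition quasi_prime_submodule ::
    "'b set \<Rightarrow> ('a, 'r) ring_scheme \<Rightarrow> ('a, 'b, 'm) module_scheme \<Rightarrow> bool"
  where "quasi_prime_submodule N R M \<longleftrightarrow>
    submodule N R M \<and> N \<noteq> carrier M \<and> quasi_prime_ideal (colon R M N) R"

definition ring_qSpec :: "('a, 'r) ring_scheme \<Rightarrow> 'a set set"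
  where "ring_qSpec R = {I. quasi_prime_ideal I R}"

definition module_qSpec :: "('a, 'r) ring_scheme \<Rightarrow> ('a, 'b, 'm) module_scheme \<Rightarrow> 'b set set"
  where "module_qSpec R M = {N. quasi_prime_submodule N R M}"

text \<open>The natural map from \<^term>\<open>module_qSpec R M\<close> to the quasi-prime spectrum of the quotient
  ring by the annihilator; the ideal \<open>(L:M)/Ann(M)\<close> is the set of cosets of the elements of
  \<open>(L:M)\<close>.  Lemma \<open>qSpec_map_in_ring_qSpec\<close> below shows that it is well defined.\<close>

definition qSpec_map :: "('a, 'r) ring_scheme \<Rightarrow> ('a, 'b, 'm) module_scheme \<Rightarrow> 'b set \<Rightarrow> 'a set set"
  where "qSpec_map R M L = (+>\<^bsub>R\<^esub>) (module_annihilator R M) ` colon R M L"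

definition quasi_prime_embedding :: "('a, 'r) ring_scheme \<Rightarrow> ('a, 'b, 'm) module_scheme \<Rightarrow> bool"
  where "quasi_prime_embedding R M \<longleftrightarrow> inj_on (qSpec_map R M) (module_qSpec R M)"


section \<open>Primary submodules and Laskerian modules\<close>

definition ideal_radical :: "('a, 'r) ring_scheme \<Rightarrow> 'a set \<Rightarrow> 'a set"
  where "ideal_radical R I = {r \<in> carrier R. \<exists>n::nat. r [^]\<^bsub>R\<^esub> n \<in> I}"

definition primary_submodule ::
    "'b set \<Rightarrow> ('a, 'r) ring_scheme \<Rightarrow> ('a, 'b, 'm) module_scheme \<Rightarrow> bool"
  where "primary_submodule Q R M \<longleftrightarrow> submodule Q R M \<and> Q \<noteq> carrier M \<and>
    (\<forall>r \<in> carrier R. \<forall>x \<in> carrier M.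
      r \<odot>\<^bsub>M\<^esub> x \<in> Q \<longrightarrow> x \<in> Q \<or> r \<in> ideal_radical R (colon R M Q))"

definition Laskerian_module :: "('a, 'r) ring_scheme \<Rightarrow> ('a, 'b, 'm) module_scheme \<Rightarrow> bool"
  where "Laskerian_module R M \<longleftrightarrow> (\<forall>N. submodule N R M \<and> N \<noteq> carrier M \<longrightarrow>
    (\<exists>F. finite F \<and> F \<noteq> {} \<and> (\<forall>Q \<in> F. primary_submodule Q R M) \<and> N = \<Inter>F))"


section \<open>Generation, freeness, projectivity\<close>

definition module_span ::
    "('a, 'r) ring_scheme \<Rightarrow> ('a, 'b, 'm) module_scheme \<Rightarrow> 'b set \<Rightarrow> 'b set"
  where "module_span R M G = \<Inter>{N. submodule N R M \<and> G \<subseteq> N}"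

definition finitely_generated_module ::
    "('a, 'r) ring_scheme \<Rightarrow> ('a, 'b, 'm) module_scheme \<Rightarrow> bool"
  where "finitely_generated_module R M \<longleftrightarrow>
    (\<exists>G \<subseteq> carrier M. finite G \<and> module_span R M G = carrier M)"

definition cyclic_module :: "('a, 'r) ring_scheme \<Rightarrow> ('a, 'b, 'm) module_scheme \<Rightarrow> bool"
  where "cyclic_module R M \<longleftrightarrow> (\<exists>x \<in> carrier M. carrier M = {r \<odot>\<^bsub>M\<^esub> x | r. r \<in> carrier R})"

definition ideal_smult ::
    "('a, 'r) ring_scheme \<Rightarrow> ('a, 'b, 'm) module_scheme \<Rightarrow> 'a set \<Rightarrow> 'b set"
  where "ideal_smult R M I = module_span R M {a \<odot>\<^bsub>M\<^esub> x | a x. a \<in> I \<and> x \<in> carrier M}"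

definition multiplication_module :: "('a, 'r) ring_scheme \<Rightarrow> ('a, 'b, 'm) module_scheme \<Rightarrow> bool"
  where "multiplication_module R M \<longleftrightarrow>
    (\<forall>N. submodule N R M \<longrightarrow> (\<exists>I. ideal I R \<and> N = ideal_smult R M I))"

definition linearly_independent ::
    "('a, 'r) ring_scheme \<Rightarrow> ('a, 'b, 'm) module_scheme \<Rightarrow> 'b set \<Rightarrow> bool"
  where "linearly_independent R M B \<longleftrightarrow> (\<forall>F c. finite F \<and> F \<subseteq> B \<and> c \<in> F \<rightarrow> carrier R \<and>
    (\<Oplus>\<^bsub>M\<^esub>x\<in>F. c x \<odot>\<^bsub>M\<^esub> x) = \<zero>\<^bsub>M\<^esub> \<longrightarrow> (\<forall>x \<in> F. c x = \<zero>\<^bsub>R\<^esub>))"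

definition free_module :: "('a, 'r) ring_scheme \<Rightarrow> ('a, 'b, 'm) module_scheme \<Rightarrow> bool"
  where "free_module R M \<longleftrightarrow>
    (\<exists>B \<subseteq> carrier M. linearly_independent R M B \<and> module_span R M B = carrier M)"

definition mod_hom ::
    "('a, 'r) ring_scheme \<Rightarrow> ('a, 'b, 'm) module_scheme \<Rightarrow> ('a, 'c, 'n) module_scheme \<Rightarrow> ('b \<Rightarrow> 'c) set"
  where "mod_hom R M N = {f \<in> carrier M \<rightarrow> carrier N.
    (\<forall>x \<in> carrier M. \<forall>y \<in> carrier M. f (x \<oplus>\<^bsub>M\<^esub> y) = f x \<oplus>\<^bsub>N\<^esub> f y) \<and>
    (\<forall>r \<in> carrier R. \<forall>x \<in> carrier M. f (r \<odot>\<^bsub>M\<^esub> x) = r \<odot>\<^bsub>N\<^esub> f x)}"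

text \<open>Projectivity is the lifting property along surjections \<open>g : N \<rightarrow> P\<close>.  A HOL definition cannot
  quantify over the types carrying \<open>N\<close> and \<open>P\<close>, so these are fixed: \<open>N\<close> lives on
  \<open>'b \<Rightarrow> 'a\<close>, which carries the free module on the elements of \<open>M\<close>, and \<open>P\<close> on
  \<open>'b\<close>, which carries \<open>M\<close> itself.  Lemma \<open>projective_module_lift\<close> below shows that the lifting
  property then holds for modules on all types.\<close>

definition projective_module :: "('a, 'r) ring_scheme \<Rightarrow> ('a, 'b, 'm) module_scheme \<Rightarrow> bool"
  where "projective_module R M \<longleftrightarrow>
    (\<forall>(N :: ('a, 'b \<Rightarrow> 'a) module) (P :: ('a, 'b) module). \<forall>g f.
      module R N \<and> module R P \<and> g \<in> mod_hom R N P \<and> g ` carrier N = carrier P \<and>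
      f \<in> mod_hom R M P \<longrightarrow>
      (\<exists>h \<in> mod_hom R M N. \<forall>x \<in> carrier M. g (h x) = f x))"


section \<open>Localization\<close>

definition frac_rel ::
    "('a, 'r) ring_scheme \<Rightarrow> 'a set \<Rightarrow> ('a, 'b, 'm) module_scheme \<Rightarrow> (('b \<times> 'a) \<times> ('b \<times> 'a)) set"
  where "frac_rel R S M = {((x, s), (y, t)). x \<in> carrier M \<and> s \<in> S \<and> y \<in> carrier M \<and> t \<in> S \<and>
    (\<exists>u \<in> S. u \<odot>\<^bsub>M\<^esub> (t \<odot>\<^bsub>M\<^esub> x) = u \<odot>\<^bsub>M\<^esub> (s \<odot>\<^bsub>M\<^esub> y))}"

definition fraction ::
    "('a, 'r) ring_scheme \<Rightarrow> 'a set \<Rightarrow> ('a, 'b, 'm) module_scheme \<Rightarrow> 'b \<Rightarrow> 'a \<Rightarrow> ('b \<times> 'a) set"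
  where "fraction R S M x s = frac_rel R S M `` {(x, s)}"

definition regular_module :: "('a, 'r) ring_scheme \<Rightarrow> ('a, 'a) module"
  where "regular_module R = \<lparr>carrier = carrier R, mult = mult R, one = \<one>\<^bsub>R\<^esub>,
    zero = \<zero>\<^bsub>R\<^esub>, add = add R, smult = mult R\<rparr>"

text \<open>The fields \<^const>\<open>mult\<close> and \<^const>\<open>one\<close> of a module record carry no meaning.\<close>

definition localized_module ::
    "('a, 'r) ring_scheme \<Rightarrow> 'a set \<Rightarrow> ('a, 'b, 'm) module_scheme \<Rightarrow> (('a \<times> 'a) set, ('b \<times> 'a) set) module"
  where "localized_module R S M =
    \<lparr>carrier = (carrier M \<times> S) // frac_rel R S M,
     mult = undefined,
     one = undefined,
     zero = fraction R S M \<zero>\<^bsub>M\<^esub> \<one>\<^bsub>R\<^esub>,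
     add = (\<lambda>G H. \<Union>(x, s) \<in> G. \<Union>(y, t) \<in> H.
       fraction R S M (t \<odot>\<^bsub>M\<^esub> x \<oplus>\<^bsub>M\<^esub> s \<odot>\<^bsub>M\<^esub> y) (s \<otimes>\<^bsub>R\<^esub> t)),
     smult = (\<lambda>G H. \<Union>(a, s) \<in> G. \<Union>(y, t) \<in> H. fraction R S M (a \<odot>\<^bsub>M\<^esub> y) (s \<otimes>\<^bsub>R\<^esub> t))\<rparr>"

definition localized_ring :: "('a, 'r) ring_scheme \<Rightarrow> 'a set \<Rightarrow> ('a \<times> 'a) set ring"
  where "localized_ring R S = (let L = localized_module R S (regular_module R) in
    \<lparr>carrier = carrier L,
     mult = smult L,
     one = fraction R S (regular_module R) \<one>\<^bsub>R\<^esub> \<one>\<^bsub>R\<^esub>,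
     zero = zero L,
     add = add L\<rparr>)"

definition locally_cyclic_module :: "('a, 'r) ring_scheme \<Rightarrow> ('a, 'b, 'm) module_scheme \<Rightarrow> bool"
  where "locally_cyclic_module R M \<longleftrightarrow> (\<forall>P. primeideal P R \<longrightarrow>
    cyclic_module (localized_ring R (carrier R - P)) (localized_module R (carrier R - P) M))"


section \<open>Classes of rings\<close>

definition serial_ring :: "('a, 'r) ring_scheme \<Rightarrow> bool"
  where "serial_ring R \<longleftrightarrow> (\<forall>I J. ideal I R \<and> ideal J R \<longrightarrow> I \<subseteq> J \<or> J \<subseteq> I)"

definition arithmetical_ring :: "('a, 'r) ring_scheme \<Rightarrow> bool"
  where "arithmetical_ring R \<longleftrightarrow>
    (\<forall>P. maximalideal P R \<longrightarrow> serial_ring (localized_ring R (carrier R - P)))"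

definition semilocal_ring :: "('a, 'r) ring_scheme \<Rightarrow> bool"
  where "semilocal_ring R \<longleftrightarrow> finite {P. maximalideal P R}"

definition fraction_field :: "('a, 'r) ring_scheme \<Rightarrow> ('a \<times> 'a) set ring"
  where "fraction_field R = localized_ring R (carrier R - {\<zero>\<^bsub>R\<^esub>})"

definition fraction_field_base :: "('a, 'r) ring_scheme \<Rightarrow> ('a \<times> 'a) set set"
  where "fraction_field_base R =
    (\<lambda>r. fraction R (carrier R - {\<zero>\<^bsub>R\<^esub>}) (regular_module R) r \<one>\<^bsub>R\<^esub>) ` carrier R"

text \<open>Polynomials of HOL-Algebra are coefficient lists with the leading coefficient first.\<close>

definition integrally_closed_domain :: "('a, 'r) ring_scheme \<Rightarrow> bool"
  where "integrally_closed_domain R \<longleftrightarrow> domain R \<and> (let K = fraction_field R; A = fraction_field_base R in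
    \<forall>x \<in> carrier K.
      (\<exists>p. polynomial\<^bsub>K\<^esub> A p \<and> p \<noteq> [] \<and> hd p = \<one>\<^bsub>K\<^esub> \<and> ring.eval K p x = \<zero>\<^bsub>K\<^esub>) \<longrightarrow> x \<in> A)"

text \<open>Fields count as Dedekind domains.\<close>

definition Dedekind_domain :: "('a, 'r) ring_scheme \<Rightarrow> bool"
  where "Dedekind_domain R \<longleftrightarrow> noetherian_domain R \<and> integrally_closed_domain R \<and>
    (\<forall>P. primeideal P R \<and> P \<noteq> {\<zero>\<^bsub>R\<^esub>} \<longrightarrow> maximalideal P R)"


section \<open>Well-definedness of the natural map\<close>

lemma (in module) ideal_colon:
  assumes "submodule N R M" shows "ideal (colon R M N) R"
proof (rule idealI)
  note E = submoduleE[OF assms]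
  have z: "\<zero>\<^bsub>M\<^esub> \<in> N"
    using subgroup.one_closed[OF submodule.axioms(1)[OF assms]] by simp
  show "ring R" by unfold_locales
  show "subgroup (colon R M N) (add_monoid R)"
    using E z by (intro R.add.subgroupI)
      (auto simp: colon_def smult_l_minus smult_l_distr simp flip: a_inv_def intro!: exI[of _ \<zero>])
  fix a x assume a: "a \<in> colon R M N" and x: "x \<in> carrier R"
  then show xa: "x \<otimes> a \<in> colon R M N"
    using E by (auto simp: colon_def smult_assoc1)
  with a x show "a \<otimes> x \<in> colon R M N"
    by (simp add: colon_def R.m_comm)
qed

lemma qSpec_map_in_ring_qSpec:
  assumes "module R M" "L \<in> module_qSpec R M"
  shows "qSpec_map R M L \<in> ring_qSpec (R Quot module_annihilator R M)"
proof -
  interpret module R M by fact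
  define A where "A = module_annihilator R M"
  define I where "I = colon R M L"
  have L: "submodule L R M" and qI: "quasi_prime_ideal I R"
    using assms(2) by (auto simp: module_qSpec_def quasi_prime_submodule_def I_def)
  have z: "\<zero>\<^bsub>M\<^esub> \<in> L"
    using subgroup.one_closed[OF submodule.axioms(1)[OF L]] by simp
  have "submodule {\<zero>\<^bsub>M\<^esub>} R M"
    by (rule submoduleI) auto
  then have A: "ideal A R"
    unfolding A_def module_annihilator_def by (rule ideal_colon)
  have I: "ideal I R" and Ine: "I \<noteq> carrier R" using qI by (auto simp: quasi_prime_ideal_def)
  have AI: "A \<subseteq> I"
    using z by (auto simp: A_def I_def module_annihilator_def colon_def)
  let ?Q = "R Quot A" and ?f = "\<lambda>J. (+>\<^bsub>R\<^esub>) A ` J"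
  have bij: "bij_betw ?f {J. ideal J R \<and> A \<subseteq> J} {J. ideal J ?Q}"
    by (rule R.quot_ideal_correspondence[OF A])
  have inv: "\<Union> (?f J) = J" if "ideal J R" "A \<subseteq> J" for J
    using R.ideal_incl_iff[OF A that(1)] that(2) by blast
  have carr: "?f (carrier R) = carrier ?Q"
    by (auto simp: FactRing_def A_RCOSETS_def')
  have qs: "quasi_prime_ideal (?f I) ?Q"
    unfolding quasi_prime_ideal_def
  proof (intro conjI allI impI)
    show "ideal (?f I) ?Q" by (rule R.ring_ideal_imp_quot_ideal[OF A I])
    show "?f I \<noteq> carrier ?Q"
    proof
      assume "?f I = carrier ?Q"
      then have "?f I = ?f (carrier R)" by (simp add: carr)
      then have "\<Union> (?f I) = \<Union> (?f (carrier R))" by simp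
      moreover have "A \<subseteq> carrier R"
        using A additive_subgroup.a_subset ideal.axioms(1) by blast
      ultimately show False using Ine unfolding inv[OF I AI] by (simp only: inv[OF R.oneideal])
    qed
    fix B C assume H: "ideal B ?Q \<and> ideal C ?Q \<and> B \<inter> C \<subseteq> ?f I"
    have surj: "\<exists>J'. ideal J' R \<and> A \<subseteq> J' \<and> J = ?f J'" if "ideal J ?Q" for J
    proof -
      have "J \<in> ?f ` {J. ideal J R \<and> A \<subseteq> J}"
        unfolding bij_betw_imp_surj_on[OF bij] using that by blast
      then show ?thesis by (elim imageE) blast
    qed
    from surj[of B] H obtain B' where B': "ideal B' R" "A \<subseteq> B'" "B = ?f B'" by blast
    from surj[of C] H obtain C' where C': "ideal C' R" "A \<subseteq> C'" "C = ?f C'" by blast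
    have "?f (B' \<inter> C') \<subseteq> ?f I" using H B' C' by blast
    then have "\<Union> (?f (B' \<inter> C')) \<subseteq> \<Union> (?f I)" by blast
    then have "B' \<inter> C' \<subseteq> I"
      unfolding inv[OF I AI] using inv[OF R.i_intersect[OF B'(1) C'(1)]] B'(2) C'(2) by auto
    then have "B' \<subseteq> I \<or> C' \<subseteq> I" using qI B' C' by (auto simp: quasi_prime_ideal_def)
    then show "B \<subseteq> ?f I \<or> C \<subseteq> ?f I" using B' C' by blast
  qed
  then show ?thesis by (simp add: ring_qSpec_def qSpec_map_def A_def I_def)
qed


section \<open>Localizations are rings and modules\<close>

lemma regular_module_simps [simp]:
  "carrier (regular_module R) = carrier R" "zero (regular_module R) = zero R"
  "add (regular_module R) = add R" "smult (regular_module R) = mult R"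
  by (simp_all add: regular_module_def)

lemma module_regular_module:
  assumes "cring R" shows "module R (regular_module R)"
proof -
  interpret cring R by fact
  show ?thesis
    by (intro moduleI abelian_groupI assms) (auto simp: a_ac l_distr r_distr m_assoc intro: l_neg)
qed

locale localization = module R M + S: submonoid S R for R (structure) and M (structure) and S
begin

lemma S_carr [simp]: "s \<in> S \<Longrightarrow> s \<in> carrier R" using S.subset by blast

lemma equiv_frac_rel: "equiv (carrier M \<times> S) (frac_rel R S M)"
proof (rule equivI)
  show "frac_rel R S M \<subseteq> (carrier M \<times> S) \<times> (carrier M \<times> S)" by (auto simp: frac_rel_def)
  show "refl_on (carrier M \<times> S) (frac_rel R S M)"
    using S.one_closed by (auto simp: refl_on_def frac_rel_def)
  show "sym (frac_rel R S M)"
    by (auto simp: sym_def frac_rel_def) metis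
  show "trans (frac_rel R S M)"
  proof (rule transI, clarsimp simp: frac_rel_def)
    fix x s y t z w u v
    assume c: "x \<in> carrier M" "s \<in> S" "y \<in> carrier M" "t \<in> S" "z \<in> carrier M" "w \<in> S" "u \<in> S" "v \<in> S"
      and 1: "u \<odot>\<^bsub>M\<^esub> (t \<odot>\<^bsub>M\<^esub> x) = u \<odot>\<^bsub>M\<^esub> (s \<odot>\<^bsub>M\<^esub> y)"
      and 2: "v \<odot>\<^bsub>M\<^esub> (w \<odot>\<^bsub>M\<^esub> y) = v \<odot>\<^bsub>M\<^esub> (t \<odot>\<^bsub>M\<^esub> z)"
    have "(u \<otimes> v \<otimes> t) \<odot>\<^bsub>M\<^esub> (w \<odot>\<^bsub>M\<^esub> x) = (v \<otimes> w) \<odot>\<^bsub>M\<^esub> (u \<odot>\<^bsub>M\<^esub> (t \<odot>\<^bsub>M\<^esub> x))"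
      using c by (simp add: R.m_ac flip: smult_assoc1)
    also have "\<dots> = (u \<otimes> s) \<odot>\<^bsub>M\<^esub> (v \<odot>\<^bsub>M\<^esub> (w \<odot>\<^bsub>M\<^esub> y))"
      unfolding 1 using c by (simp add: R.m_ac flip: smult_assoc1)
    also have "\<dots> = (u \<otimes> v \<otimes> t) \<odot>\<^bsub>M\<^esub> (s \<odot>\<^bsub>M\<^esub> z)"
      unfolding 2 using c by (simp add: R.m_ac flip: smult_assoc1)
    finally show "\<exists>u\<in>S. u \<odot>\<^bsub>M\<^esub> (w \<odot>\<^bsub>M\<^esub> x) = u \<odot>\<^bsub>M\<^esub> (s \<odot>\<^bsub>M\<^esub> z)"
      using c by (meson S.m_closed)
  qed
qed

lemma frac_eq_iff:
  assumes "x \<in> carrier M" "s \<in> S" "y \<in> carrier M" "t \<in> S"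
  shows "fraction R S M x s = fraction R S M y t \<longleftrightarrow>
    (\<exists>u \<in> S. u \<odot>\<^bsub>M\<^esub> (t \<odot>\<^bsub>M\<^esub> x) = u \<odot>\<^bsub>M\<^esub> (s \<odot>\<^bsub>M\<^esub> y))"
  using eq_equiv_class_iff[OF equiv_frac_rel, of "(x, s)" "(y, t)"] assms
  by (simp add: fraction_def frac_rel_def)

lemma frac_eqI:
  assumes "x \<in> carrier M" "s \<in> S" "y \<in> carrier M" "t \<in> S" "t \<odot>\<^bsub>M\<^esub> x = s \<odot>\<^bsub>M\<^esub> y"
  shows "fraction R S M x s = fraction R S M y t"
  using assms S.one_closed by (subst frac_eq_iff) auto

lemma localized_carrierE:
  assumes "a \<in> carrier (localized_module R S M)"
  obtains x s where "x \<in> carrier M" "s \<in> S" "a = fraction R S M x s"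
  using assms by (auto simp: localized_module_def fraction_def elim!: quotientE)

lemma frac_in_carrier [simp]:
  "x \<in> carrier M \<Longrightarrow> s \<in> S \<Longrightarrow> fraction R S M x s \<in> carrier (localized_module R S M)"
  by (auto simp: localized_module_def fraction_def intro!: quotientI)

lemma zero_localized [simp]: "\<zero>\<^bsub>localized_module R S M\<^esub> = fraction R S M \<zero>\<^bsub>M\<^esub> \<one>"
  by (simp add: localized_module_def)

lemma add_frac [simp]:
  assumes "x \<in> carrier M" "s \<in> S" "y \<in> carrier M" "t \<in> S"
  shows "fraction R S M x s \<oplus>\<^bsub>localized_module R S M\<^esub> fraction R S M y t =
    fraction R S M (t \<odot>\<^bsub>M\<^esub> x \<oplus>\<^bsub>M\<^esub> s \<odot>\<^bsub>M\<^esub> y) (s \<otimes> t)"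
proof -
  let ?f = "\<lambda>p q. case p of (x, s) \<Rightarrow> (case q of (y, t) \<Rightarrow>
    fraction R S M (t \<odot>\<^bsub>M\<^esub> x \<oplus>\<^bsub>M\<^esub> s \<odot>\<^bsub>M\<^esub> y) (s \<otimes> t))"
  have "congruent2 (frac_rel R S M) (frac_rel R S M) ?f"
  proof (rule congruent2I', clarify, unfold frac_rel_def, clarsimp)
    fix x s x' s' y t y' t' u v
    assume c: "x \<in> carrier M" "s \<in> S" "x' \<in> carrier M" "s' \<in> S" "u \<in> S"
      "y \<in> carrier M" "t \<in> S" "y' \<in> carrier M" "t' \<in> S" "v \<in> S"
      and 1: "u \<odot>\<^bsub>M\<^esub> (s' \<odot>\<^bsub>M\<^esub> x) = u \<odot>\<^bsub>M\<^esub> (s \<odot>\<^bsub>M\<^esub> x')"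
      and 2: "v \<odot>\<^bsub>M\<^esub> (t' \<odot>\<^bsub>M\<^esub> y) = v \<odot>\<^bsub>M\<^esub> (t \<odot>\<^bsub>M\<^esub> y')"
    have e1: "(u \<otimes> v) \<odot>\<^bsub>M\<^esub> ((s' \<otimes> t') \<odot>\<^bsub>M\<^esub> (t \<odot>\<^bsub>M\<^esub> x)) = (u \<otimes> v) \<odot>\<^bsub>M\<^esub> ((s \<otimes> t) \<odot>\<^bsub>M\<^esub> (t' \<odot>\<^bsub>M\<^esub> x'))"
    proof -
      have "(u \<otimes> v) \<odot>\<^bsub>M\<^esub> ((s' \<otimes> t') \<odot>\<^bsub>M\<^esub> (t \<odot>\<^bsub>M\<^esub> x)) = (v \<otimes> (t' \<otimes> t)) \<odot>\<^bsub>M\<^esub> (u \<odot>\<^bsub>M\<^esub> (s' \<odot>\<^bsub>M\<^esub> x))"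
        using c by (simp add: R.m_ac flip: smult_assoc1)
      also have "\<dots> = (u \<otimes> v) \<odot>\<^bsub>M\<^esub> ((s \<otimes> t) \<odot>\<^bsub>M\<^esub> (t' \<odot>\<^bsub>M\<^esub> x'))"
        unfolding 1 using c by (simp add: R.m_ac flip: smult_assoc1)
      finally show ?thesis .
    qed
    have e2: "(u \<otimes> v) \<odot>\<^bsub>M\<^esub> ((s' \<otimes> t') \<odot>\<^bsub>M\<^esub> (s \<odot>\<^bsub>M\<^esub> y)) = (u \<otimes> v) \<odot>\<^bsub>M\<^esub> ((s \<otimes> t) \<odot>\<^bsub>M\<^esub> (s' \<odot>\<^bsub>M\<^esub> y'))"
    proof -
      have "(u \<otimes> v) \<odot>\<^bsub>M\<^esub> ((s' \<otimes> t') \<odot>\<^bsub>M\<^esub> (s \<odot>\<^bsub>M\<^esub> y)) = (u \<otimes> (s' \<otimes> s)) \<odot>\<^bsub>M\<^esub> (v \<odot>\<^bsub>M\<^esub> (t' \<odot>\<^bsub>M\<^esub> y))"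
        using c by (simp add: R.m_ac flip: smult_assoc1)
      also have "\<dots> = (u \<otimes> v) \<odot>\<^bsub>M\<^esub> ((s \<otimes> t) \<odot>\<^bsub>M\<^esub> (s' \<odot>\<^bsub>M\<^esub> y'))"
        unfolding 2 using c by (simp add: R.m_ac flip: smult_assoc1)
      finally show ?thesis .
    qed
    show "fraction R S M (t \<odot>\<^bsub>M\<^esub> x \<oplus>\<^bsub>M\<^esub> s \<odot>\<^bsub>M\<^esub> y) (s \<otimes> t) =
       fraction R S M (t' \<odot>\<^bsub>M\<^esub> x' \<oplus>\<^bsub>M\<^esub> s' \<odot>\<^bsub>M\<^esub> y') (s' \<otimes> t')"
      using c e1 e2 by (subst frac_eq_iff) (auto simp: smult_r_distr intro!: bexI[of _ "u \<otimes> v"])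
  qed
  from UN_equiv_class2[OF equiv_frac_rel equiv_frac_rel this, of "(x, s)" "(y, t)"] assms
  show ?thesis by (simp add: localized_module_def case_prod_unfold flip: fraction_def)
qed

lemma regular_localization: "localization R (regular_module R) S"
  by (intro localization.intro module_regular_module R.is_cring S.submonoid_axioms)

lemma smult_frac [simp]:
  assumes "a \<in> carrier R" "s \<in> S" "y \<in> carrier M" "t \<in> S"
  shows "fraction R S (regular_module R) a s \<odot>\<^bsub>localized_module R S M\<^esub> fraction R S M y t =
    fraction R S M (a \<odot>\<^bsub>M\<^esub> y) (s \<otimes> t)"
proof -
  let ?f = "\<lambda>p q. case p of (a, s) \<Rightarrow> (case q of (y, t) \<Rightarrow> fraction R S M (a \<odot>\<^bsub>M\<^esub> y) (s \<otimes> t))"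
  have "congruent2 (frac_rel R S (regular_module R)) (frac_rel R S M) ?f"
  proof (rule congruent2I', clarify, unfold frac_rel_def, clarsimp)
    fix a s a' s' y t y' t' u v
    assume c: "a \<in> carrier R" "s \<in> S" "a' \<in> carrier R" "s' \<in> S" "u \<in> S"
      "y \<in> carrier M" "t \<in> S" "y' \<in> carrier M" "t' \<in> S" "v \<in> S"
      and 1: "u \<otimes> (s' \<otimes> a) = u \<otimes> (s \<otimes> a')"
      and 2: "v \<odot>\<^bsub>M\<^esub> (t' \<odot>\<^bsub>M\<^esub> y) = v \<odot>\<^bsub>M\<^esub> (t \<odot>\<^bsub>M\<^esub> y')"
    have "(u \<otimes> v) \<odot>\<^bsub>M\<^esub> ((s' \<otimes> t') \<odot>\<^bsub>M\<^esub> (a \<odot>\<^bsub>M\<^esub> y)) = (u \<otimes> (s' \<otimes> a)) \<odot>\<^bsub>M\<^esub> (v \<odot>\<^bsub>M\<^esub> (t' \<odot>\<^bsub>M\<^esub> y))"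
      using c by (simp add: R.m_ac flip: smult_assoc1)
    also have "\<dots> = (u \<otimes> v) \<odot>\<^bsub>M\<^esub> ((s \<otimes> t) \<odot>\<^bsub>M\<^esub> (a' \<odot>\<^bsub>M\<^esub> y'))"
      unfolding 1 2 using c by (simp add: R.m_ac flip: smult_assoc1)
    finally show "fraction R S M (a \<odot>\<^bsub>M\<^esub> y) (s \<otimes> t) = fraction R S M (a' \<odot>\<^bsub>M\<^esub> y') (s' \<otimes> t')"
      using c by (subst frac_eq_iff) (auto intro!: bexI[of _ "u \<otimes> v"])
  qed
  from UN_equiv_class2[OF localization.equiv_frac_rel[OF regular_localization] equiv_frac_rel this,
      of "(a, s)" "(y, t)"] assms
  show ?thesis by (simp add: localized_module_def case_prod_unfold flip: fraction_def)
qed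

lemma abelian_group_localized: "abelian_group (localized_module R S M)"
proof (rule abelian_groupI)
  let ?L = "localized_module R S M"
  show "\<zero>\<^bsub>?L\<^esub> \<in> carrier ?L" by simp
  fix a assume "a \<in> carrier ?L"
  then obtain x s where a: "x \<in> carrier M" "s \<in> S" "a = fraction R S M x s"
    by (rule localized_carrierE)
  show "\<zero>\<^bsub>?L\<^esub> \<oplus>\<^bsub>?L\<^esub> a = a" using a by simp
  have "fraction R S M (\<ominus>\<^bsub>M\<^esub> x) s \<oplus>\<^bsub>?L\<^esub> a = \<zero>\<^bsub>?L\<^esub>"
    using a by (auto simp: smult_r_minus M.l_neg intro!: frac_eqI del: equalityI subsetI)
  with a show "\<exists>b\<in>carrier ?L. b \<oplus>\<^bsub>?L\<^esub> a = \<zero>\<^bsub>?L\<^esub>"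
    by (meson M.a_inv_closed frac_in_carrier)
  fix b assume "b \<in> carrier ?L"
  then obtain y t where b: "y \<in> carrier M" "t \<in> S" "b = fraction R S M y t"
    by (rule localized_carrierE)
  show "a \<oplus>\<^bsub>?L\<^esub> b \<in> carrier ?L" using a b by simp
  show "a \<oplus>\<^bsub>?L\<^esub> b = b \<oplus>\<^bsub>?L\<^esub> a" using a b by (simp add: M.a_comm R.m_comm)
  fix c assume "c \<in> carrier ?L"
  then obtain z w where c: "z \<in> carrier M" "w \<in> S" "c = fraction R S M z w"
    by (rule localized_carrierE)
  show "a \<oplus>\<^bsub>?L\<^esub> b \<oplus>\<^bsub>?L\<^esub> c = a \<oplus>\<^bsub>?L\<^esub> (b \<oplus>\<^bsub>?L\<^esub> c)" using a b c
    by (simp add: smult_r_distr M.a_ac R.m_ac flip: smult_assoc1)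
qed

end

lemma localized_ring_simps [simp]:
  "carrier (localized_ring R S) = carrier (localized_module R S (regular_module R))"
  "mult (localized_ring R S) = smult (localized_module R S (regular_module R))"
  "one (localized_ring R S) = fraction R S (regular_module R) \<one>\<^bsub>R\<^esub> \<one>\<^bsub>R\<^esub>"
  "zero (localized_ring R S) = zero (localized_module R S (regular_module R))"
  "add (localized_ring R S) = add (localized_module R S (regular_module R))"
  by (simp_all add: localized_ring_def Let_def)

lemma cring_localized_ring:
  assumes "cring R" "submonoid S R"
  shows "cring (localized_ring R S)"
proof -
  interpret R: cring R by fact
  interpret L: localization R "regular_module R" S
    using assms by (intro localization.intro module_regular_module)
  let ?L = "localized_ring R S"
  interpret L: abelian_group "localized_module R S (regular_module R)"
    by (rule L.abelian_group_localized)
  have K: "\<exists>x s. x \<in> carrier R \<and> s \<in> S \<and> a = fraction R S (regular_module R) x s"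
    if "a \<in> carrier ?L" for a
    using that by (auto elim!: L.localized_carrierE)
  show ?thesis
  proof (rule cringI)
    show "abelian_group ?L"
    proof (rule abelian_groupI)
      fix a assume "a \<in> carrier ?L"
      then show "\<exists>b\<in>carrier ?L. b \<oplus>\<^bsub>?L\<^esub> a = \<zero>\<^bsub>?L\<^esub>"
        using L.l_neg L.a_inv_closed by auto
    qed (auto simp: L.a_ac simp del: L.zero_localized)
    show "comm_monoid ?L"
    proof (rule comm_monoidI)
      show "\<one>\<^bsub>?L\<^esub> \<in> carrier ?L" by simp
      fix a assume "a \<in> carrier ?L"
      then obtain x s where a: "x \<in> carrier R" "s \<in> S" "a = fraction R S (regular_module R) x s"
        using K by blast
      show "\<one>\<^bsub>?L\<^esub> \<otimes>\<^bsub>?L\<^esub> a = a" using a L.smult_frac by simp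
      fix b assume "b \<in> carrier ?L"
      then obtain y t where b: "y \<in> carrier R" "t \<in> S" "b = fraction R S (regular_module R) y t"
        using K by blast
      show "a \<otimes>\<^bsub>?L\<^esub> b \<in> carrier ?L" using a b L.smult_frac by simp
      show "a \<otimes>\<^bsub>?L\<^esub> b = b \<otimes>\<^bsub>?L\<^esub> a" using a b L.smult_frac by (simp add: R.m_comm)
      fix c assume "c \<in> carrier ?L"
      then obtain z w where c: "z \<in> carrier R" "w \<in> S" "c = fraction R S (regular_module R) z w"
        using K by blast
      show "a \<otimes>\<^bsub>?L\<^esub> b \<otimes>\<^bsub>?L\<^esub> c = a \<otimes>\<^bsub>?L\<^esub> (b \<otimes>\<^bsub>?L\<^esub> c)"
        using a b c L.smult_frac by (simp add: R.m_assoc)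
    qed
    fix a b c assume c: "a \<in> carrier ?L" "b \<in> carrier ?L" "c \<in> carrier ?L"
    obtain x s y t z w where
      "x \<in> carrier R" "s \<in> S" "a = fraction R S (regular_module R) x s"
      "y \<in> carrier R" "t \<in> S" "b = fraction R S (regular_module R) y t"
      "z \<in> carrier R" "w \<in> S" "c = fraction R S (regular_module R) z w"
      using K[OF c(1)] K[OF c(2)] K[OF c(3)] by blast
    then show "(a \<oplus>\<^bsub>?L\<^esub> b) \<otimes>\<^bsub>?L\<^esub> c = a \<otimes>\<^bsub>?L\<^esub> c \<oplus>\<^bsub>?L\<^esub> b \<otimes>\<^bsub>?L\<^esub> c"
      using L.smult_frac L.add_frac
      by (auto simp: R.l_distr R.r_distr R.m_ac intro!: L.frac_eqI del: equalityI subsetI)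
  qed
qed

lemma module_localized_module:
  assumes "module R M" "submonoid S R"
  shows "module (localized_ring R S) (localized_module R S M)"
proof -
  interpret L: localization R M S using assms by (intro localization.intro)
  interpret K: localization R "regular_module R" S by (rule L.regular_localization)
  let ?K = "localized_ring R S" and ?L = "localized_module R S M"
  have K: "\<exists>x s. x \<in> carrier R \<and> s \<in> S \<and> a = fraction R S (regular_module R) x s"
    if "a \<in> carrier ?K" for a
    using that by (auto elim!: K.localized_carrierE)
  have L: "\<exists>x s. x \<in> carrier M \<and> s \<in> S \<and> a = fraction R S M x s" if "a \<in> carrier ?L" for a
    using that by (auto elim!: L.localized_carrierE)
  note s = L.smult_r_distr L.smult_l_distr L.R.l_distr L.R.r_distr L.R.m_ac L.M.a_ac
  show ?thesis
  proof (rule moduleI)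
    show "cring ?K" by (rule cring_localized_ring[OF L.R.is_cring assms(2)])
    show "abelian_group ?L" by (rule L.abelian_group_localized)
    fix a b x y assume c: "a \<in> carrier ?K" "x \<in> carrier ?L"
    show "a \<odot>\<^bsub>?L\<^esub> x \<in> carrier ?L" using K[OF c(1)] L[OF c(2)] by auto
    assume b: "b \<in> carrier ?K"
    show "(a \<oplus>\<^bsub>?K\<^esub> b) \<odot>\<^bsub>?L\<^esub> x = a \<odot>\<^bsub>?L\<^esub> x \<oplus>\<^bsub>?L\<^esub> b \<odot>\<^bsub>?L\<^esub> x"
      using K[OF c(1)] L[OF c(2)] K[OF b] K.add_frac
      by (auto simp: s simp flip: L.smult_assoc1 intro!: L.frac_eqI del: equalityI subsetI)
    show "(a \<otimes>\<^bsub>?K\<^esub> b) \<odot>\<^bsub>?L\<^esub> x = a \<odot>\<^bsub>?L\<^esub> (b \<odot>\<^bsub>?L\<^esub> x)"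
      using K[OF c(1)] L[OF c(2)] K[OF b] K.smult_frac
      by (auto simp: s simp flip: L.smult_assoc1)
  next
    fix a x y assume c: "a \<in> carrier ?K" "x \<in> carrier ?L" "y \<in> carrier ?L"
    show "a \<odot>\<^bsub>?L\<^esub> (x \<oplus>\<^bsub>?L\<^esub> y) = a \<odot>\<^bsub>?L\<^esub> x \<oplus>\<^bsub>?L\<^esub> a \<odot>\<^bsub>?L\<^esub> y"
      using K[OF c(1)] L[OF c(2)] L[OF c(3)]
      by (auto simp: s simp flip: L.smult_assoc1 intro!: L.frac_eqI del: equalityI subsetI)
  next
    fix x assume c: "x \<in> carrier ?L"
    show "\<one>\<^bsub>?K\<^esub> \<odot>\<^bsub>?L\<^esub> x = x" using L[OF c] by auto
  qed
qed


section \<open>The lifting property of projective modules on all types\<close>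

definition finsupp_module :: "('a, 'r) ring_scheme \<Rightarrow> 'b set \<Rightarrow> ('a, 'b \<Rightarrow> 'a) module"
  where "finsupp_module R B =
    \<lparr>carrier = {c. range c \<subseteq> carrier R \<and> finite {x. c x \<noteq> \<zero>\<^bsub>R\<^esub>} \<and> {x. c x \<noteq> \<zero>\<^bsub>R\<^esub>} \<subseteq> B},
     mult = undefined, one = undefined, zero = (\<lambda>_. \<zero>\<^bsub>R\<^esub>),
     add = (\<lambda>c d x. c x \<oplus>\<^bsub>R\<^esub> d x), smult = (\<lambda>r c x. r \<otimes>\<^bsub>R\<^esub> c x)\<rparr>"

lemma module_finsupp_module:
  assumes "cring R" shows "module R (finsupp_module R B)"
proof -
  interpret cring R by fact
  let ?F = "finsupp_module R B"
  have sub: "finite {x. h x \<noteq> \<zero>\<^bsub>R\<^esub>} \<and> {x. h x \<noteq> \<zero>\<^bsub>R\<^esub>} \<subseteq> B"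
    if "c \<in> carrier ?F" "d \<in> carrier ?F" "\<And>x. c x = \<zero>\<^bsub>R\<^esub> \<Longrightarrow> d x = \<zero>\<^bsub>R\<^esub> \<Longrightarrow> h x = \<zero>\<^bsub>R\<^esub>" for c d h
  proof -
    have "{x. h x \<noteq> \<zero>\<^bsub>R\<^esub>} \<subseteq> {x. c x \<noteq> \<zero>\<^bsub>R\<^esub>} \<union> {x. d x \<noteq> \<zero>\<^bsub>R\<^esub>}" using that(3) by blast
    moreover have "finite ({x. c x \<noteq> \<zero>\<^bsub>R\<^esub>} \<union> {x. d x \<noteq> \<zero>\<^bsub>R\<^esub>})"
      "{x. c x \<noteq> \<zero>\<^bsub>R\<^esub>} \<union> {x. d x \<noteq> \<zero>\<^bsub>R\<^esub>} \<subseteq> B"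
      using that(1,2) by (auto simp: finsupp_module_def)
    ultimately show ?thesis by (meson finite_subset order_trans)
  qed
  have carr: "c x \<in> carrier R" if "c \<in> carrier ?F" for c x
    using that by (auto simp: finsupp_module_def)
  have memI: "h \<in> carrier ?F" if "\<And>x. h x \<in> carrier R"
    "finite {x. h x \<noteq> \<zero>\<^bsub>R\<^esub>} \<and> {x. h x \<noteq> \<zero>\<^bsub>R\<^esub>} \<subseteq> B" for h
    using that by (auto simp: finsupp_module_def)
  have ops: "\<zero>\<^bsub>?F\<^esub> = (\<lambda>_. \<zero>\<^bsub>R\<^esub>)" "c \<oplus>\<^bsub>?F\<^esub> d = (\<lambda>x. c x \<oplus>\<^bsub>R\<^esub> d x)" "r \<odot>\<^bsub>?F\<^esub> c = (\<lambda>x. r \<otimes>\<^bsub>R\<^esub> c x)" for c d r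
    by (simp_all add: finsupp_module_def)
  show ?thesis
  proof (rule moduleI[OF assms])
    show "abelian_group ?F"
    proof (rule abelian_groupI)
      show "\<zero>\<^bsub>?F\<^esub> \<in> carrier ?F" by (simp add: finsupp_module_def)
      fix c assume c: "c \<in> carrier ?F"
      show "\<zero>\<^bsub>?F\<^esub> \<oplus>\<^bsub>?F\<^esub> c = c" using carr[OF c] by (simp add: ops)
      have "(\<lambda>x. \<ominus>\<^bsub>R\<^esub> c x) \<in> carrier ?F" using carr[OF c] by (intro memI sub[OF c c]) auto
      moreover have "(\<lambda>x. \<ominus>\<^bsub>R\<^esub> c x) \<oplus>\<^bsub>?F\<^esub> c = \<zero>\<^bsub>?F\<^esub>" using carr[OF c] by (simp add: ops l_neg)
      ultimately show "\<exists>d\<in>carrier ?F. d \<oplus>\<^bsub>?F\<^esub> c = \<zero>\<^bsub>?F\<^esub>" by blast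
      fix d assume d: "d \<in> carrier ?F"
      show "c \<oplus>\<^bsub>?F\<^esub> d \<in> carrier ?F"
        unfolding ops using carr[OF c] carr[OF d] by (intro memI sub[OF c d]) auto
      show "c \<oplus>\<^bsub>?F\<^esub> d = d \<oplus>\<^bsub>?F\<^esub> c" using carr[OF c] carr[OF d] by (simp add: ops a_comm)
      fix e assume e: "e \<in> carrier ?F"
      show "c \<oplus>\<^bsub>?F\<^esub> d \<oplus>\<^bsub>?F\<^esub> e = c \<oplus>\<^bsub>?F\<^esub> (d \<oplus>\<^bsub>?F\<^esub> e)"
        using carr[OF c] carr[OF d] carr[OF e] by (simp add: ops a_assoc)
    qed
    fix r c assume r: "r \<in> carrier R" and c: "c \<in> carrier ?F"
    show "r \<odot>\<^bsub>?F\<^esub> c \<in> carrier ?F"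
      unfolding ops using r carr[OF c] by (intro memI sub[OF c c]) auto
  qed (auto simp: ops carr l_distr r_distr m_assoc)
qed

definition linear_extension ::
    "('a, 'r) ring_scheme \<Rightarrow> ('a, 'c, 'n) module_scheme \<Rightarrow> ('b \<Rightarrow> 'c) \<Rightarrow> ('b \<Rightarrow> 'a) \<Rightarrow> 'c"
  where "linear_extension R N k c = (\<Oplus>\<^bsub>N\<^esub>x\<in>{x. c x \<noteq> \<zero>\<^bsub>R\<^esub>}. c x \<odot>\<^bsub>N\<^esub> k x)"

lemma linear_extension_eq:
  assumes "module R N" "k \<in> B \<rightarrow> carrier N" "c \<in> carrier (finsupp_module R B)"
    "finite T" "{x. c x \<noteq> \<zero>\<^bsub>R\<^esub>} \<subseteq> T" "T \<subseteq> B"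
  shows "linear_extension R N k c = (\<Oplus>\<^bsub>N\<^esub>x\<in>T. c x \<odot>\<^bsub>N\<^esub> k x)"
proof -
  interpret module R N by fact
  have c: "c x \<in> carrier R" for x using assms(3) by (auto simp: finsupp_module_def)
  have k: "k x \<in> carrier N" if "x \<in> T" for x using that assms by blast
  show ?thesis unfolding linear_extension_def
    using assms(4,5) c k by (intro M.add.finprod_mono_neutral_cong_left) auto
qed

lemma linear_extension_hom:
  assumes "module R N" "k \<in> B \<rightarrow> carrier N"
  shows "linear_extension R N k \<in> mod_hom R (finsupp_module R B) N"
proof -
  interpret module R N by fact
  let ?F = "finsupp_module R B"
  interpret F: module R ?F by (rule module_finsupp_module[OF R.is_cring])
  have carr: "c x \<in> carrier R" if "c \<in> carrier ?F" for c x
    using that by (auto simp: finsupp_module_def)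
  have fin: "finite {x. c x \<noteq> \<zero>\<^bsub>R\<^esub>}" "{x. c x \<noteq> \<zero>\<^bsub>R\<^esub>} \<subseteq> B" if "c \<in> carrier ?F" for c
    using that by (auto simp: finsupp_module_def)
  have ops: "(c \<oplus>\<^bsub>?F\<^esub> d) x = c x \<oplus>\<^bsub>R\<^esub> d x" "(r \<odot>\<^bsub>?F\<^esub> c) x = r \<otimes>\<^bsub>R\<^esub> c x" for c d r x
    by (simp_all add: finsupp_module_def)
  show ?thesis unfolding mod_hom_def
  proof (intro CollectI conjI ballI Pi_I)
    fix c assume c: "c \<in> carrier ?F"
    show "linear_extension R N k c \<in> carrier N"
      unfolding linear_extension_def using carr[OF c] fin[OF c] assms(2)
      by (intro M.add.finprod_closed) auto
    fix d assume d: "d \<in> carrier ?F"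
    let ?T = "{x. c x \<noteq> \<zero>\<^bsub>R\<^esub>} \<union> {x. d x \<noteq> \<zero>\<^bsub>R\<^esub>}"
    have T: "finite ?T" "?T \<subseteq> B" using fin[OF c] fin[OF d] by auto
    have k: "k x \<in> carrier N" if "x \<in> ?T" for x using that T assms(2) by blast
    have "linear_extension R N k (c \<oplus>\<^bsub>?F\<^esub> d) = (\<Oplus>\<^bsub>N\<^esub>x\<in>?T. (c \<oplus>\<^bsub>?F\<^esub> d) x \<odot>\<^bsub>N\<^esub> k x)"
      using c d T by (intro linear_extension_eq[OF assms]) (auto simp: ops)
    also have "\<dots> = (\<Oplus>\<^bsub>N\<^esub>x\<in>?T. c x \<odot>\<^bsub>N\<^esub> k x \<oplus>\<^bsub>N\<^esub> d x \<odot>\<^bsub>N\<^esub> k x)"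
      using carr[OF c] carr[OF d] k by (intro M.add.finprod_cong') (auto simp: ops smult_l_distr)
    also have "\<dots> = (\<Oplus>\<^bsub>N\<^esub>x\<in>?T. c x \<odot>\<^bsub>N\<^esub> k x) \<oplus>\<^bsub>N\<^esub> (\<Oplus>\<^bsub>N\<^esub>x\<in>?T. d x \<odot>\<^bsub>N\<^esub> k x)"
      using carr[OF c] carr[OF d] k by (intro M.finsum_addf) auto
    also have "(\<Oplus>\<^bsub>N\<^esub>x\<in>?T. c x \<odot>\<^bsub>N\<^esub> k x) = linear_extension R N k c"
      using c T by (intro linear_extension_eq[OF assms, symmetric]) auto
    also have "(\<Oplus>\<^bsub>N\<^esub>x\<in>?T. d x \<odot>\<^bsub>N\<^esub> k x) = linear_extension R N k d"
      using d T by (intro linear_extension_eq[OF assms, symmetric]) auto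
    finally show "linear_extension R N k (c \<oplus>\<^bsub>?F\<^esub> d) =
      linear_extension R N k c \<oplus>\<^bsub>N\<^esub> linear_extension R N k d" .
  next
    fix r c assume r: "r \<in> carrier R" and c: "c \<in> carrier ?F"
    let ?T = "{x. c x \<noteq> \<zero>\<^bsub>R\<^esub>}"
    have T: "finite ?T" "?T \<subseteq> B" using fin[OF c] by auto
    have k: "k x \<in> carrier N" if "x \<in> ?T" for x using that T assms(2) by blast
    have "linear_extension R N k (r \<odot>\<^bsub>?F\<^esub> c) = (\<Oplus>\<^bsub>N\<^esub>x\<in>?T. (r \<odot>\<^bsub>?F\<^esub> c) x \<odot>\<^bsub>N\<^esub> k x)"
      using c r T by (intro linear_extension_eq[OF assms]) (auto simp: ops)
    also have "\<dots> = (\<Oplus>\<^bsub>N\<^esub>x\<in>?T. r \<odot>\<^bsub>N\<^esub> (c x \<odot>\<^bsub>N\<^esub> k x))"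
      using carr[OF c] r k by (intro M.add.finprod_cong') (auto simp: ops smult_assoc1)
    also have "\<dots> = r \<odot>\<^bsub>N\<^esub> linear_extension R N k c"
      unfolding linear_extension_def using carr[OF c] r k T
      by (intro finsum_smult_ldistr[symmetric]) auto
    finally show "linear_extension R N k (r \<odot>\<^bsub>?F\<^esub> c) = r \<odot>\<^bsub>N\<^esub> linear_extension R N k c" .
  qed
qed

lemma mod_hom_finsum:
  assumes "module R M" "module R N" "f \<in> mod_hom R M N"
    "finite T" "u \<in> T \<rightarrow> carrier M"
  shows "f (\<Oplus>\<^bsub>M\<^esub>x\<in>T. u x) = (\<Oplus>\<^bsub>N\<^esub>x\<in>T. f (u x))"
proof -
  interpret M: module R M by fact
  interpret N: module R N by fact
  have f: "f \<in> carrier M \<rightarrow> carrier N" using assms(3) by (auto simp: mod_hom_def)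
  have "f (\<zero>\<^bsub>R\<^esub> \<odot>\<^bsub>M\<^esub> \<zero>\<^bsub>M\<^esub>) = \<zero>\<^bsub>R\<^esub> \<odot>\<^bsub>N\<^esub> f \<zero>\<^bsub>M\<^esub>"
    using assms(3) M.R.zero_closed M.M.zero_closed unfolding mod_hom_def by blast
  moreover have "f \<zero>\<^bsub>M\<^esub> \<in> carrier N" using f by auto
  ultimately have z: "f \<zero>\<^bsub>M\<^esub> = \<zero>\<^bsub>N\<^esub>" by simp
  show ?thesis using assms(4,5)
  proof (induction T)
    case empty then show ?case by (simp add: z)
  next
    case (insert x T)
    have "(\<Oplus>\<^bsub>M\<^esub>x\<in>T. u x) \<in> carrier M" using insert by (intro M.M.add.finprod_closed) auto
    then have "f (u x \<oplus>\<^bsub>M\<^esub> (\<Oplus>\<^bsub>M\<^esub>x\<in>T. u x)) = f (u x) \<oplus>\<^bsub>N\<^esub> f (\<Oplus>\<^bsub>M\<^esub>x\<in>T. u x)"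
      using assms(3) insert.prems by (auto simp: mod_hom_def)
    moreover have "(\<lambda>x. f (u x)) \<in> T \<rightarrow> carrier N" "f (u x) \<in> carrier N"
      using f insert.prems by auto
    moreover have "u \<in> T \<rightarrow> carrier M" "u x \<in> carrier M" using insert.prems by auto
    ultimately show ?case
      using insert by (simp add: M.M.finsum_insert N.M.finsum_insert)
  qed
qed

lemma mod_hom_linear_extension:
  assumes "module R M" "module R N" "f \<in> mod_hom R M N"
    "k \<in> B \<rightarrow> carrier M" "c \<in> carrier (finsupp_module R B)"
  shows "f (linear_extension R M k c) = linear_extension R N (\<lambda>x. f (k x)) c"
proof -
  interpret M: module R M by fact
  interpret N: module R N by fact
  have f: "f \<in> carrier M \<rightarrow> carrier N" using assms(3) by (auto simp: mod_hom_def)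
  have c: "c x \<in> carrier R" "finite {x. c x \<noteq> \<zero>\<^bsub>R\<^esub>}" for x
    using assms(5) by (auto simp: finsupp_module_def)
  have k: "k x \<in> carrier M" if "c x \<noteq> \<zero>\<^bsub>R\<^esub>" for x
    using assms(4,5) that by (auto simp: finsupp_module_def)
  have "f (linear_extension R M k c) = (\<Oplus>\<^bsub>N\<^esub>x\<in>{x. c x \<noteq> \<zero>\<^bsub>R\<^esub>}. f (c x \<odot>\<^bsub>M\<^esub> k x))"
    unfolding linear_extension_def using c k by (intro mod_hom_finsum[OF assms(1,2,3)]) auto
  also have "\<dots> = linear_extension R N (\<lambda>x. f (k x)) c"
    unfolding linear_extension_def
  proof (intro N.M.add.finprod_cong' refl)
    show "(\<lambda>x. c x \<odot>\<^bsub>N\<^esub> f (k x)) \<in> {x. c x \<noteq> \<zero>\<^bsub>R\<^esub>} \<rightarrow> carrier N"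
      using f c k by blast
    show "f (c x \<odot>\<^bsub>M\<^esub> k x) = c x \<odot>\<^bsub>N\<^esub> f (k x)" if "x \<in> {x. c x \<noteq> \<zero>\<^bsub>R\<^esub>}" for x
      using assms(3) c k that by (auto simp: mod_hom_def)
  qed
  finally show ?thesis .
qed

theorem projective_module_lift:
  fixes M :: "('a, 'b, 'm) module_scheme" and N :: "('a, 'c, 'n) module_scheme"
    and P :: "('a, 'd, 'p) module_scheme"
  assumes "module R M" "projective_module R M" "module R N" "module R P"
    and g: "g \<in> mod_hom R N P" "g ` carrier N = carrier P" and f: "f \<in> mod_hom R M P"
  shows "\<exists>h \<in> mod_hom R M N. \<forall>x \<in> carrier M. g (h x) = f x"
proof -
  interpret M: module R M by fact
  interpret N: module R N by fact
  let ?F = "finsupp_module R (carrier M)"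
  define M' :: "('a, 'b) module" where "M' = \<lparr>carrier = carrier M, mult = mult M, one = one M,
    zero = zero M, add = add M, smult = smult M\<rparr>"
  have M'_simps [simp]: "carrier M' = carrier M" "zero M' = zero M" "add M' = add M" "smult M' = smult M"
    by (simp_all add: M'_def)
  have M': "module R M'"
  proof (intro moduleI abelian_groupI M.R.is_cring)
    fix x assume "x \<in> carrier M'"
    then show "\<exists>y\<in>carrier M'. y \<oplus>\<^bsub>M'\<^esub> x = \<zero>\<^bsub>M'\<^esub>"
      using M.M.l_neg by auto
  qed (auto simp: M.M.a_ac M.smult_l_distr M.smult_r_distr M.smult_assoc1)
  have F: "module R ?F" by (rule module_finsupp_module[OF M.R.is_cring])
  have e: "linear_extension R M' id \<in> mod_hom R ?F M'"
    by (rule linear_extension_hom[OF M']) simp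
  have "linear_extension R M' id ` carrier ?F = carrier M'"
  proof
    show "linear_extension R M' id ` carrier ?F \<subseteq> carrier M'"
      using e by (auto simp: mod_hom_def)
    show "carrier M' \<subseteq> linear_extension R M' id ` carrier ?F"
    proof
      fix x assume x: "x \<in> carrier M'"
      let ?c = "\<lambda>y. if y = x then \<one>\<^bsub>R\<^esub> else \<zero>\<^bsub>R\<^esub>"
      interpret M': module R M' by (rule M')
      have sub: "{y. ?c y \<noteq> \<zero>\<^bsub>R\<^esub>} \<subseteq> {x}" by auto
      have c: "?c \<in> carrier ?F"
        using x finite_subset[OF sub] by (auto simp: finsupp_module_def)
      have "linear_extension R M' id ?c = (\<Oplus>\<^bsub>M'\<^esub>y\<in>{x}. ?c y \<odot>\<^bsub>M'\<^esub> id y)"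
        using x sub c by (intro linear_extension_eq[OF M' _ c]) auto
      also have "\<dots> = x" using x by (subst M'.M.finsum_insert) auto
      finally show "x \<in> linear_extension R M' id ` carrier ?F"
        using c by (metis imageI)
    qed
  qed
  moreover have "id \<in> mod_hom R M M'" by (auto simp: mod_hom_def)
  ultimately obtain s where s: "s \<in> mod_hom R M ?F"
    and sec: "\<forall>x \<in> carrier M. linear_extension R M' id (s x) = id x"
    using assms(2) F M' e unfolding projective_module_def by blast
  have sF: "s x \<in> carrier ?F" if "x \<in> carrier M" for x
    using s that by (auto simp: mod_hom_def)
  have "\<forall>x \<in> carrier M. \<exists>y \<in> carrier N. g y = f x"
  proof
    fix x assume "x \<in> carrier M"
    then have "f x \<in> g ` carrier N" using f g(2) by (auto simp: mod_hom_def)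
    then show "\<exists>y \<in> carrier N. g y = f x" by (elim imageE) auto
  qed
  then obtain k where k: "k x \<in> carrier N" "g (k x) = f x" if "x \<in> carrier M" for x
    by metis
  define h where "h x = linear_extension R N k (s x)" for x
  have kN: "k \<in> carrier M \<rightarrow> carrier N" using k by blast
  have "h \<in> mod_hom R M N"
    using linear_extension_hom[OF assms(3) kN] s sF unfolding mod_hom_def h_def by auto
  moreover have "g (h x) = f x" if x: "x \<in> carrier M" for x
  proof -
    interpret P: module R P by fact
    have "g (h x) = linear_extension R P (\<lambda>y. g (k y)) (s x)"
      unfolding h_def by (rule mod_hom_linear_extension[OF assms(3,4) g(1) kN sF[OF x]])
    also have "\<dots> = linear_extension R P (\<lambda>y. f (id y)) (s x)"
      unfolding linear_extension_def
    proof (intro P.M.add.finprod_cong' refl)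
      have sx: "y \<in> carrier M" "s x y \<in> carrier R" if "s x y \<noteq> \<zero>\<^bsub>R\<^esub>" for y
        using sF[OF x] that by (auto simp: finsupp_module_def)
      have fP: "f y \<in> carrier P" if "y \<in> carrier M" for y
        using f that by (auto simp: mod_hom_def)
      show "(\<lambda>y. s x y \<odot>\<^bsub>P\<^esub> f (id y)) \<in> {y. s x y \<noteq> \<zero>\<^bsub>R\<^esub>} \<rightarrow> carrier P"
        using sx fP by auto
      show "s x y \<odot>\<^bsub>P\<^esub> g (k y) = s x y \<odot>\<^bsub>P\<^esub> f (id y)" if "y \<in> {y. s x y \<noteq> \<zero>\<^bsub>R\<^esub>}" for y
        using k sx that by auto
    qed
    also have "\<dots> = f (linear_extension R M' id (s x))"
    proof (rule mod_hom_linear_extension[OF M' assms(4), symmetric])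
      show "f \<in> mod_hom R M' P" using f by (auto simp: mod_hom_def)
      show "id \<in> carrier M \<rightarrow> carrier M'" by simp
      show "s x \<in> carrier ?F" by (rule sF[OF x])
    qed
    also have "\<dots> = f x" using sec x by simp
    finally show ?thesis .
  qed
  ultimately show ?thesis by blast
qed

end

theory Submission
  imports Defs
begin

text \<open>
  Two quasi-prime submodules have the same image under the natural map iff they have the same
  colon ideal.  Hence over a quasi-prime-embedding module there is, for every prime ideal \<open>P\<close>, at
  most one proper \<open>P\<close>-saturated submodule \<open>N\<close> with \<open>P \<subseteq> (N:M)\<close>, that is, the fibre of \<open>M\<close> at \<open>P\<close> is
  at most one-dimensional.  Over an arithmetical ring every proper submodule saturated at a maximal
  ideal is quasi-prime, so that locally \<open>M\<close> behaves like a multiplication module.  Localizations are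
  replaced by saturations: \<open>M\<close> is cyclic at \<open>P\<close> iff every element of \<open>M\<close> has a multiple \<open>u z \<in> R x\<close>
  with \<open>u \<notin> P\<close>, for a fixed \<open>x\<close>.

  A projective module is cyclic at \<open>P\<close> without Kaplansky's theorem: a coordinate of a dual basis
  that is a unit at \<open>P\<close> on some \<open>x\<close> splits off \<open>R x\<close>, and the complement, whose fibre is zero, vanishes
  locally because the ideal of coordinates of any of its elements satisfies Nakayama's lemma.
  For a non-faithful module over a Dedekind domain, \<open>Ann(M)\<close> contains a product of maximal ideals, and a common generator modulo these
  finitely many ideals generates \<open>M\<close>.
\<close>

section \<open>Saturation at a prime ideal\<close>

text \<open>For a submodule \<open>N\<close>, \<open>saturation R M P N\<close> is the preimage of
  the localization of \<open>N\<close> under the map from \<open>M\<close> to its localization at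
  \<open>P\<close>. Saturated submodules therefore stand for submodules of the localization, and
  those with \<open>P\<close> in their colon ideal for subspaces of the fibre, a vector space over
  the residue field of \<open>P\<close>. A vector space with at most one proper subspace has
  dimension at most one.

  The obstacle is that such a fibre does not make the localization cyclic. Over the integers, every
  fibre of the rationals has dimension at most one, yet at a nonzero prime their localization is not
  cyclic. Nakayama's lemma bridges this gap for finitely generated modules only. Over an
  arithmetical ring the additional quasi-prime submodules replace it: colon ideals then decide which
  elements lie in a saturated submodule.\<close>

definition saturation :: "('a, 'r) ring_scheme \<Rightarrow> ('a, 'b, 'm) module_scheme \<Rightarrow> 'a set \<Rightarrow> 'b set \<Rightarrow> 'b set"
  where "saturation R M P N = {x \<in> carrier M. \<exists>u \<in> carrier R - P. u \<odot>\<^bsub>M\<^esub> x \<in> N}"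

text \<open>The set \<open>K + A g\<close>. The ideal \<open>A\<close> is a parameter because
  Nakayama's argument compares \<open>K + R g\<close> with \<open>K + P g\<close>.\<close>

definition adjoin ::
    "('a, 'b, 'm) module_scheme \<Rightarrow> 'b set \<Rightarrow> 'a set \<Rightarrow> 'b \<Rightarrow> 'b set"
  where "adjoin M K A g = {k \<oplus>\<^bsub>M\<^esub> a \<odot>\<^bsub>M\<^esub> g | k a. k \<in> K \<and> a \<in> A}"

lemma saturationI:
  "x \<in> carrier M \<Longrightarrow> u \<in> carrier R \<Longrightarrow> u \<notin> P \<Longrightarrow> u \<odot>\<^bsub>M\<^esub> x \<in> N \<Longrightarrow> x \<in> saturation R M P N"
  by (auto simp: saturation_def)

lemma saturationE:
  assumes "x \<in> saturation R M P N"
  obtains u where "x \<in> carrier M" "u \<in> carrier R" "u \<notin> P" "u \<odot>\<^bsub>M\<^esub> x \<in> N"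
  using assms by (auto simp: saturation_def)

lemma adjoinI: "k \<in> K \<Longrightarrow> a \<in> A \<Longrightarrow> k \<oplus>\<^bsub>M\<^esub> a \<odot>\<^bsub>M\<^esub> g \<in> adjoin M K A g"
  by (auto simp: adjoin_def)

lemma adjoinE:
  assumes "x \<in> adjoin M K A g"
  obtains k a where "k \<in> K" "a \<in> A" "x = k \<oplus>\<^bsub>M\<^esub> a \<odot>\<^bsub>M\<^esub> g"
  using assms by (auto simp: adjoin_def)

context module
begin

lemma submodule_zero: "submodule N R M \<Longrightarrow> \<zero>\<^bsub>M\<^esub> \<in> N"
  using subgroup.one_closed[OF submodule.axioms(1)] by fastforce

lemma submodule_subset: "submodule N R M \<Longrightarrow> x \<in> N \<Longrightarrow> x \<in> carrier M"
  using submoduleE(1) by blast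

lemma submodule_diff:
  assumes "submodule N R M" "x \<in> N" "y \<in> N"
  shows "x \<ominus>\<^bsub>M\<^esub> y \<in> N"
  using assms submoduleE by (simp add: M.minus_eq)

lemma submodule_add_cancel:
  assumes "submodule N R M" "x \<oplus>\<^bsub>M\<^esub> y \<in> N" "y \<in> N" "x \<in> carrier M"
  shows "x \<in> N"
proof -
  have "x = (x \<oplus>\<^bsub>M\<^esub> y) \<ominus>\<^bsub>M\<^esub> y"
    using assms submodule_subset by (simp add: M.minus_eq M.a_assoc M.r_neg)
  then show ?thesis using submodule_diff[OF assms(1-3)] by simp
qed

lemma submodule_Int:
  "submodule N R M \<Longrightarrow> submodule L R M \<Longrightarrow> submodule (N \<inter> L) R M"
  by (rule submoduleI) (auto intro: submoduleE(3-5) submodule_zero submodule_subset)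

lemma submodule_zero_set: "submodule {\<zero>\<^bsub>M\<^esub>} R M"
  by (rule submoduleI) auto

lemma colon_subset: "colon R M N \<subseteq> carrier R"
  by (auto simp: colon_def)

lemma colon_mono: "N \<subseteq> L \<Longrightarrow> colon R M N \<subseteq> colon R M L"
  by (auto simp: colon_def)

lemma colon_eq_carrier_iff:
  assumes "submodule N R M"
  shows "colon R M N = carrier R \<longleftrightarrow> N = carrier M"
proof
  assume "colon R M N = carrier R"
  then have "\<one> \<in> colon R M N" by simp
  then show "N = carrier M" using submodule_subset[OF assms] by (auto simp: colon_def)
next
  assume "N = carrier M" then show "colon R M N = carrier R" by (auto simp: colon_def)
qed

lemma submodule_saturation:
  assumes "primeideal P R" "submodule N R M"
  shows "submodule (saturation R M P N) R M"
proof (rule submoduleI)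
  interpret P: primeideal P R by fact
  note E = submoduleE[OF assms(2)]
  have one: "\<one> \<notin> P" using P.I_notcarr P.one_imp_carrier by auto
  show "saturation R M P N \<subseteq> carrier M" by (auto simp: saturation_def)
  show "\<zero>\<^bsub>M\<^esub> \<in> saturation R M P N"
    using one submodule_zero[OF assms(2)] by (intro saturationI[of _ _ \<one>]) auto
  show "\<ominus>\<^bsub>M\<^esub> x \<in> saturation R M P N" if x: "x \<in> saturation R M P N" for x
    using x E(3) by (elim saturationE, intro saturationI) (auto simp: smult_r_minus)
  fix x y assume "x \<in> saturation R M P N" "y \<in> saturation R M P N"
  then obtain u v where uv: "u \<in> carrier R" "u \<notin> P" "v \<in> carrier R" "v \<notin> P" "u \<odot>\<^bsub>M\<^esub> x \<in> N" "v \<odot>\<^bsub>M\<^esub> y \<in> N"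
    and c: "x \<in> carrier M" "y \<in> carrier M" by (meson saturationE)
  have "(u \<otimes> v) \<odot>\<^bsub>M\<^esub> (x \<oplus>\<^bsub>M\<^esub> y) = v \<odot>\<^bsub>M\<^esub> (u \<odot>\<^bsub>M\<^esub> x) \<oplus>\<^bsub>M\<^esub> u \<odot>\<^bsub>M\<^esub> (v \<odot>\<^bsub>M\<^esub> y)"
    using uv c by (simp add: smult_r_distr R.m_comm flip: smult_assoc1)
  also have "\<dots> \<in> N" using uv E(4,5) by blast
  finally show "x \<oplus>\<^bsub>M\<^esub> y \<in> saturation R M P N"
    using uv c P.I_prime by (intro saturationI[of _ _ "u \<otimes> v"]) auto
next
  fix a x assume a: "a \<in> carrier R" and "x \<in> saturation R M P N"
  then obtain u where u: "u \<in> carrier R" "u \<notin> P" "u \<odot>\<^bsub>M\<^esub> x \<in> N" and c: "x \<in> carrier M"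
    by (meson saturationE)
  have "u \<odot>\<^bsub>M\<^esub> (a \<odot>\<^bsub>M\<^esub> x) = a \<odot>\<^bsub>M\<^esub> (u \<odot>\<^bsub>M\<^esub> x)"
    using u a c by (simp add: R.m_comm flip: smult_assoc1)
  also have "\<dots> \<in> N" using a u submoduleE(4)[OF assms(2)] by blast
  finally show "a \<odot>\<^bsub>M\<^esub> x \<in> saturation R M P N"
    using u a c by (intro saturationI) auto
qed

lemma saturation_extensive:
  assumes "primeideal P R" "submodule N R M"
  shows "N \<subseteq> saturation R M P N"
proof -
  interpret P: primeideal P R by fact
  have "\<one> \<in> carrier R - P" using P.I_notcarr P.one_imp_carrier by auto
  then show ?thesis
    using submodule_subset[OF assms(2)] by (auto simp: saturation_def intro!: bexI[of _ \<one>])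
qed

lemma saturation_mono: "N \<subseteq> L \<Longrightarrow> saturation R M P N \<subseteq> saturation R M P L"
  by (auto simp: saturation_def)

lemma saturation_idem:
  assumes "primeideal P R"
  shows "saturation R M P (saturation R M P N) \<subseteq> saturation R M P N"
proof
  interpret P: primeideal P R by fact
  fix x assume "x \<in> saturation R M P (saturation R M P N)"
  then obtain u v where u: "x \<in> carrier M" "u \<in> carrier R" "u \<notin> P" "v \<in> carrier R" "v \<notin> P"
    "v \<odot>\<^bsub>M\<^esub> (u \<odot>\<^bsub>M\<^esub> x) \<in> N"
    by (meson saturationE)
  then show "x \<in> saturation R M P N"
    using P.I_prime by (intro saturationI[of _ _ "v \<otimes> u"]) (auto simp: smult_assoc1)
qed

lemma submodule_adjoin:
  assumes K: "submodule K R M" and A: "ideal A R" and g: "g \<in> carrier M"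
  shows "submodule (adjoin M K A g) R M"
proof (rule submoduleI)
  interpret A: ideal A R by fact
  have c: "k \<in> carrier M" if "k \<in> K" for k using submodule_subset[OF K that] .
  show "adjoin M K A g \<subseteq> carrier M"
    using c A.Icarr g by (auto elim!: adjoinE)
  have "\<zero>\<^bsub>M\<^esub> \<oplus>\<^bsub>M\<^esub> \<zero> \<odot>\<^bsub>M\<^esub> g \<in> adjoin M K A g"
    using submodule_zero[OF K] A.zero_closed by (rule adjoinI)
  then show "\<zero>\<^bsub>M\<^esub> \<in> adjoin M K A g" using g by simp
  fix x assume "x \<in> adjoin M K A g"
  then obtain k a where x: "k \<in> K" "a \<in> A" "x = k \<oplus>\<^bsub>M\<^esub> a \<odot>\<^bsub>M\<^esub> g" by (rule adjoinE)
  have "\<ominus>\<^bsub>M\<^esub> k \<oplus>\<^bsub>M\<^esub> (\<ominus> a) \<odot>\<^bsub>M\<^esub> g \<in> adjoin M K A g"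
    using x submoduleE(3)[OF K] A.a_inv_closed by (intro adjoinI) auto
  then show "\<ominus>\<^bsub>M\<^esub> x \<in> adjoin M K A g"
    using x c A.Icarr g by (simp add: smult_l_minus M.minus_add)
  {
    fix y assume "y \<in> adjoin M K A g"
    then obtain l b where y: "l \<in> K" "b \<in> A" "y = l \<oplus>\<^bsub>M\<^esub> b \<odot>\<^bsub>M\<^esub> g" by (rule adjoinE)
    have "(k \<oplus>\<^bsub>M\<^esub> l) \<oplus>\<^bsub>M\<^esub> (a \<oplus> b) \<odot>\<^bsub>M\<^esub> g \<in> adjoin M K A g"
      using x y submoduleE(5)[OF K] A.a_closed by (intro adjoinI) auto
    then show "x \<oplus>\<^bsub>M\<^esub> y \<in> adjoin M K A g"
      using x y c A.Icarr g by (simp add: smult_l_distr M.a_ac)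
  next
    fix r assume r: "r \<in> carrier R"
    have "(r \<odot>\<^bsub>M\<^esub> k) \<oplus>\<^bsub>M\<^esub> (r \<otimes> a) \<odot>\<^bsub>M\<^esub> g \<in> adjoin M K A g"
      using x r submoduleE(4)[OF K] A.I_l_closed by (intro adjoinI) auto
    then show "r \<odot>\<^bsub>M\<^esub> x \<in> adjoin M K A g"
      using x r c A.Icarr g by (simp add: smult_r_distr smult_assoc1)
  }
qed

lemma adjoin_base:
  assumes "submodule K R M" "ideal A R" "g \<in> carrier M"
  shows "K \<subseteq> adjoin M K A g"
proof
  interpret A: ideal A R by fact
  fix k assume k: "k \<in> K"
  then have "k = k \<oplus>\<^bsub>M\<^esub> \<zero> \<odot>\<^bsub>M\<^esub> g" using assms submodule_subset by simp
  then show "k \<in> adjoin M K A g" unfolding adjoin_def using k A.zero_closed by blast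
qed

lemma adjoin_self:
  assumes "submodule K R M" "g \<in> carrier M"
  shows "g \<in> adjoin M K (carrier R) g"
proof -
  have "g = \<zero>\<^bsub>M\<^esub> \<oplus>\<^bsub>M\<^esub> \<one> \<odot>\<^bsub>M\<^esub> g" using assms by simp
  then show ?thesis unfolding adjoin_def using submodule_zero[OF assms(1)] by blast
qed

lemma adjoin_zero:
  assumes "A \<subseteq> carrier R" "g \<in> carrier M"
  shows "adjoin M {\<zero>\<^bsub>M\<^esub>} A g = {a \<odot>\<^bsub>M\<^esub> g | a. a \<in> A}"
  using assms by (force simp: adjoin_def)

lemma adjoin_subset:
  assumes "submodule N R M" "K \<subseteq> N" "g \<in> N" "A \<subseteq> carrier R"
  shows "adjoin M K A g \<subseteq> N"
proof
  fix x assume "x \<in> adjoin M K A g"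
  then obtain k a where "k \<in> K" "a \<in> A" "x = k \<oplus>\<^bsub>M\<^esub> a \<odot>\<^bsub>M\<^esub> g" by (auto simp: adjoin_def)
  then show "x \<in> N" using assms submoduleE(4,5)[OF assms(1)] by blast
qed

lemma submodule_cyclic:
  assumes "ideal A R" "x \<in> carrier M"
  shows "submodule {a \<odot>\<^bsub>M\<^esub> x | a. a \<in> A} R M"
  using submodule_adjoin[OF submodule_zero_set assms] adjoin_zero[OF _ assms(2)]
    additive_subgroup.a_subset[OF ideal.axioms(1)[OF assms(1)]] by simp

end

section \<open>Quasi-prime-embedding and multiplication modules\<close>

text \<open>If \<open>a\<close> in \<open>A\<close> and \<open>b\<close> in \<open>B\<close> both
  avoid \<open>P\<close>, their product lies in \<open>A \<inter> B\<close> and still avoids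
  \<open>P\<close>.\<close>

lemma (in cring) primeideal_quasi_prime:
  assumes "primeideal P R" shows "quasi_prime_ideal P R"
proof -
  interpret P: primeideal P R by fact
  have "A \<subseteq> P \<or> B \<subseteq> P" if AB: "ideal A R" "ideal B R" "A \<inter> B \<subseteq> P" for A B
  proof (rule ccontr)
    assume "\<not> (A \<subseteq> P \<or> B \<subseteq> P)"
    then obtain a b where ab: "a \<in> A" "a \<notin> P" "b \<in> B" "b \<notin> P" by blast
    then have c: "a \<in> carrier R" "b \<in> carrier R" using ideal.Icarr AB by fast+
    then have "a \<otimes> b \<in> A \<inter> B"
      using ideal.I_r_closed[OF AB(1) ab(1)] ideal.I_l_closed[OF AB(2) ab(3)] by blast
    then show False using AB(3) ab c P.I_prime by blast
  qed
  then show ?thesis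
    using P.is_ideal P.I_notcarr unfolding quasi_prime_ideal_def by blast
qed

lemma quasi_prime_ideal_finite_Inter:
  assumes qp: "quasi_prime_ideal I R" and "ring R" and "finite F" "F \<noteq> {}"
    and "\<forall>A \<in> F. ideal A R" "\<Inter>F \<subseteq> I"
  shows "\<exists>A \<in> F. A \<subseteq> I"
  using assms(3-6)
proof (induction F rule: finite_ne_induct)
  case (insert A F)
  have "ideal (\<Inter>F) R" using insert ring.i_Intersect[OF assms(2)] by blast
  then have "A \<subseteq> I \<or> \<Inter>F \<subseteq> I"
    using insert.prems qp unfolding quasi_prime_ideal_def by auto
  then show ?case using insert by blast
qed auto

context module
begin

text \<open>The colon ideal contains the annihilator, so the union of the cosets forming its image
  gives it back.\<close>

lemma qSpec_map_eq_iff: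
  assumes "submodule N R M" "submodule L R M"
  shows "qSpec_map R M N = qSpec_map R M L \<longleftrightarrow> colon R M N = colon R M L"
proof -
  have inv: "\<Union> (qSpec_map R M N) = colon R M N" if N: "submodule N R M" for N
  proof -
    have "module_annihilator R M \<subseteq> colon R M N"
      using submodule_zero[OF N] by (auto simp: module_annihilator_def intro!: colon_mono)
    then show ?thesis
      using R.ideal_incl_iff[OF _ ideal_colon[OF N]] ideal_colon[OF submodule_zero_set]
      by (simp add: qSpec_map_def module_annihilator_def)
  qed
  show ?thesis using inv[OF assms(1)] inv[OF assms(2)] unfolding qSpec_map_def by metis
qed

lemma quasi_prime_embedding_iff:
  "quasi_prime_embedding R M \<longleftrightarrow> (\<forall>N L. quasi_prime_submodule N R M \<and> quasi_prime_submodule L R M \<and>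
    colon R M N = colon R M L \<longrightarrow> N = L)"
proof -
  have "qSpec_map R M N = qSpec_map R M L \<longleftrightarrow> colon R M N = colon R M L"
    if "quasi_prime_submodule N R M" "quasi_prime_submodule L R M" for N L
    using that qSpec_map_eq_iff unfolding quasi_prime_submodule_def by blast
  then show ?thesis
    unfolding quasi_prime_embedding_def inj_on_def module_qSpec_def Ball_def mem_Collect_eq
    by metis
qed

text \<open>Colon ideals turn a primary decomposition of \<open>N\<close> into a finite intersection
  of ideals inside \<open>(N:M)\<close>. Quasi-primality puts the colon ideal of one component
  \<open>Q\<close> inside \<open>(N:M)\<close>, and \<open>N \<subseteq> Q\<close> makes the two
  equal. So \<open>Q\<close> is itself quasi-prime with the colon ideal of \<open>N\<close>, and
  injectivity gives \<open>Q = N\<close>.\<close>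

lemma Laskerian_quasi_prime_imp_primary:
  assumes "Laskerian_module R M" "quasi_prime_embedding R M" "quasi_prime_submodule N R M"
  shows "primary_submodule N R M"
proof -
  have N: "submodule N R M" "N \<noteq> carrier M" "quasi_prime_ideal (colon R M N) R"
    using assms(3) by (auto simp: quasi_prime_submodule_def)
  obtain F where F: "finite F" "F \<noteq> {}" "\<forall>Q \<in> F. primary_submodule Q R M" "N = \<Inter>F"
    using assms(1) N unfolding Laskerian_module_def by blast
  have "\<Inter>(colon R M ` F) \<subseteq> colon R M N"
    using F(2,4) by (auto simp: colon_def)
  moreover have "\<forall>A \<in> colon R M ` F. ideal A R"
    using F(3) ideal_colon by (auto simp: primary_submodule_def)
  ultimately have "\<exists>A \<in> colon R M ` F. A \<subseteq> colon R M N"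
    using F(1,2) by (intro quasi_prime_ideal_finite_Inter[OF N(3) R.ring_axioms]) auto
  then obtain Q where Q: "Q \<in> F" "colon R M Q \<subseteq> colon R M N" by blast
  moreover have "colon R M N \<subseteq> colon R M Q"
    using F(4) Q(1) by (intro colon_mono) blast
  ultimately have eq: "colon R M Q = colon R M N" by blast
  have prim: "primary_submodule Q R M" using F(3) Q(1) by blast
  then have "quasi_prime_submodule Q R M"
    using N(3) eq by (auto simp: quasi_prime_submodule_def primary_submodule_def)
  then have "Q = N" using assms(2,3) eq quasi_prime_embedding_iff by blast
  then show ?thesis using prim by simp
qed

section \<open>Spans, products \<open>I M\<close>, and a colon criterion for multiplication
  modules\<close>

lemma submodule_span:
  assumes "G \<subseteq> carrier M"
  shows "submodule (module_span R M G) R M"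
proof (rule submoduleI)
  show "module_span R M G \<subseteq> carrier M"
    using assms carrier_is_submodule by (auto simp: module_span_def)
qed (simp_all add: module_span_def submoduleE(3-5) submodule_zero)

lemma span_extensive: "G \<subseteq> module_span R M G"
  by (auto simp: module_span_def)

lemma span_least: "submodule N R M \<Longrightarrow> G \<subseteq> N \<Longrightarrow> module_span R M G \<subseteq> N"
  by (auto simp: module_span_def)

lemma submodule_ideal_smult:
  assumes "I \<subseteq> carrier R" shows "submodule (ideal_smult R M I) R M"
  unfolding ideal_smult_def using assms by (intro submodule_span) auto

lemma ideal_smult_least:
  assumes "submodule N R M" "I \<subseteq> colon R M N"
  shows "ideal_smult R M I \<subseteq> N"
  unfolding ideal_smult_def using assms by (intro span_least) (auto simp: colon_def)

lemma colon_ideal_smult: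
  assumes "I \<subseteq> carrier R" shows "I \<subseteq> colon R M (ideal_smult R M I)"
  using assms span_extensive[of "{a \<odot>\<^bsub>M\<^esub> x |a x. a \<in> I \<and> x \<in> carrier M}"]
  unfolding ideal_smult_def colon_def by blast

text \<open>If \<open>N = I M\<close>, then \<open>I \<subseteq> (N:M)\<close>, so the colon ideal
  is the largest candidate for \<open>I\<close>. Since \<open>(N:M) M \<subseteq> N\<close> always
  holds, only the other inclusion is a condition.\<close>

lemma multiplication_module_iff:
  "multiplication_module R M \<longleftrightarrow> (\<forall>N. submodule N R M \<longrightarrow> N \<subseteq> ideal_smult R M (colon R M N))"
proof
  assume mult: "multiplication_module R M"
  show "\<forall>N. submodule N R M \<longrightarrow> N \<subseteq> ideal_smult R M (colon R M N)"
  proof (intro allI impI)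
    fix N assume "submodule N R M"
    then obtain I where I: "ideal I R" "N = ideal_smult R M I"
      using mult unfolding multiplication_module_def by blast
    have "I \<subseteq> colon R M N"
      using colon_ideal_smult[OF additive_subgroup.a_subset[OF ideal.axioms(1)[OF I(1)]]] I(2)
      by simp
    also have "\<dots> \<subseteq> colon R M (ideal_smult R M (colon R M N))"
      by (rule colon_ideal_smult[OF colon_subset])
    finally show "N \<subseteq> ideal_smult R M (colon R M N)"
      using ideal_smult_least[OF submodule_ideal_smult[OF colon_subset]] I(2) by simp
  qed
next
  assume *: "\<forall>N. submodule N R M \<longrightarrow> N \<subseteq> ideal_smult R M (colon R M N)"
  show "multiplication_module R M"
    unfolding multiplication_module_def
  proof (intro allI impI)
    fix N assume N: "submodule N R M"
    have "N = ideal_smult R M (colon R M N)"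
      using * N ideal_smult_least[OF N] by blast
    then show "\<exists>I. ideal I R \<and> N = ideal_smult R M I" using ideal_colon[OF N] by blast
  qed
qed

text \<open>Since \<open>N = (N:M) M\<close>, colon ideals decide inclusions between arbitrary
  submodules, which is more than injectivity on the quasi-prime ones.\<close>

lemma multiplication_module_colon_mono:
  assumes "multiplication_module R M" "submodule N R M" "submodule L R M"
    "colon R M N \<subseteq> colon R M L"
  shows "N \<subseteq> L"
  using ideal_smult_least[OF assms(3,4)] assms(1,2) unfolding multiplication_module_iff by blast

lemma multiplication_imp_quasi_prime_embedding:
  assumes "multiplication_module R M" shows "quasi_prime_embedding R M"
  unfolding quasi_prime_embedding_iff quasi_prime_submodule_def
  using multiplication_module_colon_mono[OF assms] by (metis subset_antisym order_refl)

text \<open>Two ideals of a serial ring are comparable, so their intersection is one of them and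
  every proper ideal is quasi-prime. Hence every proper submodule is quasi-prime. As
  \<open>N\<close> and \<open>(N:M) M\<close> have the same colon ideal, they coincide.\<close>

lemma serial_quasi_prime_embedding_imp_multiplication:
  assumes "serial_ring R" "quasi_prime_embedding R M"
  shows "multiplication_module R M"
  unfolding multiplication_module_iff
proof (intro allI impI)
  fix N assume N: "submodule N R M"
  let ?L = "ideal_smult R M (colon R M N)"
  have L: "submodule ?L R M" by (rule submodule_ideal_smult[OF colon_subset])
  have LN: "?L \<subseteq> N" by (rule ideal_smult_least[OF N]) simp
  have cL: "colon R M ?L = colon R M N"
    using colon_mono[OF LN] colon_ideal_smult[OF colon_subset] by blast
  have qp: "quasi_prime_submodule K R M" if K: "submodule K R M" "K \<noteq> carrier M" for K
    unfolding quasi_prime_submodule_def quasi_prime_ideal_def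
    using K ideal_colon[OF K(1)] colon_eq_carrier_iff[OF K(1)] assms(1)
    unfolding serial_ring_def by (metis Int_absorb1 Int_absorb2)
  show "N \<subseteq> ?L"
  \<comment> \<open>The whole module is not quasi-prime and is treated apart: only for it is the
    colon ideal all of \<open>R\<close>.\<close>
  proof (cases "N = carrier M")
    case True
    then show ?thesis using cL colon_eq_carrier_iff[OF N] colon_eq_carrier_iff[OF L] by simp
  next
    case False
    moreover from this have "?L \<noteq> carrier M"
      using cL colon_eq_carrier_iff[OF N] colon_eq_carrier_iff[OF L] by simp
    ultimately show ?thesis
      using qp N L cL assms(2) unfolding quasi_prime_embedding_iff by blast
  qed
qed

text \<open>If \<open>x\<close> generates \<open>M\<close> and \<open>r x\<close> lies in
  \<open>N\<close>, then \<open>r\<close> sends every \<open>s x\<close> to \<open>s (r x)\<close>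
  and so lies in \<open>(N:M)\<close>.\<close>

lemma cyclic_imp_multiplication:
  assumes "cyclic_module R M" shows "multiplication_module R M"
  unfolding multiplication_module_iff
proof (intro allI impI subsetI)
  obtain x where x: "x \<in> carrier M" "carrier M = {r \<odot>\<^bsub>M\<^esub> x | r. r \<in> carrier R}"
    using assms unfolding cyclic_module_def by blast
  fix N z assume N: "submodule N R M" and z: "z \<in> N"
  then obtain r where r: "r \<in> carrier R" "z = r \<odot>\<^bsub>M\<^esub> x" 
    using submodule_subset[OF N z] unfolding x(2) by blast
  have "r \<odot>\<^bsub>M\<^esub> y \<in> N" if y: "y \<in> carrier M" for y
  proof -
    obtain s where "s \<in> carrier R" "y = s \<odot>\<^bsub>M\<^esub> x" using y unfolding x(2) by blast
    then have "r \<odot>\<^bsub>M\<^esub> y = s \<odot>\<^bsub>M\<^esub> z" using r x(1) by (simp add: R.m_comm flip: smult_assoc1)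
    then show ?thesis using z submoduleE(4)[OF N] \<open>s \<in> carrier R\<close> by simp
  qed
  then have "r \<in> colon R M N" using r by (simp add: colon_def)
  then have "r \<in> colon R M (ideal_smult R M (colon R M N))"
    using colon_ideal_smult[OF colon_subset] by blast
  then show "z \<in> ideal_smult R M (colon R M N)" using r x(1) by (simp add: colon_def)
qed

text \<open>An element of \<open>(N:M)\<close> outside \<open>P\<close> would put all of
  \<open>M\<close> into the saturation of \<open>N\<close>. So both colon ideals equal
  \<open>P\<close>, which is quasi-prime because it is prime, and injectivity applies.\<close>

lemma prime_submodule_unique:
  assumes "quasi_prime_embedding R M" "primeideal P R"
    and "submodule N R M" "N \<noteq> carrier M" "saturation R M P N \<subseteq> N" "P \<subseteq> colon R M N"
    and "submodule L R M" "L \<noteq> carrier M" "saturation R M P L \<subseteq> L" "P \<subseteq> colon R M L"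
  shows "N = L"
proof -
  have eq: "colon R M K = P"
    if K: "submodule K R M" "K \<noteq> carrier M" "saturation R M P K \<subseteq> K" "P \<subseteq> colon R M K" for K
  proof (rule ccontr)
    assume "colon R M K \<noteq> P"
    then obtain u where "u \<in> colon R M K" "u \<notin> P" using K(4) by blast
    then have "carrier M \<subseteq> saturation R M P K" by (auto simp: colon_def intro: saturationI)
    then show False using K submodule_subset by blast
  qed
  have "quasi_prime_submodule K R M"
    if "submodule K R M" "K \<noteq> carrier M" "saturation R M P K \<subseteq> K" "P \<subseteq> colon R M K" for K
    unfolding quasi_prime_submodule_def eq[OF that]
    using that R.primeideal_quasi_prime[OF assms(2)] by simp
  then show ?thesis
    using assms(1) eq[OF assms(3-6)] eq[OF assms(7-10)] assms(3-10)
    unfolding quasi_prime_embedding_iff by metis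
qed

end

section \<open>Modules that are cyclic at a prime ideal\<close>

definition cyclic_at :: "('a, 'r) ring_scheme \<Rightarrow> ('a, 'b, 'm) module_scheme \<Rightarrow> 'a set \<Rightarrow> bool"
  where "cyclic_at R M P \<longleftrightarrow>
    (\<exists>x \<in> carrier M. carrier M \<subseteq> saturation R M P {r \<odot>\<^bsub>M\<^esub> x | r. r \<in> carrier R})"

context module
begin

lemma cyclic_self: "x \<in> carrier M \<Longrightarrow> x \<in> {r \<odot>\<^bsub>M\<^esub> x | r. r \<in> carrier R}"
  using smult_one R.one_closed by (metis (mono_tags, lifting) mem_Collect_eq)

text \<open>At \<open>P\<close> the element \<open>u \<ominus> p\<close> is a unit. Nakayama-type
  arguments end with a relation \<open>u g = k + p g\<close> and divide by this unit.\<close>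

lemma prime_complement_diff:
  assumes "primeideal P R" "u \<in> carrier R" "u \<notin> P" "p \<in> P"
  shows "u \<ominus> p \<in> carrier R" "u \<ominus> p \<notin> P"
proof -
  interpret P: primeideal P R by fact
  have p: "p \<in> carrier R" using assms(4) P.Icarr by blast
  then show "u \<ominus> p \<in> carrier R" using assms(2) by simp
  have "u = (u \<ominus> p) \<oplus> p" using p assms(2) by (simp add: R.minus_eq R.a_assoc R.l_neg)
  then show "u \<ominus> p \<notin> P" using assms(3,4) P.a_closed by metis
qed

lemma smult_diff_distr:
  assumes "a \<in> carrier R" "b \<in> carrier R" "x \<in> carrier M"
  shows "(a \<ominus> b) \<odot>\<^bsub>M\<^esub> x = a \<odot>\<^bsub>M\<^esub> x \<ominus>\<^bsub>M\<^esub> b \<odot>\<^bsub>M\<^esub> x"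
  using assms by (simp add: R.minus_eq M.minus_eq smult_l_distr smult_l_minus)

lemma saturated_eq_carrierI:
  assumes "saturation R M P N \<subseteq> N" "submodule N R M" "u \<in> colon R M N" "u \<notin> P"
  shows "N = carrier M"
proof -
  have "w \<in> saturation R M P N" if "w \<in> carrier M" for w
    using that assms(3,4) by (intro saturationI[of _ _ u]) (auto simp: colon_def)
  then show ?thesis using assms(1) submodule_subset[OF assms(2)] by blast
qed

text \<open>The residual of \<open>S\<close> by \<open>I\<close>. For \<open>I = {a}\<close> it is
  the preimage of \<open>S\<close> under multiplication by \<open>a\<close>, so a containment
  checked on generators of \<open>M\<close> extends to \<open>M\<close>.\<close>

lemma submodule_colon_set:
  assumes "submodule S R M" "I \<subseteq> carrier R"
  shows "submodule {w \<in> carrier M. \<forall>a \<in> I. a \<odot>\<^bsub>M\<^esub> w \<in> S} R M"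
proof (rule submoduleI)
  note E = submoduleE[OF assms(1)]
  have I: "a \<in> carrier R" if "a \<in> I" for a using that assms(2) by blast
  show "\<ominus>\<^bsub>M\<^esub> x \<in> {w \<in> carrier M. \<forall>a \<in> I. a \<odot>\<^bsub>M\<^esub> w \<in> S}"
    if "x \<in> {w \<in> carrier M. \<forall>a \<in> I. a \<odot>\<^bsub>M\<^esub> w \<in> S}" for x
    using that I E(3) by (simp add: smult_r_minus)
  show "x \<oplus>\<^bsub>M\<^esub> y \<in> {w \<in> carrier M. \<forall>a \<in> I. a \<odot>\<^bsub>M\<^esub> w \<in> S}"
    if "x \<in> {w \<in> carrier M. \<forall>a \<in> I. a \<odot>\<^bsub>M\<^esub> w \<in> S}" "y \<in> {w \<in> carrier M. \<forall>a \<in> I. a \<odot>\<^bsub>M\<^esub> w \<in> S}" for x y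
    using that I E(5) by (simp add: smult_r_distr)
  fix r x assume r: "r \<in> carrier R" and x: "x \<in> {w \<in> carrier M. \<forall>a \<in> I. a \<odot>\<^bsub>M\<^esub> w \<in> S}"
  have "a \<odot>\<^bsub>M\<^esub> (r \<odot>\<^bsub>M\<^esub> x) \<in> S" if a: "a \<in> I" for a
  proof -
    have "a \<odot>\<^bsub>M\<^esub> (r \<odot>\<^bsub>M\<^esub> x) = r \<odot>\<^bsub>M\<^esub> (a \<odot>\<^bsub>M\<^esub> x)"
      using r x I[OF a] by (simp add: R.m_comm flip: smult_assoc1)
    then show ?thesis using E(4) r x a by simp
  qed
  then show "r \<odot>\<^bsub>M\<^esub> x \<in> {w \<in> carrier M. \<forall>a \<in> I. a \<odot>\<^bsub>M\<^esub> w \<in> S}" using r x by simp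
qed (use submodule_zero[OF assms(1)] assms(2) in auto)

lemma saturated_colon_set:
  assumes "saturation R M P S \<subseteq> S" "I \<subseteq> carrier R"
  shows "saturation R M P {w \<in> carrier M. \<forall>a \<in> I. a \<odot>\<^bsub>M\<^esub> w \<in> S} \<subseteq> {w \<in> carrier M. \<forall>a \<in> I. a \<odot>\<^bsub>M\<^esub> w \<in> S}"
proof
  fix w assume "w \<in> saturation R M P {w \<in> carrier M. \<forall>a \<in> I. a \<odot>\<^bsub>M\<^esub> w \<in> S}"
  then obtain u where u: "w \<in> carrier M" "u \<in> carrier R" "u \<notin> P" "\<forall>a \<in> I. a \<odot>\<^bsub>M\<^esub> (u \<odot>\<^bsub>M\<^esub> w) \<in> S"
    by (auto elim!: saturationE)
  have "a \<odot>\<^bsub>M\<^esub> w \<in> S" if a: "a \<in> I" for a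
  proof -
    have "a \<in> carrier R" using a assms(2) by blast
    then have "u \<odot>\<^bsub>M\<^esub> (a \<odot>\<^bsub>M\<^esub> w) = a \<odot>\<^bsub>M\<^esub> (u \<odot>\<^bsub>M\<^esub> w)"
      using u by (simp add: R.m_comm flip: smult_assoc1)
    then have "a \<odot>\<^bsub>M\<^esub> w \<in> saturation R M P S"
      using u a \<open>a \<in> carrier R\<close> by (intro saturationI[of _ _ u]) auto
    then show ?thesis using assms(1) by blast
  qed
  then show "w \<in> {w \<in> carrier M. \<forall>a \<in> I. a \<odot>\<^bsub>M\<^esub> w \<in> S}" using u by blast
qed

text \<open>A relation \<open>u w = r z\<close> gives \<open>u (p w) = (p r) z\<close> with
  \<open>p r\<close> in \<open>P\<close>. If \<open>z\<close> generates \<open>M\<close> locally,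
  this puts \<open>P M\<close> into the saturation of \<open>P z\<close>.\<close>

lemma saturation_cyclic_smult:
  assumes "ideal P R" "p \<in> P" "z \<in> carrier M" "w \<in> saturation R M P {r \<odot>\<^bsub>M\<^esub> z | r. r \<in> carrier R}"
  shows "p \<odot>\<^bsub>M\<^esub> w \<in> saturation R M P {p \<odot>\<^bsub>M\<^esub> z | p. p \<in> P}"
proof -
  have p: "p \<in> carrier R" by (rule ideal.Icarr[OF assms(1,2)])
  obtain u where u: "w \<in> carrier M" "u \<in> carrier R" "u \<notin> P" "u \<odot>\<^bsub>M\<^esub> w \<in> {r \<odot>\<^bsub>M\<^esub> z | r. r \<in> carrier R}"
    using assms(4) by (rule saturationE)
  then obtain r where r: "r \<in> carrier R" "u \<odot>\<^bsub>M\<^esub> w = r \<odot>\<^bsub>M\<^esub> z" by blast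
  have "u \<odot>\<^bsub>M\<^esub> (p \<odot>\<^bsub>M\<^esub> w) = p \<odot>\<^bsub>M\<^esub> (u \<odot>\<^bsub>M\<^esub> w)"
    using p u by (simp add: R.m_comm flip: smult_assoc1)
  also have "\<dots> = (p \<otimes> r) \<odot>\<^bsub>M\<^esub> z" unfolding r(2) using r(1) p assms(3) by (simp add: smult_assoc1)
  finally show ?thesis
    using ideal.I_r_closed[OF assms(1,2) r(1)] u p by (intro saturationI[of _ _ u]) auto
qed

text \<open>A replacement for Nakayama's lemma when no finiteness is at hand: by \<open>H\<close>,
  colon ideals decide membership. Either some \<open>z\<close> generates \<open>M\<close> at
  \<open>P\<close>, or the colon ideal of every saturated \<open>R z\<close> lies in
  \<open>P\<close>. In the second case \<open>H\<close> shows that the fibre vanishes, and a second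
  use of \<open>H\<close> that \<open>M\<close> itself vanishes at \<open>P\<close>.\<close>

lemma cyclic_atI_colon:
  assumes P: "primeideal P R"
    and H: "\<And>z N. z \<in> carrier M \<Longrightarrow> submodule N R M \<Longrightarrow> saturation R M P N \<subseteq> N \<Longrightarrow>
      colon R M (saturation R M P {r \<odot>\<^bsub>M\<^esub> z | r. r \<in> carrier R}) \<subseteq> colon R M N \<Longrightarrow> z \<in> N"
  shows "cyclic_at R M P"
proof -
  interpret P: primeideal P R by fact
  let ?S = "\<lambda>z. saturation R M P {r \<odot>\<^bsub>M\<^esub> z | r. r \<in> carrier R}"
  let ?T = "\<lambda>z. saturation R M P {p \<odot>\<^bsub>M\<^esub> z | p. p \<in> P}"
  have S: "submodule (?S z) R M" "saturation R M P (?S z) \<subseteq> ?S z" if "z \<in> carrier M" for z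
    using submodule_saturation[OF P submodule_cyclic[OF R.oneideal that]] saturation_idem[OF P] by auto
  have T: "submodule (?T z) R M" "saturation R M P (?T z) \<subseteq> ?T z" if "z \<in> carrier M" for z
    using submodule_saturation[OF P submodule_cyclic[OF P.is_ideal that]] saturation_idem[OF P] by auto
  show ?thesis
  proof (cases "\<exists>z \<in> carrier M. \<not> colon R M (?S z) \<subseteq> P")
    case True
    then show ?thesis using saturated_eq_carrierI[OF S(2,1)] unfolding cyclic_at_def by blast
  next
    case False
    \<comment> \<open>The fibre is zero: the colon ideal of every \<open>?S z\<close> lies in
      \<open>P \<subseteq> (N:M)\<close>, so \<open>H\<close> puts every \<open>z\<close> into
      \<open>N\<close>.\<close>
    have *: "N = carrier M" if N: "submodule N R M" "saturation R M P N \<subseteq> N" "P \<subseteq> colon R M N" for N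
    proof
      show "N \<subseteq> carrier M" using submodule_subset[OF N(1)] by blast
      show "carrier M \<subseteq> N" using H[OF _ N(1,2)] False N(3) by (meson subset_iff)
    qed
    have "z \<in> saturation R M P {\<zero>\<^bsub>M\<^esub>}" if z: "z \<in> carrier M" for z
    proof -
      define I where "I = colon R M (?S z)"
      have I: "I \<subseteq> carrier R" unfolding I_def by (rule colon_subset)
      \<comment> \<open>Chosen so that \<open>P\<close> lies in its colon ideal: \<open>I M\<close>
        is inside \<open>?S z\<close>, hence \<open>P I M\<close> is inside \<open>?T z\<close>. The
        vanishing fibre then gives \<open>I M \<subseteq> ?T z\<close>, and \<open>H\<close> applies
        to \<open>?T z\<close>.\<close>
      let ?N = "{w \<in> carrier M. \<forall>a \<in> I. a \<odot>\<^bsub>M\<^esub> w \<in> ?T z}"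
      have "P \<subseteq> colon R M ?N"
      proof
        fix p assume p: "p \<in> P"
        then have pc: "p \<in> carrier R" by (rule P.Icarr)
        have "a \<odot>\<^bsub>M\<^esub> (p \<odot>\<^bsub>M\<^esub> w) \<in> ?T z" if w: "w \<in> carrier M" and a: "a \<in> I" for w a
        proof -
          have ac: "a \<in> carrier R" using a I by blast
          have "a \<odot>\<^bsub>M\<^esub> w \<in> ?S z" using a w by (simp add: I_def colon_def)
          then have "p \<odot>\<^bsub>M\<^esub> (a \<odot>\<^bsub>M\<^esub> w) \<in> ?T z"
            by (rule saturation_cyclic_smult[OF P.is_ideal p z])
          moreover have "p \<odot>\<^bsub>M\<^esub> (a \<odot>\<^bsub>M\<^esub> w) = a \<odot>\<^bsub>M\<^esub> (p \<odot>\<^bsub>M\<^esub> w)"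
            using ac pc w by (simp add: R.m_comm flip: smult_assoc1)
          ultimately show ?thesis by simp
        qed
        then show "p \<in> colon R M ?N" using pc by (simp add: colon_def)
      qed
      then have "?N = carrier M"
        using submodule_colon_set[OF T(1)[OF z] I] saturated_colon_set[OF T(2)[OF z] I] by (intro *)
      then have "I \<subseteq> colon R M (?T z)" using I unfolding colon_def by blast
      then have "z \<in> ?T z" using H[OF z T[OF z]] unfolding I_def by blast
      then obtain u where u: "u \<in> carrier R" "u \<notin> P" "u \<odot>\<^bsub>M\<^esub> z \<in> {p \<odot>\<^bsub>M\<^esub> z | p. p \<in> P}"
        by (rule saturationE)
      then obtain p where p: "p \<in> P" "u \<odot>\<^bsub>M\<^esub> z = p \<odot>\<^bsub>M\<^esub> z" by blast
      \<comment> \<open>Locally \<open>z\<close> is a \<open>P\<close>-multiple of itself, so a unit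
        at \<open>P\<close> kills it.\<close>
      have "(u \<ominus> p) \<odot>\<^bsub>M\<^esub> z = \<zero>\<^bsub>M\<^esub>"
        using u p P.Icarr[OF p(1)] z by (simp add: smult_diff_distr M.r_neg M.minus_eq)
      then show ?thesis using prime_complement_diff[OF P u(1,2) p(1)] z by (intro saturationI) auto
    qed
    moreover have "{\<zero>\<^bsub>M\<^esub>} \<subseteq> {r \<odot>\<^bsub>M\<^esub> \<zero>\<^bsub>M\<^esub> | r. r \<in> carrier R}" using cyclic_self[OF M.zero_closed] by blast
    ultimately have "carrier M \<subseteq> ?S \<zero>\<^bsub>M\<^esub>" using saturation_mono by blast
    then show ?thesis unfolding cyclic_at_def by blast
  qed
qed

text \<open>In a multiplication module colon ideals decide inclusions, so \<open>R z\<close> can be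
  compared with \<open>N\<close>; saturating \<open>R z\<close> only enlarges its colon
  ideal.\<close>

lemma multiplication_imp_cyclic_at:
  assumes "multiplication_module R M" "primeideal P R"
  shows "cyclic_at R M P"
proof (rule cyclic_atI_colon[OF assms(2)])
  fix z N assume z: "z \<in> carrier M" and N: "submodule N R M"
    and le: "colon R M (saturation R M P {r \<odot>\<^bsub>M\<^esub> z | r. r \<in> carrier R}) \<subseteq> colon R M N"
  have C: "submodule {r \<odot>\<^bsub>M\<^esub> z | r. r \<in> carrier R} R M"
    by (rule submodule_cyclic[OF R.oneideal z])
  have "z \<in> {r \<odot>\<^bsub>M\<^esub> z | r. r \<in> carrier R}"
    by (rule cyclic_self[OF z])
  moreover have "{r \<odot>\<^bsub>M\<^esub> z | r. r \<in> carrier R} \<subseteq> N"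
    using colon_mono[OF saturation_extensive[OF assms(2) C]] le
    by (intro multiplication_module_colon_mono[OF assms(1) C N]) blast
  ultimately show "z \<in> N" by blast
qed

text \<open>\<open>x\<close> represents a generator of the fibre at \<open>P\<close>: it is taken
  outside the unique proper saturated submodule whose colon ideal contains \<open>P\<close>.\<close>

lemma quasi_prime_embedding_generator:
  assumes "quasi_prime_embedding R M" "primeideal P R"
  obtains x where "x \<in> carrier M"
    "\<And>N. submodule N R M \<Longrightarrow> saturation R M P N \<subseteq> N \<Longrightarrow> P \<subseteq> colon R M N \<Longrightarrow> x \<in> N \<Longrightarrow> N = carrier M"
proof (cases "\<exists>N. submodule N R M \<and> saturation R M P N \<subseteq> N \<and> P \<subseteq> colon R M N \<and> N \<noteq> carrier M")
  case True
  then obtain N where N: "submodule N R M" "saturation R M P N \<subseteq> N" "P \<subseteq> colon R M N" "N \<noteq> carrier M"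
    by blast
  then obtain x where x: "x \<in> carrier M" "x \<notin> N" using submodule_subset by blast
  show ?thesis
  proof (rule that[OF x(1)], rule ccontr)
    fix L assume L: "submodule L R M" "saturation R M P L \<subseteq> L" "P \<subseteq> colon R M L" "x \<in> L" "L \<noteq> carrier M"
    then have "L = N" using N by (intro prime_submodule_unique[OF assms])
    then show False using L(4) x(2) by simp
  qed
next
  case False
  \<comment> \<open>The fibre is zero and every element generates it; zero is the default.\<close>
  then show ?thesis by (intro that[of "\<zero>\<^bsub>M\<^esub>"]) auto
qed

text \<open>Nakayama's lemma for one generator: the hypothesis applied to \<open>K + P g\<close> gives \<open>u g = k + p g\<close>
  with \<open>u - p \<notin> P\<close>.\<close>

lemma saturation_adjoin_Nakayama:
  assumes P: "primeideal P R" and K: "submodule K R M" and g: "g \<in> carrier M" and x: "x \<in> K"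
    and H: "\<And>N. submodule N R M \<Longrightarrow> saturation R M P N \<subseteq> N \<Longrightarrow> P \<subseteq> colon R M N \<Longrightarrow> x \<in> N \<Longrightarrow> N = carrier M"
    and gen: "carrier M \<subseteq> saturation R M P (adjoin M K (carrier R) g)"
  shows "carrier M \<subseteq> saturation R M P K"
proof -
  interpret P: primeideal P R by fact
  let ?A = "adjoin M K P g"
  have A: "submodule ?A R M" by (rule submodule_adjoin[OF K P.is_ideal g])
  have "P \<subseteq> colon R M (saturation R M P ?A)"
  proof
    fix p assume p: "p \<in> P"
    then have pc: "p \<in> carrier R" by (rule P.Icarr)
    have "p \<odot>\<^bsub>M\<^esub> w \<in> saturation R M P ?A" if w: "w \<in> carrier M" for w
    proof -
      have "w \<in> saturation R M P (adjoin M K (carrier R) g)" using w gen by blast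
      then obtain u where u: "u \<in> carrier R" "u \<notin> P" "u \<odot>\<^bsub>M\<^esub> w \<in> adjoin M K (carrier R) g"
        by (rule saturationE)
      from u(3) obtain k r where kr: "k \<in> K" "r \<in> carrier R" "u \<odot>\<^bsub>M\<^esub> w = k \<oplus>\<^bsub>M\<^esub> r \<odot>\<^bsub>M\<^esub> g"
        by (rule adjoinE)
      have "u \<odot>\<^bsub>M\<^esub> (p \<odot>\<^bsub>M\<^esub> w) = p \<odot>\<^bsub>M\<^esub> (u \<odot>\<^bsub>M\<^esub> w)"
        using u pc w by (simp add: R.m_comm flip: smult_assoc1)
      also have "\<dots> = p \<odot>\<^bsub>M\<^esub> k \<oplus>\<^bsub>M\<^esub> (p \<otimes> r) \<odot>\<^bsub>M\<^esub> g"
        unfolding kr(3) using pc kr submodule_subset[OF K] g by (simp add: smult_r_distr smult_assoc1)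
      also have "\<dots> \<in> ?A"
        using submoduleE(4)[OF K pc kr(1)] P.I_r_closed[OF p kr(2)] by (rule adjoinI)
      finally show ?thesis using u pc w by (intro saturationI[of _ _ u]) auto
    qed
    then show "p \<in> colon R M (saturation R M P ?A)" using pc by (simp add: colon_def)
  qed
  moreover have "x \<in> saturation R M P ?A"
    using x adjoin_base[OF K P.is_ideal g] saturation_extensive[OF P A] by blast
  ultimately have "saturation R M P ?A = carrier M"
    by (intro H submodule_saturation[OF P A] saturation_idem[OF P])
  then have "g \<in> saturation R M P ?A" using g by simp
  then obtain u where u: "u \<in> carrier R" "u \<notin> P" "u \<odot>\<^bsub>M\<^esub> g \<in> ?A" by (rule saturationE)
  from u(3) obtain k p where kp: "k \<in> K" "p \<in> P" "u \<odot>\<^bsub>M\<^esub> g = k \<oplus>\<^bsub>M\<^esub> p \<odot>\<^bsub>M\<^esub> g" by (rule adjoinE)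
  have "(u \<ominus> p) \<odot>\<^bsub>M\<^esub> g = k"
    using u kp P.Icarr[OF kp(2)] g submodule_subset[OF K kp(1)]
    by (simp add: smult_diff_distr M.minus_eq M.a_assoc M.r_neg)
  then have "g \<in> saturation R M P K"
    using prime_complement_diff[OF P u(1,2) kp(2)] g kp(1) by (intro saturationI) auto
  then have "adjoin M K (carrier R) g \<subseteq> saturation R M P K"
    using saturation_extensive[OF P K]
    by (intro adjoin_subset[OF submodule_saturation[OF P K]]) auto
  then have "saturation R M P (adjoin M K (carrier R) g) \<subseteq> saturation R M P K"
    using saturation_mono saturation_idem[OF P] by blast
  then show ?thesis using gen by blast
qed

text \<open>Induction on \<open>G\<close> with \<open>K\<close> varying; together \<open>K\<close>
  and \<open>G\<close> generate \<open>M\<close> at \<open>P\<close>. To remove \<open>g\<close>,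
  the induction hypothesis is used for \<open>K + R g\<close>, and the one-generator lemma then
  drops \<open>g\<close> again. It applies because \<open>x\<close> stays in \<open>K\<close>
  throughout.\<close>

lemma finitely_generated_Nakayama:
  assumes P: "primeideal P R" and "finite G" "G \<subseteq> carrier M"
    and H: "\<And>N. submodule N R M \<Longrightarrow> saturation R M P N \<subseteq> N \<Longrightarrow> P \<subseteq> colon R M N \<Longrightarrow> x \<in> N \<Longrightarrow> N = carrier M"
    and "submodule K R M" "x \<in> K"
    and "\<And>N. submodule N R M \<Longrightarrow> saturation R M P N \<subseteq> N \<Longrightarrow> K \<subseteq> N \<Longrightarrow> G \<subseteq> N \<Longrightarrow> N = carrier M"
  shows "carrier M \<subseteq> saturation R M P K"
  using assms(2,3,5-7)
proof (induction G arbitrary: K)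
  case empty
  then show ?case
    using submodule_saturation[OF P] saturation_idem[OF P] saturation_extensive[OF P]
    by (metis empty_subsetI order_refl)
next
  case (insert g G)
  let ?K = "adjoin M K (carrier R) g"
  have g: "g \<in> carrier M" using insert.prems by simp
  have K': "submodule ?K R M" by (rule submodule_adjoin[OF insert.prems(2) R.oneideal g])
  have "carrier M \<subseteq> saturation R M P ?K"
  proof (rule insert.IH[OF _ K'])
    show "G \<subseteq> carrier M" using insert.prems by simp
    show "x \<in> ?K" using adjoin_base[OF insert.prems(2) R.oneideal g] insert.prems(3) by blast
    fix N assume N: "submodule N R M" "saturation R M P N \<subseteq> N" "?K \<subseteq> N" "G \<subseteq> N"
    then show "N = carrier M"
      using insert.prems(4)[of N] adjoin_base[OF insert.prems(2) R.oneideal g]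
        adjoin_self[OF insert.prems(2) g] by blast
  qed
  then show ?case using saturation_adjoin_Nakayama[OF P insert.prems(2) g insert.prems(3)] H by blast
qed

text \<open>Nakayama's lemma for \<open>K = R x\<close>, where \<open>x\<close> generates the
  fibre.\<close>

lemma finitely_generated_imp_cyclic_at:
  assumes "finitely_generated_module R M" "quasi_prime_embedding R M" and P: "primeideal P R"
  shows "cyclic_at R M P"
proof -
  obtain G where G: "G \<subseteq> carrier M" "finite G" "module_span R M G = carrier M"
    using assms(1) unfolding finitely_generated_module_def by blast
  obtain x where x: "x \<in> carrier M"
    "\<And>N. submodule N R M \<Longrightarrow> saturation R M P N \<subseteq> N \<Longrightarrow> P \<subseteq> colon R M N \<Longrightarrow> x \<in> N \<Longrightarrow> N = carrier M"
    using quasi_prime_embedding_generator[OF assms(2,3)] by blast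
  have "x \<in> {r \<odot>\<^bsub>M\<^esub> x | r. r \<in> carrier R}"
    by (rule cyclic_self[OF x(1)])
  moreover have "N = carrier M" if "submodule N R M" "G \<subseteq> N" for N
    using span_least[OF that] G(3) submodule_subset[OF that(1)] by blast
  ultimately have "carrier M \<subseteq> saturation R M P {r \<odot>\<^bsub>M\<^esub> x | r. r \<in> carrier R}"
    using finitely_generated_Nakayama[OF P G(2,1) x(2) submodule_cyclic[OF R.oneideal x(1)]] by blast
  then show ?thesis using x(1) unfolding cyclic_at_def by blast
qed

end

section \<open>Common generators at finitely many maximal ideals\<close>

lemma (in cring) exists_maximalideal:
  assumes "ideal I R" "I \<noteq> carrier R"
  shows "\<exists>m. maximalideal m R \<and> I \<subseteq> m"
proof -
  let ?A = "{J. ideal J R \<and> I \<subseteq> J \<and> \<one> \<notin> J}"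
  have "I \<in> ?A" using assms ideal.one_imp_carrier by blast
  then have "\<exists>m \<in> ?A. \<forall>J \<in> ?A. m \<subseteq> J \<longrightarrow> J = m"
  proof (intro subset_Zorn_nonempty)
    fix C assume C: "C \<noteq> {}" "subset.chain ?A C"
    then have "subset.chain {J. ideal J R} C" by (auto simp: pred_on.chain_def)
    then have "ideal (\<Union>C) R" using chain_Union_is_ideal[of C] C(1) by simp
    moreover have "I \<subseteq> \<Union>C" using C unfolding pred_on.chain_def by fast
    moreover have "\<one> \<notin> \<Union>C" using C unfolding pred_on.chain_def by fast
    ultimately show "\<Union>C \<in> ?A" by blast
  qed blast
  then obtain m where "m \<in> ?A" and max: "\<forall>J \<in> ?A. m \<subseteq> J \<longrightarrow> J = m" by (rule bexE)
  then have m: "ideal m R" "I \<subseteq> m" "\<one> \<notin> m" by simp_all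
  have "maximalideal m R"
  proof (rule maximalidealI[OF m(1)])
    show "carrier R \<noteq> m" using m(3) by auto
    fix J assume J: "ideal J R" "m \<subseteq> J" "J \<subseteq> carrier R"
    have "J = m" if "\<one> \<notin> J"
    proof -
      have "J \<in> ?A" using J(1,2) m(2) that by auto
      then show ?thesis using max J(2) by blast
    qed
    then show "J = m \<or> J = carrier R" using ideal.one_imp_carrier[OF J(1)] by blast
  qed
  then show ?thesis using m(2) by blast
qed

text \<open>No other maximal ideal lies inside \<open>m\<close>, so each one contains an element
  outside \<open>m\<close>, and the product of these works. Adding \<open>e y\<close> to a vector
  can alter it modulo \<open>m\<close> but leaves it unchanged modulo the ideals of
  \<open>F\<close>.\<close>

lemma (in cring) maximalideal_avoid:
  assumes "maximalideal m R" "finite F" "\<forall>I \<in> F. maximalideal I R" "m \<notin> F"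
  shows "\<exists>e \<in> carrier R. e \<notin> m \<and> (\<forall>I \<in> F. e \<in> I)"
  using assms(2-4)
proof (induction F)
  interpret m: primeideal m R using maximalideal_prime[OF assms(1)] .
  case empty
  then show ?case using m.I_notcarr m.one_imp_carrier by auto
next
  interpret m: primeideal m R using maximalideal_prime[OF assms(1)] .
  case (insert I F)
  then obtain e where e: "e \<in> carrier R" "e \<notin> m" "\<forall>I \<in> F. e \<in> I" by auto
  interpret I: maximalideal I R using insert.prems by simp
  have "\<not> I \<subseteq> m"
    using I.I_maximal[OF m.is_ideal] m.a_subset m.I_notcarr insert.prems by auto
  then obtain f where f: "f \<in> I" "f \<notin> m" by blast
  have fc: "f \<in> carrier R" using f I.Icarr by blast
  have "e \<otimes> f \<in> J" if "J \<in> insert I F" for J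
    using that f e fc I.I_l_closed insert.prems
      ideal.I_r_closed[OF maximalideal.axioms(1)] by (metis insert_iff)
  moreover have "e \<otimes> f \<notin> m" using m.I_prime[OF e(1) fc] e(2) f(2) by blast
  ultimately show ?case using e(1) fc by (intro bexI[of _ "e \<otimes> f"]) auto
qed

text \<open>The ideal \<open>m + R u\<close> is strictly larger than \<open>m\<close>, hence all of
  \<open>R\<close>; \<open>a\<close> is an inverse of \<open>u\<close> modulo
  \<open>m\<close>.\<close>

lemma (in cring) maximalideal_inverse:
  assumes "maximalideal m R" "u \<in> carrier R" "u \<notin> m"
  shows "\<exists>a \<in> carrier R. \<exists>p \<in> m. \<one> = p \<oplus> a \<otimes> u"
proof -
  interpret m: maximalideal m R by fact
  let ?J = "m <+>\<^bsub>R\<^esub> PIdl u"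
  have PI: "ideal (PIdl u) R" by (rule cgenideal_ideal[OF assms(2)])
  have J: "ideal ?J R" by (rule add_ideals[OF m.is_ideal PI])
  have "m \<subseteq> ?J"
  proof
    fix p assume p: "p \<in> m"
    then have "p = p \<oplus> \<zero>" by (simp add: m.Icarr)
    then show "p \<in> ?J"
      unfolding set_add_def' using p additive_subgroup.zero_closed[OF ideal.axioms(1)[OF PI]] by blast
  qed
  moreover have "u \<in> ?J"
  proof -
    have "u = \<zero> \<oplus> u" using assms(2) by simp
    then show ?thesis unfolding set_add_def' using cgenideal_self[OF assms(2)] m.zero_closed by blast
  qed
  ultimately have "?J = carrier R"
    using m.I_maximal[OF J] assms(3) ideal.Icarr[OF J] by blast
  then have "\<one> \<in> ?J" by simp
  then show ?thesis unfolding set_add_def' cgenideal_def by blast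
qed

section \<open>Local-global principles and generators common to several maximal ideals\<close>

context module
begin

text \<open>The quotient \<open>M / N\<close> is a vector space over the field \<open>R / m\<close>,
  on which every \<open>u\<close> outside \<open>m\<close> acts invertibly.\<close>

lemma maximal_saturated:
  assumes "maximalideal m R" "submodule N R M" "m \<subseteq> colon R M N"
  shows "saturation R M m N \<subseteq> N"
proof
  fix w assume "w \<in> saturation R M m N"
  then obtain u where u: "w \<in> carrier M" "u \<in> carrier R" "u \<notin> m" "u \<odot>\<^bsub>M\<^esub> w \<in> N" by (rule saturationE)
  obtain a p where ap: "a \<in> carrier R" "p \<in> m" "\<one> = p \<oplus> a \<otimes> u"
    using R.maximalideal_inverse[OF assms(1) u(2,3)] by blast
  have pc: "p \<in> carrier R" using ap(2) assms(3) colon_subset by blast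
  have "w = \<one> \<odot>\<^bsub>M\<^esub> w" using u by simp
  also have "\<dots> = p \<odot>\<^bsub>M\<^esub> w \<oplus>\<^bsub>M\<^esub> a \<odot>\<^bsub>M\<^esub> (u \<odot>\<^bsub>M\<^esub> w)"
    unfolding ap(3) using pc ap(1) u by (simp add: smult_l_distr smult_assoc1)
  also have "\<dots> \<in> N"
  proof (rule submoduleE(5)[OF assms(2)])
    show "p \<odot>\<^bsub>M\<^esub> w \<in> N" using ap(2) assms(3) u(1) by (auto simp: colon_def)
    show "a \<odot>\<^bsub>M\<^esub> (u \<odot>\<^bsub>M\<^esub> w) \<in> N" using submoduleE(4)[OF assms(2) ap(1) u(4)] .
  qed
  finally show "w \<in> N" .
qed

text \<open>The elements \<open>r\<close> with \<open>r z\<close> in \<open>N\<close> form an ideal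
  that lies in no maximal ideal, so it contains one.\<close>

lemma submodule_local_mem:
  assumes N: "submodule N R M" and z: "z \<in> carrier M"
    and loc: "\<And>m. maximalideal m R \<Longrightarrow> z \<in> saturation R M m N"
  shows "z \<in> N"
proof (rule ccontr)
  assume "z \<notin> N"
  let ?J = "{r \<in> carrier R. r \<odot>\<^bsub>M\<^esub> z \<in> N}"
  have J: "ideal ?J R"
  proof (rule idealI[OF R.ring_axioms])
    show "subgroup ?J (add_monoid R)"
      using submoduleE(3,5)[OF N] submodule_zero[OF N] z
      by (intro R.add.subgroupI)
        (auto simp: smult_l_minus smult_l_distr simp flip: a_inv_def intro!: exI[of _ \<zero>])
    show "x \<otimes> a \<in> ?J" if "a \<in> ?J" "x \<in> carrier R" for a x
      using that submoduleE(4)[OF N] z by (simp add: smult_assoc1)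
    then show "a \<otimes> x \<in> ?J" if "a \<in> ?J" "x \<in> carrier R" for a x
      using that by (simp add: R.m_comm)
  qed
  moreover have "\<one> \<notin> ?J" using \<open>z \<notin> N\<close> z by simp
  then have "?J \<noteq> carrier R" using R.one_closed by blast
  ultimately obtain m where m: "maximalideal m R" "?J \<subseteq> m"
    using R.exists_maximalideal by blast
  obtain u where "u \<in> carrier R" "u \<notin> m" "u \<odot>\<^bsub>M\<^esub> z \<in> N" using loc[OF m(1)] by (rule saturationE)
  then show False using m(2) by blast
qed

text \<open>The product of finitely many denominators is a common one, and it avoids
  \<open>P\<close> because \<open>P\<close> is prime.\<close>

lemma finite_subset_saturation:
  assumes P: "primeideal P R" and K: "submodule K R M" and "finite G" "G \<subseteq> saturation R M P K"
  shows "\<exists>u \<in> carrier R. u \<notin> P \<and> (\<forall>g \<in> G. u \<odot>\<^bsub>M\<^esub> g \<in> K)"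
  using assms(3,4)
proof (induction G)
  interpret P: primeideal P R by fact
  case empty
  then show ?case using P.I_notcarr P.one_imp_carrier by auto
next
  interpret P: primeideal P R by fact
  case (insert g G)
  then obtain u where u: "u \<in> carrier R" "u \<notin> P" "\<forall>g \<in> G. u \<odot>\<^bsub>M\<^esub> g \<in> K" by auto
  have "g \<in> saturation R M P K" using insert.prems by simp
  then obtain v where v: "g \<in> carrier M" "v \<in> carrier R" "v \<notin> P" "v \<odot>\<^bsub>M\<^esub> g \<in> K" by (rule saturationE)
  have "(v \<otimes> u) \<odot>\<^bsub>M\<^esub> h \<in> K" if h: "h \<in> insert g G" for h
  proof (cases "h = g")
    case True
    have "(v \<otimes> u) \<odot>\<^bsub>M\<^esub> h = u \<odot>\<^bsub>M\<^esub> (v \<odot>\<^bsub>M\<^esub> g)"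
      unfolding True using u v by (simp add: R.m_comm flip: smult_assoc1)
    then show ?thesis using submoduleE(4)[OF K u(1) v(4)] by simp
  next
    case False
    then have "h \<in> G" "h \<in> carrier M" using h insert.prems by (auto simp: saturation_def)
    then show ?thesis using u v submoduleE(4)[OF K v(2)] by (simp add: smult_assoc1)
  qed
  then show ?case using u v P.I_prime by (intro bexI[of _ "v \<otimes> u"]) auto
qed

text \<open>Membership of \<open>z\<close> in \<open>(N:M) M\<close> is tested at each maximal ideal
  \<open>m\<close>. Finite generation supplies a single \<open>u\<close> outside \<open>m\<close>
  with \<open>u M \<subseteq> R x\<close>; this uniformity puts a suitable scalar into
  \<open>(N:M)\<close> itself.\<close>

lemma finitely_generated_locally_cyclic_imp_multiplication:
  assumes fg: "finitely_generated_module R M" and loc: "\<And>m. maximalideal m R \<Longrightarrow> cyclic_at R M m"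
  shows "multiplication_module R M"
  unfolding multiplication_module_iff
proof (intro allI impI subsetI)
  obtain G where G: "G \<subseteq> carrier M" "finite G" "module_span R M G = carrier M"
    using fg unfolding finitely_generated_module_def by blast
  fix N z assume N: "submodule N R M" and zN: "z \<in> N"
  have z: "z \<in> carrier M" by (rule submodule_subset[OF N zN])
  let ?L = "ideal_smult R M (colon R M N)"
  show "z \<in> ?L"
  proof (rule submodule_local_mem[OF submodule_ideal_smult[OF colon_subset] z])
    fix m assume m: "maximalideal m R"
    interpret m: primeideal m R by (rule R.maximalideal_prime[OF m])
    obtain x where x: "x \<in> carrier M" "carrier M \<subseteq> saturation R M m {r \<odot>\<^bsub>M\<^esub> x | r. r \<in> carrier R}"
      using loc[OF m] unfolding cyclic_at_def by blast
    let ?K = "{r \<odot>\<^bsub>M\<^esub> x | r. r \<in> carrier R}"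
    have K: "submodule ?K R M" by (rule submodule_cyclic[OF R.oneideal x(1)])
    obtain u where u: "u \<in> carrier R" "u \<notin> m" "\<forall>g \<in> G. u \<odot>\<^bsub>M\<^esub> g \<in> ?K"
      using finite_subset_saturation[OF m.primeideal K G(2)] G(1) x(2) by blast
    \<comment> \<open>The elements that \<open>u\<close> carries into \<open>R x\<close> form a
      submodule; it contains the generators, so it is \<open>M\<close>.\<close>
    have "G \<subseteq> {w \<in> carrier M. \<forall>a \<in> {u}. a \<odot>\<^bsub>M\<^esub> w \<in> ?K}" using G(1) u(3) by auto
    then have "carrier M \<subseteq> {w \<in> carrier M. \<forall>a \<in> {u}. a \<odot>\<^bsub>M\<^esub> w \<in> ?K}"
      using span_least[OF submodule_colon_set[OF K]] u(1) G(3) by blast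
    then have uM: "\<exists>s \<in> carrier R. u \<odot>\<^bsub>M\<^esub> w = s \<odot>\<^bsub>M\<^esub> x" if "w \<in> carrier M" for w
      using that by blast
    obtain r where r: "r \<in> carrier R" "u \<odot>\<^bsub>M\<^esub> z = r \<odot>\<^bsub>M\<^esub> x" using uM[OF z] by blast
    \<comment> \<open>With \<open>u z = r x\<close> and \<open>u w = s x\<close>, both
      \<open>r (u w)\<close> and \<open>s (u z)\<close> equal \<open>(r s) x\<close>, and the second
      lies in \<open>N\<close>.\<close>
    have "(r \<otimes> u) \<odot>\<^bsub>M\<^esub> w \<in> N" if w: "w \<in> carrier M" for w
    proof -
      obtain s where s: "s \<in> carrier R" "u \<odot>\<^bsub>M\<^esub> w = s \<odot>\<^bsub>M\<^esub> x" using uM[OF w] by blast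
      have "(r \<otimes> u) \<odot>\<^bsub>M\<^esub> w = r \<odot>\<^bsub>M\<^esub> (s \<odot>\<^bsub>M\<^esub> x)" using r u w s(2) by (simp add: smult_assoc1)
      also have "\<dots> = s \<odot>\<^bsub>M\<^esub> (u \<odot>\<^bsub>M\<^esub> z)"
        unfolding r(2) using r(1) s(1) x(1) by (simp add: R.m_comm flip: smult_assoc1)
      finally show ?thesis using submoduleE(4)[OF N] s(1) u(1) zN by simp
    qed
    then have "r \<otimes> u \<in> colon R M N" using r(1) u(1) by (simp add: colon_def)
    then have "r \<otimes> u \<in> colon R M ?L" using colon_ideal_smult[OF colon_subset] by blast
    then have "(r \<otimes> u) \<odot>\<^bsub>M\<^esub> x \<in> ?L" using x(1) by (simp add: colon_def)
    \<comment> \<open>The square arises because one factor \<open>u\<close> replaces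
      \<open>z\<close> by \<open>r x\<close> and the other moves \<open>r\<close> into
      \<open>(N:M)\<close>.\<close>
    moreover have "(u \<otimes> u) \<odot>\<^bsub>M\<^esub> z = u \<odot>\<^bsub>M\<^esub> (r \<odot>\<^bsub>M\<^esub> x)"
      using r(2) u(1) z by (simp add: smult_assoc1)
    moreover have "u \<odot>\<^bsub>M\<^esub> (r \<odot>\<^bsub>M\<^esub> x) = (r \<otimes> u) \<odot>\<^bsub>M\<^esub> x"
      using r(1) u(1) x(1) by (simp add: R.m_comm flip: smult_assoc1)
    ultimately show "z \<in> saturation R M m ?L"
      using u z m.I_prime by (intro saturationI[of _ _ "u \<otimes> u"]) auto
  qed
qed

text \<open>Induction on \<open>F\<close> in the manner of the Chinese remainder theorem. If
  \<open>x\<close> fails at the new ideal \<open>m\<close>, it lies in the unique proper submodule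
  \<open>K\<close> there and is corrected to \<open>x + e y\<close>, with \<open>y\<close> outside
  \<open>K\<close> and \<open>e\<close> outside \<open>m\<close> but in all the other
  ideals.\<close>

lemma quasi_prime_embedding_common_generator:
  assumes qpe: "quasi_prime_embedding R M" and "finite F" "\<forall>m \<in> F. maximalideal m R"
  shows "\<exists>x \<in> carrier M. \<forall>m \<in> F. \<forall>N. submodule N R M \<and> m \<subseteq> colon R M N \<and> x \<in> N \<longrightarrow> N = carrier M"
  using assms(2,3)
proof (induction F)
  case (insert m F)
  then obtain x where x: "x \<in> carrier M"
    "\<And>m N. m \<in> F \<Longrightarrow> submodule N R M \<Longrightarrow> m \<subseteq> colon R M N \<Longrightarrow> x \<in> N \<Longrightarrow> N = carrier M"
    by auto
  have m: "maximalideal m R" using insert.prems by simp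
  show ?case
  proof (cases "\<forall>N. submodule N R M \<and> m \<subseteq> colon R M N \<and> x \<in> N \<longrightarrow> N = carrier M")
    case True
    then show ?thesis using x by (intro bexI[of _ x]) auto
  next
    case False
    then obtain K where K: "submodule K R M" "m \<subseteq> colon R M K" "x \<in> K" "K \<noteq> carrier M" by blast
    then obtain y where y: "y \<in> carrier M" "y \<notin> K" using submodule_subset by blast
    obtain e where e: "e \<in> carrier R" "e \<notin> m" "\<forall>I \<in> F. e \<in> I"
      using R.maximalideal_avoid[OF m insert.hyps(1)] insert.prems insert.hyps(2) by auto
    have "N = carrier M"
      if "I \<in> insert m F" and N: "submodule N R M" "I \<subseteq> colon R M N" "x \<oplus>\<^bsub>M\<^esub> e \<odot>\<^bsub>M\<^esub> y \<in> N" for I N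
    proof (cases "I = m")
      case True
      show ?thesis
      proof (rule ccontr)
        assume "N \<noteq> carrier M"
        \<comment> \<open>Uniqueness identifies \<open>N\<close> with \<open>K\<close>. Then
          \<open>K\<close> contains \<open>e y\<close>, and since \<open>e\<close> is a unit modulo
          \<open>m\<close>, also \<open>y\<close>.\<close>
        then have "N = K"
          using N(1,2) K True maximal_saturated[OF m]
          by (intro prime_submodule_unique[OF qpe R.maximalideal_prime[OF m]]) auto
        then have "e \<odot>\<^bsub>M\<^esub> y \<oplus>\<^bsub>M\<^esub> x \<in> K" using N(3) x(1) e(1) y(1) by (simp add: M.a_comm)
        then have "e \<odot>\<^bsub>M\<^esub> y \<in> K" using submodule_add_cancel[OF K(1)] K(3) e(1) y(1) by blast
        then have "y \<in> saturation R M m K" using e y by (intro saturationI) auto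
        then show False using maximal_saturated[OF m K(1,2)] y(2) by blast
      qed
    next
      case False
      then have I: "I \<in> F" using that(1) by simp
      \<comment> \<open>Here \<open>e\<close> lies in \<open>I \<subseteq> (N:M)\<close>, so the
        correction term disappears modulo \<open>N\<close>.\<close>
      then have "e \<odot>\<^bsub>M\<^esub> y \<in> N" using e(3) N(2) y(1) by (auto simp: colon_def)
      then have "x \<in> N" using submodule_add_cancel[OF N(1,3)] x(1) by blast
      then show ?thesis using x(2)[OF I N(1,2)] by blast
    qed
    then show ?thesis using x(1) e(1) y(1) by (intro bexI[of _ "x \<oplus>\<^bsub>M\<^esub> e \<odot>\<^bsub>M\<^esub> y"]) auto
  qed
qed auto

lemma cyclic_moduleI:
  assumes "x \<in> carrier M" "carrier M \<subseteq> {r \<odot>\<^bsub>M\<^esub> x | r. r \<in> carrier R}"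
  shows "cyclic_module R M"
proof -
  have "{r \<odot>\<^bsub>M\<^esub> x | r. r \<in> carrier R} \<subseteq> carrier M" using assms(1) by auto
  then show ?thesis using assms unfolding cyclic_module_def by blast
qed

text \<open>Let \<open>x\<close> generate the fibres at all maximal ideals and let \<open>y\<close>
  generate \<open>M\<close> at \<open>m\<close>. Then \<open>x\<close> is locally a multiple of
  \<open>y\<close>, with a unit as coefficient unless the fibre, and with it the localization, is
  zero. So \<open>R x\<close> is all of \<open>M\<close> at each maximal ideal.\<close>

lemma semilocal_locally_cyclic_imp_cyclic:
  assumes "semilocal_ring R" "quasi_prime_embedding R M" "\<And>m. maximalideal m R \<Longrightarrow> cyclic_at R M m"
  shows "cyclic_module R M"
proof -
  obtain x where x: "x \<in> carrier M" "\<forall>m \<in> {m. maximalideal m R}. \<forall>N.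
      submodule N R M \<and> m \<subseteq> colon R M N \<and> x \<in> N \<longrightarrow> N = carrier M"
    using quasi_prime_embedding_common_generator[OF assms(2) assms(1)[unfolded semilocal_ring_def]]
    by blast
  let ?K = "{r \<odot>\<^bsub>M\<^esub> x | r. r \<in> carrier R}"
  have K: "submodule ?K R M" by (rule submodule_cyclic[OF R.oneideal x(1)])
  have "carrier M \<subseteq> saturation R M m ?K" if m: "maximalideal m R" for m
  proof -
    interpret m: primeideal m R by (rule R.maximalideal_prime[OF m])
    obtain y where y: "y \<in> carrier M" "carrier M \<subseteq> saturation R M m {r \<odot>\<^bsub>M\<^esub> y | r. r \<in> carrier R}"
      using assms(3)[OF m] unfolding cyclic_at_def by blast
    let ?L = "saturation R M m {p \<odot>\<^bsub>M\<^esub> y | p. p \<in> m}"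
    have L: "submodule ?L R M"
      by (rule submodule_saturation[OF m.primeideal submodule_cyclic[OF m.is_ideal y(1)]])
    have mL: "m \<subseteq> colon R M ?L"
      using saturation_cyclic_smult[OF m.is_ideal _ y(1)] y(2) m.Icarr
      unfolding colon_def by blast
    have "y \<in> saturation R M m ?K"
    proof (cases "x \<in> ?L")
      case True
      \<comment> \<open>Locally \<open>?L\<close> is \<open>m y\<close>. By the choice of
        \<open>x\<close> it is all of \<open>M\<close>, so \<open>y\<close> is an
        \<open>m\<close>-multiple of itself and vanishes locally.\<close>
      then have "?L = carrier M" using x(2) m L mL by blast
      then have "y \<in> ?L" using y(1) by simp
      then obtain u where u: "u \<in> carrier R" "u \<notin> m" "u \<odot>\<^bsub>M\<^esub> y \<in> {p \<odot>\<^bsub>M\<^esub> y | p. p \<in> m}"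
        by (rule saturationE)
      then obtain p where p: "p \<in> m" "u \<odot>\<^bsub>M\<^esub> y = p \<odot>\<^bsub>M\<^esub> y" by blast
      have "(u \<ominus> p) \<odot>\<^bsub>M\<^esub> y = \<zero>\<^bsub>M\<^esub>"
        using u p m.Icarr[OF p(1)] y(1) by (simp add: smult_diff_distr M.r_neg M.minus_eq)
      then show ?thesis
        using prime_complement_diff[OF m.primeideal u(1,2) p(1)] y(1) submodule_zero[OF K]
        by (intro saturationI[of _ _ "u \<ominus> p"]) auto
    next
      case False
      have "x \<in> saturation R M m {r \<odot>\<^bsub>M\<^esub> y | r. r \<in> carrier R}" using x(1) y(2) by blast
      then obtain s where s: "s \<in> carrier R" "s \<notin> m" "s \<odot>\<^bsub>M\<^esub> x \<in> {r \<odot>\<^bsub>M\<^esub> y | r. r \<in> carrier R}"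
        by (rule saturationE)
      then obtain r where r: "r \<in> carrier R" "s \<odot>\<^bsub>M\<^esub> x = r \<odot>\<^bsub>M\<^esub> y" by blast
      \<comment> \<open>Were \<open>r\<close> in \<open>m\<close>, \<open>x\<close> would lie in
        \<open>?L\<close>. So \<open>s x = r y\<close> can be read backwards, as expressing
        \<open>y\<close> by \<open>x\<close> at \<open>m\<close>.\<close>
      have "r \<notin> m"
      proof
        assume "r \<in> m"
        then have "s \<odot>\<^bsub>M\<^esub> x \<in> {p \<odot>\<^bsub>M\<^esub> y | p. p \<in> m}" unfolding r(2) by blast
        then have "x \<in> ?L" by (rule saturationI[OF x(1) s(1,2)])
        then show False using False by contradiction
      qed
      moreover have "r \<odot>\<^bsub>M\<^esub> y \<in> ?K" unfolding r(2)[symmetric] using s(1) by blast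
      ultimately show ?thesis using r(1) y(1) by (intro saturationI[of _ _ r]) auto
    qed
    then have "{r \<odot>\<^bsub>M\<^esub> y | r. r \<in> carrier R} \<subseteq> saturation R M m ?K"
      using submoduleE(4)[OF submodule_saturation[OF m.primeideal K]] by blast
    then have "saturation R M m {r \<odot>\<^bsub>M\<^esub> y | r. r \<in> carrier R} \<subseteq> saturation R M m ?K"
      using saturation_mono saturation_idem[OF m.primeideal] by blast
    then show ?thesis using y(2) by blast
  qed
  then have "carrier M \<subseteq> ?K" using submodule_local_mem[OF K] by blast
  then show ?thesis using x(1) by (intro cyclic_moduleI)
qed

text \<open>This stands in for the fact that \<open>I\<close> contains a product of maximal ideals:
  \<open>?good I\<close> says that \<open>N = M\<close> once \<open>I M \<subseteq> N\<close> and
  \<open>N + m M = M\<close> for all \<open>m\<close> in \<open>F\<close>. The proof is Noetherian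
  induction. A maximal counterexample \<open>B\<close> is neither the unit ideal nor maximal, hence
  not prime, and a product \<open>a b\<close> in \<open>B\<close> leads to the larger ideals
  \<open>B + R a\<close> and \<open>B + R b\<close>.\<close>

lemma noetherian_maximal_cover:
  assumes noeth: "noetherian_ring R" and I: "ideal I R"
    and dim: "\<forall>P. primeideal P R \<longrightarrow> I \<subseteq> P \<longrightarrow> maximalideal P R"
  shows "\<exists>F. finite F \<and> (\<forall>m \<in> F. maximalideal m R) \<and>
    (\<forall>N. submodule N R M \<and> I \<subseteq> colon R M N \<and>
      (\<forall>m \<in> F. \<forall>L. submodule L R M \<and> N \<subseteq> L \<and> m \<subseteq> colon R M L \<longrightarrow> L = carrier M) \<longrightarrow> N = carrier M)"
    (is "?good I")
proof (rule ccontr)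
  assume "\<not> ?good I"
  let ?A = "{J. ideal J R \<and> I \<subseteq> J \<and> \<not> ?good J}"
  have "\<exists>B \<in> ?A. \<forall>J \<in> ?A. B \<subseteq> J \<longrightarrow> J = B"
  proof (intro subset_Zorn_nonempty)
    show "?A \<noteq> {}" using I \<open>\<not> ?good I\<close> by blast
    fix C assume C: "C \<noteq> {}" "subset.chain ?A C"
    then have "subset.chain {J. ideal J R} C" by (auto simp: pred_on.chain_def)
    then have "\<Union>C \<in> C" by (rule noetherian_ring.ideal_chain_is_trivial[OF noeth C(1)])
    then show "\<Union>C \<in> ?A" using C(2) unfolding pred_on.chain_def by (meson subsetD)
  qed
  then obtain B where "B \<in> ?A" and max': "\<forall>J \<in> ?A. B \<subseteq> J \<longrightarrow> J = B" by (rule bexE)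
  then have B: "ideal B R" "I \<subseteq> B" "\<not> ?good B" by simp_all
  have max: "?good J" if J: "ideal J R" "B \<subseteq> J" "J \<noteq> B" for J
  proof (rule ccontr)
    assume "\<not> ?good J"
    then have "J \<in> ?A" using J(1,2) B(2) by simp
    then show False using max' J(2,3) by blast
  qed
  \<comment> \<open>For the unit ideal the empty \<open>F\<close> works, since its only
    \<open>N\<close> is \<open>M\<close>.\<close>
  have "?good (carrier R)"
    using colon_eq_carrier_iff colon_subset by (intro exI[of _ "{}"]) blast
  then have nc: "carrier R \<noteq> B" using B(3) by metis
  have "\<not> maximalideal B R"
  proof
    assume "maximalideal B R"
    then have "?good B" by (intro exI[of _ "{B}"]) auto
    then show False using B(3) by contradiction
  qed
  then have "\<not> primeideal B R" using dim B(2) by blast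
  then obtain a b where ab: "a \<in> carrier R" "b \<in> carrier R" "a \<otimes> b \<in> B" "a \<notin> B" "b \<notin> B"
    using primeidealI[OF B(1) R.is_cring nc] by blast
  define good where "good J \<longleftrightarrow> ?good J" for J
  \<comment> \<open>The ideal generated by \<open>B\<close> and \<open>c\<close> is strictly larger
    than \<open>B\<close>, hence good, and lies in every colon ideal containing \<open>B\<close> and
    \<open>c\<close>.\<close>
  have ext: "\<exists>J. good J \<and> (\<forall>N. submodule N R M \<longrightarrow> B \<subseteq> colon R M N \<longrightarrow> c \<in> colon R M N \<longrightarrow> J \<subseteq> colon R M N)"
    if c: "c \<in> carrier R" "c \<notin> B" for c
  proof (intro exI conjI allI impI)
    have sub: "insert c B \<subseteq> carrier R" using c ideal.Icarr[OF B(1)] by blast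
    have J: "ideal (Idl (insert c B)) R" "insert c B \<subseteq> Idl (insert c B)"
      using R.genideal_ideal[OF sub] R.genideal_self[OF sub] by auto
    then show "good (Idl (insert c B))" unfolding good_def using c(2) by (intro max) auto
    show "Idl (insert c B) \<subseteq> colon R M N"
      if "submodule N R M" "B \<subseteq> colon R M N" "c \<in> colon R M N" for N
      using R.genideal_minimal[OF ideal_colon[OF that(1)]] that(2,3) by simp
  qed
  obtain J1 where J1: "good J1"
    "\<forall>N. submodule N R M \<longrightarrow> B \<subseteq> colon R M N \<longrightarrow> a \<in> colon R M N \<longrightarrow> J1 \<subseteq> colon R M N"
    using ext[OF ab(1,4)] by (elim exE conjE)
  obtain J2 where J2: "good J2"
    "\<forall>N. submodule N R M \<longrightarrow> B \<subseteq> colon R M N \<longrightarrow> b \<in> colon R M N \<longrightarrow> J2 \<subseteq> colon R M N"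
    using ext[OF ab(2,5)] by (elim exE conjE)
  obtain F1 where F1: "finite F1" "\<forall>m \<in> F1. maximalideal m R"
    "\<forall>N. submodule N R M \<and> J1 \<subseteq> colon R M N \<and>
      (\<forall>m \<in> F1. \<forall>L. submodule L R M \<and> N \<subseteq> L \<and> m \<subseteq> colon R M L \<longrightarrow> L = carrier M) \<longrightarrow> N = carrier M"
    using J1(1) unfolding good_def by (elim exE conjE)
  obtain F2 where F2: "finite F2" "\<forall>m \<in> F2. maximalideal m R"
    "\<forall>N. submodule N R M \<and> J2 \<subseteq> colon R M N \<and>
      (\<forall>m \<in> F2. \<forall>L. submodule L R M \<and> N \<subseteq> L \<and> m \<subseteq> colon R M L \<longrightarrow> L = carrier M) \<longrightarrow> N = carrier M"
    using J2(1) unfolding good_def by (elim exE conjE)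
  have "N = carrier M"
    if N: "submodule N R M" "B \<subseteq> colon R M N"
      and cov: "\<forall>m \<in> F1 \<union> F2. \<forall>L. submodule L R M \<and> N \<subseteq> L \<and> m \<subseteq> colon R M L \<longrightarrow> L = carrier M" for N
  proof -
    \<comment> \<open>The residual of \<open>N\<close> by \<open>a\<close>. Since
      \<open>a b M \<subseteq> N\<close>, it contains \<open>b M\<close>, and \<open>F2\<close>
      shows that it is \<open>M\<close>. Then \<open>a M \<subseteq> N\<close>, and
      \<open>F1\<close> shows that \<open>N = M\<close>.\<close>
    let ?N = "{w \<in> carrier M. \<forall>c \<in> {a}. c \<odot>\<^bsub>M\<^esub> w \<in> N}"
    have N': "submodule ?N R M" using submodule_colon_set[OF N(1), of "{a}"] ab(1) by simp
    have NN': "N \<subseteq> ?N" using submoduleE(4)[OF N(1) ab(1)] submodule_subset[OF N(1)] by auto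
    have "a \<odot>\<^bsub>M\<^esub> (b \<odot>\<^bsub>M\<^esub> w) \<in> N" if "w \<in> carrier M" for w
    proof -
      have "(a \<otimes> b) \<odot>\<^bsub>M\<^esub> w \<in> N" using N(2) ab(3) that by (auto simp: colon_def)
      then show ?thesis using ab(1,2) that by (simp add: smult_assoc1)
    qed
    then have "b \<in> colon R M ?N" using ab(2) by (simp add: colon_def)
    then have "J2 \<subseteq> colon R M ?N" using J2(2) N' N(2) colon_mono[OF NN'] by blast
    then have "?N = carrier M" using F2(3) N' cov NN' by (meson UnCI order_trans)
    then have "a \<in> colon R M N" using ab(1) unfolding colon_def by blast
    then have "J1 \<subseteq> colon R M N" using J1(2) N by blast
    then show ?thesis using F1(3) N(1) cov by (meson UnCI)
  qed
  then have "?good B" using F1(1,2) F2(1,2) by (intro exI[of _ "F1 \<union> F2"]) auto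
  then show False using B(3) by contradiction
qed

text \<open>The annihilator is nonzero, so every prime ideal above it is maximal and the finite
  cover applies to it. It lies in every colon ideal, so for a common generator \<open>x\<close> the
  cover yields \<open>R x = M\<close>.\<close>

lemma Dedekind_nonfaithful_imp_cyclic:
  assumes "Dedekind_domain R" "\<not> faithful_module R M" "quasi_prime_embedding R M"
  shows "cyclic_module R M"
proof -
  let ?A = "module_annihilator R M"
  have A: "ideal ?A R" unfolding module_annihilator_def by (rule ideal_colon[OF submodule_zero_set])
  have noeth: "noetherian_ring R"
    using assms(1) unfolding Dedekind_domain_def noetherian_domain_def by blast
  have dim: "\<forall>P. primeideal P R \<longrightarrow> ?A \<subseteq> P \<longrightarrow> maximalideal P R"
  proof (intro allI impI)
    fix P assume that: "primeideal P R" "?A \<subseteq> P"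
    have "\<zero> \<in> ?A" using additive_subgroup.zero_closed[OF ideal.axioms(1)[OF A]] .
    then have "P \<noteq> {\<zero>}" using that(2) assms(2) unfolding faithful_module_def by blast
    then show "maximalideal P R" using assms(1) that(1) unfolding Dedekind_domain_def by blast
  qed
  obtain F where F: "finite F" "\<forall>m \<in> F. maximalideal m R"
    "\<forall>N. submodule N R M \<and> ?A \<subseteq> colon R M N \<and>
      (\<forall>m \<in> F. \<forall>L. submodule L R M \<and> N \<subseteq> L \<and> m \<subseteq> colon R M L \<longrightarrow> L = carrier M) \<longrightarrow> N = carrier M"
    using noetherian_maximal_cover[OF noeth A dim] by (elim exE conjE)
  obtain x where x: "x \<in> carrier M"
    "\<forall>m \<in> F. \<forall>N. submodule N R M \<and> m \<subseteq> colon R M N \<and> x \<in> N \<longrightarrow> N = carrier M"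
    using quasi_prime_embedding_common_generator[OF assms(3) F(1,2)] by (elim bexE)
  let ?K = "{r \<odot>\<^bsub>M\<^esub> x | r. r \<in> carrier R}"
  have K: "submodule ?K R M" by (rule submodule_cyclic[OF R.oneideal x(1)])
  have "?A \<subseteq> colon R M ?K"
    unfolding module_annihilator_def using submodule_zero[OF K] by (intro colon_mono) blast
  then have "?K = carrier M" using F(3) K x(2) cyclic_self[OF x(1)] by (meson subsetD)
  then show ?thesis using x(1) by (intro cyclic_moduleI) auto
qed

end

section \<open>Localization\<close>

lemma (in cring) ideal_commI:
  assumes "I \<subseteq> carrier R" "\<zero> \<in> I" "\<And>a b. a \<in> I \<Longrightarrow> b \<in> I \<Longrightarrow> a \<oplus> b \<in> I"
    and l: "\<And>a x. a \<in> I \<Longrightarrow> x \<in> carrier R \<Longrightarrow> x \<otimes> a \<in> I"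
  shows "ideal I R"
proof (rule idealI[OF ring_axioms])
  have "\<ominus> a \<in> I" if "a \<in> I" for a
    using l[OF that, of "\<ominus> \<one>"] that assms(1) by (auto simp: l_minus)
  then show "subgroup I (add_monoid R)"
    using assms(1-3) by (intro add.subgroupI) (auto simp flip: a_inv_def)
  show "x \<otimes> a \<in> I" if "a \<in> I" "x \<in> carrier R" for a x using l that by blast
  then show "a \<otimes> x \<in> I" if "a \<in> I" "x \<in> carrier R" for a x
    using that assms(1) by (metis m_comm subsetD)
qed

lemma submonoid_prime_complement:
  assumes "primeideal P R" shows "submonoid (carrier R - P) R"
proof -
  interpret primeideal P R by fact
  show ?thesis
    using I_prime I_notcarr one_imp_carrier by (intro submonoid.intro) auto
qed

context localization
begin

abbreviation "RS \<equiv> localized_ring R S"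
abbreviation "MS \<equiv> localized_module R S M"
abbreviation "rfrac \<equiv> fraction R S (regular_module R)"

lemma cring_RS: "cring RS"
  by (rule cring_localized_ring[OF R.is_cring S.submonoid_axioms])

lemma module_MS: "module RS MS"
  by (rule module_localized_module[OF module_axioms S.submonoid_axioms])

lemma rfrac_in_carrier_module [simp]:
  "a \<in> carrier R \<Longrightarrow> s \<in> S \<Longrightarrow> rfrac a s \<in> carrier (localized_module R S (regular_module R))"
  using localization.frac_in_carrier[OF regular_localization] by simp

lemma rfrac_in_carrier: "a \<in> carrier R \<Longrightarrow> s \<in> S \<Longrightarrow> rfrac a s \<in> carrier RS"
  by simp

lemma RS_carrierE:
  assumes "a \<in> carrier RS"
  obtains r s where "r \<in> carrier R" "s \<in> S" "a = rfrac r s"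
  using localization.localized_carrierE[OF regular_localization] assms by (metis localized_ring_simps(1) regular_module_simps(1))

lemma rfrac_mult:
  assumes "a \<in> carrier R" "s \<in> S" "b \<in> carrier R" "t \<in> S"
  shows "rfrac a s \<otimes>\<^bsub>RS\<^esub> rfrac b t = rfrac (a \<otimes> b) (s \<otimes> t)"
  using localization.smult_frac[OF regular_localization, of a s b t] assms by simp

lemma rfrac_add:
  assumes "a \<in> carrier R" "s \<in> S" "b \<in> carrier R" "t \<in> S"
  shows "rfrac a s \<oplus>\<^bsub>RS\<^esub> rfrac b t = rfrac (t \<otimes> a \<oplus> s \<otimes> b) (s \<otimes> t)"
  using localization.add_frac[OF regular_localization, of a s b t] assms by simp

lemma rfrac_eq_iff:
  assumes "a \<in> carrier R" "s \<in> S" "b \<in> carrier R" "t \<in> S"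
  shows "rfrac a s = rfrac b t \<longleftrightarrow> (\<exists>u \<in> S. u \<otimes> (t \<otimes> a) = u \<otimes> (s \<otimes> b))"
  using localization.frac_eq_iff[OF regular_localization, of a s b t] assms by simp

lemma rfrac_eqI:
  assumes "a \<in> carrier R" "s \<in> S" "b \<in> carrier R" "t \<in> S" "t \<otimes> a = s \<otimes> b"
  shows "rfrac a s = rfrac b t"
  using localization.frac_eqI[OF regular_localization, of a s b t] assms by simp

lemma RS_zero: "\<zero>\<^bsub>RS\<^esub> = rfrac \<zero> \<one>"
  using localization.zero_localized[OF regular_localization] by simp

text \<open>The scalars \<open>s/1\<close> and \<open>1/s\<close> are inverse to each other, so
  denominators do not affect membership.\<close>

lemma ideal_rfrac_iff:
  assumes "ideal J RS" "a \<in> carrier R" "s \<in> S"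
  shows "rfrac a s \<in> J \<longleftrightarrow> rfrac a \<one> \<in> J"
proof
  assume "rfrac a s \<in> J"
  then have "rfrac s \<one> \<otimes>\<^bsub>RS\<^esub> rfrac a s \<in> J"
    using assms by (intro ideal.I_l_closed) auto
  moreover have "rfrac s \<one> \<otimes>\<^bsub>RS\<^esub> rfrac a s = rfrac a \<one>"
    using assms by (subst rfrac_mult) (auto intro!: rfrac_eqI del: equalityI subsetI)
  ultimately show "rfrac a \<one> \<in> J" by simp
next
  assume "rfrac a \<one> \<in> J"
  then have "rfrac \<one> s \<otimes>\<^bsub>RS\<^esub> rfrac a \<one> \<in> J"
    using assms by (intro ideal.I_l_closed) auto
  then show "rfrac a s \<in> J" using assms by (subst (asm) rfrac_mult) auto
qed

lemma submodule_frac_iff: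
  assumes "submodule L RS MS" "x \<in> carrier M" "s \<in> S"
  shows "fraction R S M x s \<in> L \<longleftrightarrow> fraction R S M x \<one> \<in> L"
proof
  interpret MS: module RS MS by (rule module_MS)
  assume "fraction R S M x s \<in> L"
  then have "rfrac s \<one> \<odot>\<^bsub>MS\<^esub> fraction R S M x s \<in> L"
    using assms by (intro MS.submoduleE(4)) auto
  moreover have "rfrac s \<one> \<odot>\<^bsub>MS\<^esub> fraction R S M x s = fraction R S M x \<one>"
    using assms by (subst smult_frac) (auto intro!: frac_eqI del: equalityI subsetI)
  ultimately show "fraction R S M x \<one> \<in> L" by simp
next
  interpret MS: module RS MS by (rule module_MS)
  assume "fraction R S M x \<one> \<in> L"
  then have "rfrac \<one> s \<odot>\<^bsub>MS\<^esub> fraction R S M x \<one> \<in> L"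
    using assms by (intro MS.submoduleE(4)) auto
  then show "fraction R S M x s \<in> L" using assms by (subst (asm) smult_frac) auto
qed

section \<open>Extension and contraction along a localization\<close>

lemma ideal_extension:
  assumes "ideal A R"
  shows "ideal {rfrac a s | a s. a \<in> A \<and> s \<in> S} RS"
proof -
  interpret A: ideal A R by fact
  interpret RS: cring RS by (rule cring_RS)
  let ?A = "{rfrac a s | a s. a \<in> A \<and> s \<in> S}"
  have I: "rfrac a s \<in> ?A" if "a \<in> A" "s \<in> S" for a s using that by blast
  show ?thesis
  proof (rule RS.ideal_commI)
    show "?A \<subseteq> carrier RS" using A.Icarr rfrac_in_carrier by blast
    show "\<zero>\<^bsub>RS\<^esub> \<in> ?A" unfolding RS_zero using A.zero_closed by (intro I) auto
    fix x assume "x \<in> ?A"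
    then obtain a s where x: "a \<in> A" "s \<in> S" "x = rfrac a s" by blast
    {
      fix y assume "y \<in> ?A"
      then obtain b t where y: "b \<in> A" "t \<in> S" "y = rfrac b t" by blast
      have "x \<oplus>\<^bsub>RS\<^esub> y = rfrac (t \<otimes> a \<oplus> s \<otimes> b) (s \<otimes> t)"
        unfolding x(3) y(3) using x y A.Icarr by (intro rfrac_add) auto
      moreover have "t \<otimes> a \<oplus> s \<otimes> b \<in> A"
        using A.I_l_closed[OF x(1) S_carr[OF y(2)]] A.I_l_closed[OF y(1) S_carr[OF x(2)]]
        by (rule A.a_closed)
      ultimately show "x \<oplus>\<^bsub>RS\<^esub> y \<in> ?A" using I[OF _ S.m_closed[OF x(2) y(2)]] by simp
    next
      fix y assume "y \<in> carrier RS"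
      then obtain b t where y: "b \<in> carrier R" "t \<in> S" "y = rfrac b t" by (rule RS_carrierE)
      have "y \<otimes>\<^bsub>RS\<^esub> x = rfrac (b \<otimes> a) (t \<otimes> s)"
        unfolding x(3) y(3) using x y A.Icarr by (intro rfrac_mult) auto
      then show "y \<otimes>\<^bsub>RS\<^esub> x \<in> ?A"
        using I[OF A.I_l_closed[OF x(1) y(1)] S.m_closed[OF y(2) x(2)]] by simp
    }
  qed
qed

lemma ideal_contraction:
  assumes "ideal J RS"
  shows "ideal {r \<in> carrier R. rfrac r \<one> \<in> J} R"
proof (rule R.ideal_commI)
  interpret J: additive_subgroup J RS by (rule ideal.axioms(1)[OF assms])
  have "rfrac \<zero> \<one> \<in> J" using J.zero_closed RS_zero by metis
  then show "\<zero> \<in> {r \<in> carrier R. rfrac r \<one> \<in> J}" by simp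
  fix a assume a: "a \<in> {r \<in> carrier R. rfrac r \<one> \<in> J}"
  show "a \<oplus> b \<in> {r \<in> carrier R. rfrac r \<one> \<in> J}" if b: "b \<in> {r \<in> carrier R. rfrac r \<one> \<in> J}" for b
  proof -
    have "rfrac a \<one> \<oplus>\<^bsub>RS\<^esub> rfrac b \<one> \<in> J" using a b by (intro J.a_closed) auto
    then show ?thesis using a b by (subst (asm) rfrac_add) auto
  qed
  show "x \<otimes> a \<in> {r \<in> carrier R. rfrac r \<one> \<in> J}" if x: "x \<in> carrier R" for x
  proof -
    have "rfrac x \<one> \<otimes>\<^bsub>RS\<^esub> rfrac a \<one> \<in> J" using a x by (intro ideal.I_l_closed[OF assms]) auto
    then show ?thesis using a x by (subst (asm) rfrac_mult) auto
  qed
qed auto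

text \<open>A fraction in the extensions of two ideals can be rewritten with numerator
  \<open>c a = d b\<close>, which lies in both. This is why extension of ideals commutes with finite
  intersections.\<close>

lemma rfrac_eq_common:
  assumes "a \<in> carrier R" "s \<in> S" "b \<in> carrier R" "t \<in> S" "rfrac a s = rfrac b t"
  obtains c d w where "c \<in> S" "d \<in> S" "w \<in> S" "c \<otimes> a = d \<otimes> b" "rfrac a s = rfrac (c \<otimes> a) w"
proof -
  obtain u where u: "u \<in> S" "u \<otimes> (t \<otimes> a) = u \<otimes> (s \<otimes> b)"
    using rfrac_eq_iff[OF assms(1-4)] assms(5) by blast
  show ?thesis
  \<comment> \<open>Equality of the fractions gives \<open>u t a = u s b\<close>. The factors of
    \<open>a\<close> and \<open>b\<close> serve as \<open>c\<close> and \<open>d\<close>, and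
    \<open>a/s\<close> is expanded by \<open>c\<close>.\<close>
  proof (rule that[of "u \<otimes> t" "u \<otimes> s" "(u \<otimes> t) \<otimes> s"])
    show "(u \<otimes> t) \<otimes> a = (u \<otimes> s) \<otimes> b" using u assms by (simp add: R.m_assoc)
    show "rfrac a s = rfrac ((u \<otimes> t) \<otimes> a) ((u \<otimes> t) \<otimes> s)"
      using u(1) assms(1-4) by (intro rfrac_eqI) (auto simp: R.m_ac)
  qed (use u assms in auto)
qed

text \<open>Extension preserves intersections: if \<open>A \<inter> B\<close> lies in the
  contraction of \<open>J\<close>, the extended ideals intersect inside \<open>J\<close>. One of
  them then lies in \<open>J\<close> and contracts back.\<close>

lemma quasi_prime_contraction:
  assumes "quasi_prime_ideal J RS"
  shows "quasi_prime_ideal {r \<in> carrier R. rfrac r \<one> \<in> J} R"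
proof -
  let ?I = "{r \<in> carrier R. rfrac r \<one> \<in> J}" and ?e = "\<lambda>A. {rfrac a s | a s. a \<in> A \<and> s \<in> S}"
  have J: "ideal J RS" "J \<noteq> carrier RS"
    and qp: "\<And>A B. ideal A RS \<Longrightarrow> ideal B RS \<Longrightarrow> A \<inter> B \<subseteq> J \<Longrightarrow> A \<subseteq> J \<or> B \<subseteq> J"
    using assms unfolding quasi_prime_ideal_def by auto
  have "\<one> \<notin> ?I" using J ideal.one_imp_carrier[OF J(1)] by auto
  then have "?I \<noteq> carrier R" using R.one_closed by blast
  moreover have "A \<subseteq> ?I \<or> B \<subseteq> ?I" if A: "ideal A R" and B: "ideal B R" and AB: "A \<inter> B \<subseteq> ?I" for A B
  proof -
    have "?e A \<inter> ?e B \<subseteq> J"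
    proof
      fix x assume "x \<in> ?e A \<inter> ?e B"
      then obtain a s b t where x: "a \<in> A" "s \<in> S" "b \<in> B" "t \<in> S" "x = rfrac a s" "x = rfrac b t"
        by blast
      have ab: "a \<in> carrier R" "b \<in> carrier R" using ideal.Icarr A B x by fast+
      have "rfrac a s = rfrac b t" using x(5,6) by simp
      then obtain c d w where c: "c \<in> S" "d \<in> S" "w \<in> S" "c \<otimes> a = d \<otimes> b" "rfrac a s = rfrac (c \<otimes> a) w"
        by (rule rfrac_eq_common[OF ab(1) x(2) ab(2) x(4)])
      have "c \<otimes> a \<in> A" "c \<otimes> a \<in> B"
        using ideal.I_l_closed[OF A x(1) S_carr[OF c(1)]] ideal.I_l_closed[OF B x(3) S_carr[OF c(2)]] c(4)
        by simp_all
      then have "rfrac (c \<otimes> a) \<one> \<in> J" using AB by blast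
      then show "x \<in> J" using ideal_rfrac_iff[OF J(1) _ c(3), of "c \<otimes> a"] ab(1) c(1,5) x(5) by simp
    qed
    then have "?e A \<subseteq> J \<or> ?e B \<subseteq> J" by (rule qp[OF ideal_extension[OF A] ideal_extension[OF B]])
    moreover have "C \<subseteq> ?I" if "ideal C R" "?e C \<subseteq> J" for C
    proof
      fix c assume c: "c \<in> C"
      then have "rfrac c \<one> \<in> ?e C" using S.one_closed by blast
      then show "c \<in> ?I" using that(2) ideal.Icarr[OF that(1) c] by blast
    qed
    ultimately show ?thesis using A B by blast
  qed
  ultimately show ?thesis using ideal_contraction[OF J(1)] unfolding quasi_prime_ideal_def by blast
qed

lemma submodule_contraction:
  assumes "submodule L RS MS"
  shows "submodule {x \<in> carrier M. fraction R S M x \<one> \<in> L} R M"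
proof (rule submoduleI)
  interpret MS: module RS MS by (rule module_MS)
  let ?N = "{x \<in> carrier M. fraction R S M x \<one> \<in> L}"
  note E = MS.submoduleE[OF assms]
  show z: "\<zero>\<^bsub>M\<^esub> \<in> ?N" using MS.submodule_zero[OF assms] by simp
  have sm: "r \<odot>\<^bsub>M\<^esub> x \<in> ?N" if "r \<in> carrier R" "x \<in> ?N" for r x
  proof -
    have "rfrac r \<one> \<odot>\<^bsub>MS\<^esub> fraction R S M x \<one> \<in> L" using that by (intro E(4)) auto
    then show ?thesis using that by (subst (asm) smult_frac) auto
  qed
  then show "r \<odot>\<^bsub>M\<^esub> x \<in> ?N" if "r \<in> carrier R" "x \<in> ?N" for r x using that by blast
  show "\<ominus>\<^bsub>M\<^esub> x \<in> ?N" if "x \<in> ?N" for x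
    using sm[OF _ that, of "\<ominus> \<one>"] that by (simp add: smult_l_minus)
  show "x \<oplus>\<^bsub>M\<^esub> y \<in> ?N" if "x \<in> ?N" "y \<in> ?N" for x y
    using E(5)[of "fraction R S M x \<one>" "fraction R S M y \<one>"] that by simp
qed auto

text \<open>Up to a unit every element of \<open>MS\<close> has denominator one, so it suffices to
  test \<open>r/1\<close> on the images of elements of \<open>M\<close>.\<close>

lemma colon_contraction:
  assumes "submodule L RS MS"
  shows "colon R M {x \<in> carrier M. fraction R S M x \<one> \<in> L} = {r \<in> carrier R. rfrac r \<one> \<in> colon RS MS L}"
proof -
  have "(\<forall>x \<in> carrier M. fraction R S M (r \<odot>\<^bsub>M\<^esub> x) \<one> \<in> L) \<longleftrightarrow>
      (\<forall>y \<in> carrier MS. rfrac r \<one> \<odot>\<^bsub>MS\<^esub> y \<in> L)" if r: "r \<in> carrier R" for r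
  proof
    assume *: "\<forall>x \<in> carrier M. fraction R S M (r \<odot>\<^bsub>M\<^esub> x) \<one> \<in> L"
    show "\<forall>y \<in> carrier MS. rfrac r \<one> \<odot>\<^bsub>MS\<^esub> y \<in> L"
    proof
      fix y assume "y \<in> carrier MS"
      then obtain x s where y: "x \<in> carrier M" "s \<in> S" "y = fraction R S M x s"
        by (rule localized_carrierE)
      then show "rfrac r \<one> \<odot>\<^bsub>MS\<^esub> y \<in> L"
        using * r submodule_frac_iff[OF assms, of "r \<odot>\<^bsub>M\<^esub> x" s] by simp
    qed
  next
    assume *: "\<forall>y \<in> carrier MS. rfrac r \<one> \<odot>\<^bsub>MS\<^esub> y \<in> L"
    show "\<forall>x \<in> carrier M. fraction R S M (r \<odot>\<^bsub>M\<^esub> x) \<one> \<in> L"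
    proof
      fix x assume x: "x \<in> carrier M"
      then have "rfrac r \<one> \<odot>\<^bsub>MS\<^esub> fraction R S M x \<one> \<in> L" using * by simp
      then show "fraction R S M (r \<odot>\<^bsub>M\<^esub> x) \<one> \<in> L" using x r by simp
    qed
  qed
  then show ?thesis by (auto simp: colon_def)
qed

text \<open>A submodule of \<open>MS\<close> consists of the fractions with numerator in its
  contraction, so contraction is injective. It preserves quasi-primality and commutes with colon
  ideals, so injectivity of the natural map for \<open>M\<close> carries over.\<close>

lemma quasi_prime_embedding_localized:
  assumes "quasi_prime_embedding R M"
  shows "quasi_prime_embedding RS MS"
proof -
  interpret MS: module RS MS by (rule module_MS)
  let ?c = "\<lambda>L. {x \<in> carrier M. fraction R S M x \<one> \<in> L}"
  have rec: "L = {fraction R S M x s | x s. x \<in> ?c L \<and> s \<in> S}" if L: "submodule L RS MS" for L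
  proof
    show "L \<subseteq> {fraction R S M x s | x s. x \<in> ?c L \<and> s \<in> S}"
    proof
      fix y assume y: "y \<in> L"
      obtain x s where x: "x \<in> carrier M" "s \<in> S" "y = fraction R S M x s"
        using MS.submodule_subset[OF L y] by (rule localized_carrierE)
      then have "x \<in> ?c L" using submodule_frac_iff[OF L x(1,2)] y by simp
      then show "y \<in> {fraction R S M x s | x s. x \<in> ?c L \<and> s \<in> S}" using x by blast
    qed
    show "{fraction R S M x s | x s. x \<in> ?c L \<and> s \<in> S} \<subseteq> L"
      using submodule_frac_iff[OF L] by blast
  qed
  have qp: "quasi_prime_submodule (?c L) R M" if "quasi_prime_submodule L RS MS" for L
  proof -
    have L: "submodule L RS MS" "L \<noteq> carrier MS" "quasi_prime_ideal (colon RS MS L) RS"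
      using that unfolding quasi_prime_submodule_def by auto
    have "?c L \<noteq> carrier M"
    proof
      assume *: "?c L = carrier M"
      have "y \<in> L" if y: "y \<in> carrier MS" for y
      proof -
        obtain x s where x: "x \<in> carrier M" "s \<in> S" "y = fraction R S M x s"
          using y by (rule localized_carrierE)
        then have "x \<in> ?c L" using * by simp
        then show ?thesis using submodule_frac_iff[OF L(1) x(1,2)] x(3) by simp
      qed
      then show False using L(2) MS.submodule_subset[OF L(1)] by blast
    qed
    then show ?thesis
      using submodule_contraction[OF L(1)] quasi_prime_contraction[OF L(3)] colon_contraction[OF L(1)]
      unfolding quasi_prime_submodule_def by simp
  qed
  show ?thesis
    unfolding MS.quasi_prime_embedding_iff
  proof (intro allI impI, elim conjE)
    fix N L assume N: "quasi_prime_submodule N RS MS" and L: "quasi_prime_submodule L RS MS"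
      and eq: "colon RS MS N = colon RS MS L"
    then have sub: "submodule N RS MS" "submodule L RS MS" by (auto simp: quasi_prime_submodule_def)
    have "colon R M (?c N) = colon R M (?c L)"
      unfolding colon_contraction[OF sub(1)] colon_contraction[OF sub(2)] eq ..
    then have "?c N = ?c L"
      using assms qp[OF N] qp[OF L] unfolding quasi_prime_embedding_iff by blast
    then show "N = L" using rec[OF sub(1)] rec[OF sub(2)] by simp
  qed
qed

end

text \<open>Both directions clear denominators. A generator \<open>x/s\<close> may be replaced by
  \<open>x\<close>, because \<open>s\<close> becomes a unit. An equality
  \<open>z/1 = (r/t) (x/s)\<close> amounts to \<open>u t s z = u r x\<close>, and
  \<open>u z = r x\<close> gives back \<open>z/s = (r/(s u)) (x/1)\<close>.\<close>

lemma (in module) cyclic_localized_iff: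
  assumes "primeideal P R"
  shows "cyclic_module (localized_ring R (carrier R - P)) (localized_module R (carrier R - P) M) \<longleftrightarrow>
    cyclic_at R M P"
proof -
  interpret L: localization R M "carrier R - P"
    by (intro localization.intro module_axioms submonoid_prime_complement assms)
  note L.S_carr [simp del] \<comment> \<open>loops, since its premise simplifies to its conclusion\<close>
  interpret MS: module L.RS L.MS by (rule L.module_MS)
  show ?thesis
  proof
    assume "cyclic_module L.RS L.MS"
    then obtain y where y: "y \<in> carrier L.MS" "carrier L.MS = {r \<odot>\<^bsub>L.MS\<^esub> y | r. r \<in> carrier L.RS}"
      unfolding cyclic_module_def by blast
    obtain x s where x: "x \<in> carrier M" "s \<in> carrier R - P" "y = fraction R (carrier R - P) M x s"
      using y(1) by (rule L.localized_carrierE)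
    have "z \<in> saturation R M P {r \<odot>\<^bsub>M\<^esub> x | r. r \<in> carrier R}" if z: "z \<in> carrier M" for z
    proof -
      have "fraction R (carrier R - P) M z \<one> \<in> carrier L.MS" using z L.S.one_closed by simp
      then obtain q where q: "q \<in> carrier L.RS" "fraction R (carrier R - P) M z \<one> = q \<odot>\<^bsub>L.MS\<^esub> y"
        unfolding y(2) by blast
      obtain r t where r: "r \<in> carrier R" "t \<in> carrier R - P" "q = L.rfrac r t"
        using q(1) by (rule L.RS_carrierE)
      have ts: "t \<otimes> s \<in> carrier R - P" using r(2) x(2) by (rule L.S.m_closed)
      have "fraction R (carrier R - P) M z \<one> = fraction R (carrier R - P) M (r \<odot>\<^bsub>M\<^esub> x) (t \<otimes> s)"
        unfolding q(2) r(3) x(3) by (rule L.smult_frac[OF r(1,2) x(1,2)])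
      then have "\<exists>u \<in> carrier R - P. u \<odot>\<^bsub>M\<^esub> ((t \<otimes> s) \<odot>\<^bsub>M\<^esub> z) = u \<odot>\<^bsub>M\<^esub> (\<one> \<odot>\<^bsub>M\<^esub> (r \<odot>\<^bsub>M\<^esub> x))"
        by (rule iffD1[OF L.frac_eq_iff[OF z L.S.one_closed smult_closed[OF r(1) x(1)] ts]])
      then obtain u where u: "u \<in> carrier R - P" "u \<odot>\<^bsub>M\<^esub> ((t \<otimes> s) \<odot>\<^bsub>M\<^esub> z) = u \<odot>\<^bsub>M\<^esub> (\<one> \<odot>\<^bsub>M\<^esub> (r \<odot>\<^bsub>M\<^esub> x))"
        by (rule bexE)
      have "(u \<otimes> (t \<otimes> s)) \<odot>\<^bsub>M\<^esub> z = (u \<otimes> r) \<odot>\<^bsub>M\<^esub> x"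
      proof -
        have c: "u \<in> carrier R" "t \<otimes> s \<in> carrier R" using u(1) ts by blast+
        have "(u \<otimes> (t \<otimes> s)) \<odot>\<^bsub>M\<^esub> z = u \<odot>\<^bsub>M\<^esub> ((t \<otimes> s) \<odot>\<^bsub>M\<^esub> z)" by (rule smult_assoc1[OF c z])
        also have "\<dots> = u \<odot>\<^bsub>M\<^esub> (r \<odot>\<^bsub>M\<^esub> x)" unfolding u(2) smult_one[OF smult_closed[OF r(1) x(1)]] ..
        also have "\<dots> = (u \<otimes> r) \<odot>\<^bsub>M\<^esub> x" by (rule smult_assoc1[OF c(1) r(1) x(1), symmetric])
        finally show ?thesis .
      qed
      moreover have "u \<otimes> (t \<otimes> s) \<in> carrier R - P" using u(1) ts by (rule L.S.m_closed)
      moreover have "u \<otimes> r \<in> carrier R" using u(1) r(1) by simp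
      ultimately show ?thesis using z by (intro saturationI[of _ _ "u \<otimes> (t \<otimes> s)"]) blast+
    qed
    then show "cyclic_at R M P" using x(1) unfolding cyclic_at_def by blast
  next
    assume "cyclic_at R M P"
    then obtain x where x: "x \<in> carrier M" "carrier M \<subseteq> saturation R M P {r \<odot>\<^bsub>M\<^esub> x | r. r \<in> carrier R}"
      unfolding cyclic_at_def by blast
    show "cyclic_module L.RS L.MS"
    proof (rule MS.cyclic_moduleI)
      show "fraction R (carrier R - P) M x \<one> \<in> carrier L.MS" using x(1) L.S.one_closed by simp
      show "carrier L.MS \<subseteq> {r \<odot>\<^bsub>L.MS\<^esub> fraction R (carrier R - P) M x \<one> | r. r \<in> carrier L.RS}"
      proof
        fix y assume "y \<in> carrier L.MS"
        then obtain z s where z: "z \<in> carrier M" "s \<in> carrier R - P" "y = fraction R (carrier R - P) M z s"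
          by (rule L.localized_carrierE)
        have "z \<in> saturation R M P {r \<odot>\<^bsub>M\<^esub> x | r. r \<in> carrier R}" using x(2) z(1) by blast
        then obtain u where u: "u \<in> carrier R" "u \<notin> P" "u \<odot>\<^bsub>M\<^esub> z \<in> {r \<odot>\<^bsub>M\<^esub> x | r. r \<in> carrier R}"
          by (rule saturationE)
        then obtain r where r: "r \<in> carrier R" "u \<odot>\<^bsub>M\<^esub> z = r \<odot>\<^bsub>M\<^esub> x" by blast
        have us: "s \<otimes> u \<in> carrier R - P" using z(2) u by (intro L.S.m_closed) auto
        have "L.rfrac r (s \<otimes> u) \<odot>\<^bsub>L.MS\<^esub> fraction R (carrier R - P) M x \<one> =
            fraction R (carrier R - P) M (r \<odot>\<^bsub>M\<^esub> x) ((s \<otimes> u) \<otimes> \<one>)"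
          using r(1) us x(1) L.S.one_closed by (intro L.smult_frac)
        also have "\<dots> = y"
          unfolding z(3) r(2)[symmetric]
          using us z u by (intro L.frac_eqI) (auto simp: smult_assoc1)
        finally show "y \<in> {r \<odot>\<^bsub>L.MS\<^esub> fraction R (carrier R - P) M x \<one> | r. r \<in> carrier L.RS}"
          using L.rfrac_in_carrier[OF r(1) us] by blast
      qed
    qed
  qed
qed

lemma (in module) locally_cyclic_iff:
  "locally_cyclic_module R M \<longleftrightarrow> (\<forall>P. primeideal P R \<longrightarrow> cyclic_at R M P)"
  unfolding locally_cyclic_module_def using cyclic_localized_iff by blast

section \<open>Arithmetical rings, and the passage from maximal to prime ideals\<close>

lemma (in module) cyclic_at_subideal:
  assumes "cyclic_at R M m" "P \<subseteq> m" shows "cyclic_at R M P"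
proof -
  have "saturation R M m N \<subseteq> saturation R M P N" for N
    using assms(2) by (auto simp: saturation_def)
  then show ?thesis using assms(1) unfolding cyclic_at_def by blast
qed

text \<open>In the serial localization the extensions of \<open>A\<close> and \<open>B\<close> are
  comparable. If that of \<open>A\<close> is the smaller one, each \<open>a\<close> in
  \<open>A\<close> has a multiple \<open>c a = d b\<close> in
  \<open>A \<inter> B \<subseteq> I\<close> with \<open>c\<close> outside \<open>P\<close>, and
  \<open>sat\<close> removes \<open>c\<close>.\<close>

lemma (in cring) serial_localization_quasi_prime:
  assumes P: "primeideal P R" and serial: "serial_ring (localized_ring R (carrier R - P))"
    and I: "ideal I R" "I \<noteq> carrier R"
    and sat: "\<And>u r. u \<in> carrier R - P \<Longrightarrow> r \<in> carrier R \<Longrightarrow> u \<otimes> r \<in> I \<Longrightarrow> r \<in> I"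
  shows "quasi_prime_ideal I R"
proof -
  interpret L: localization R "regular_module R" "carrier R - P"
    by (intro localization.intro module_regular_module is_cring submonoid_prime_complement P)
  note L.S_carr [simp del]
  let ?e = "\<lambda>A. {L.rfrac a s | a s. a \<in> A \<and> s \<in> carrier R - P}"
  have key: "A \<subseteq> I" if A: "ideal A R" and B: "ideal B R" and AB: "A \<inter> B \<subseteq> I" and le: "?e A \<subseteq> ?e B" for A B
  proof
    fix a assume a: "a \<in> A"
    then have ac: "a \<in> carrier R" by (rule ideal.Icarr[OF A])
    have "L.rfrac a \<one> \<in> ?e A" using a L.S.one_closed by blast
    then obtain b t where b: "b \<in> B" "t \<in> carrier R - P" "L.rfrac a \<one> = L.rfrac b t" using le by blast
    have bc: "b \<in> carrier R" by (rule ideal.Icarr[OF B b(1)])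
    obtain c d w where c: "c \<in> carrier R - P" "d \<in> carrier R - P" "c \<otimes> a = d \<otimes> b"
      using L.rfrac_eq_common[OF ac L.S.one_closed bc b(2,3)] by blast
    have "c \<otimes> a \<in> A" using ideal.I_l_closed[OF A a] c(1) by blast
    moreover have "c \<otimes> a \<in> B" unfolding c(3) using ideal.I_l_closed[OF B b(1)] c(2) by blast
    ultimately show "a \<in> I" using AB sat[OF c(1) ac] by blast
  qed
  have "A \<subseteq> I \<or> B \<subseteq> I" if A: "ideal A R" and B: "ideal B R" and AB: "A \<inter> B \<subseteq> I" for A B
  proof -
    have "?e A \<subseteq> ?e B \<or> ?e B \<subseteq> ?e A"
      using serial L.ideal_extension[OF A] L.ideal_extension[OF B] unfolding serial_ring_def by blast
    then show ?thesis using key[OF A B AB] key[OF B A] AB by blast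
  qed
  then show ?thesis using I unfolding quasi_prime_ideal_def by blast
qed

text \<open>The colon ideal of an \<open>m\<close>-saturated submodule is itself saturated, so all
  proper \<open>m\<close>-saturated submodules are quasi-prime. The natural map then separates all
  of them, which yields the membership criterion of \<open>cyclic_atI_colon\<close>.\<close>

lemma (in module) arithmetical_imp_cyclic_at_maximal:
  assumes "arithmetical_ring R" "quasi_prime_embedding R M" and m: "maximalideal m R"
  shows "cyclic_at R M m"
proof -
  interpret m: primeideal m R by (rule R.maximalideal_prime[OF m])
  have qp: "quasi_prime_submodule N R M"
    if N: "submodule N R M" "saturation R M m N \<subseteq> N" "N \<noteq> carrier M" for N
  proof -
    have "r \<in> colon R M N" if "u \<in> carrier R - m" "r \<in> carrier R" "u \<otimes> r \<in> colon R M N" for u r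
    proof -
      have "r \<odot>\<^bsub>M\<^esub> x \<in> N" if x: "x \<in> carrier M" for x
      proof -
        have "u \<odot>\<^bsub>M\<^esub> (r \<odot>\<^bsub>M\<^esub> x) \<in> N"
          using x that \<open>u \<in> carrier R - m\<close> \<open>r \<in> carrier R\<close> \<open>u \<otimes> r \<in> colon R M N\<close>
          by (simp add: colon_def flip: smult_assoc1)
        then have "r \<odot>\<^bsub>M\<^esub> x \<in> saturation R M m N"
          using x \<open>u \<in> carrier R - m\<close> \<open>r \<in> carrier R\<close> by (intro saturationI[of _ _ u]) auto
        then show ?thesis using N(2) by blast
      qed
      then show ?thesis using \<open>r \<in> carrier R\<close> by (simp add: colon_def)
    qed
    then have "quasi_prime_ideal (colon R M N) R"
      using assms(1) m N(3) colon_eq_carrier_iff[OF N(1)] ideal_colon[OF N(1)]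
      unfolding arithmetical_ring_def
      by (intro R.serial_localization_quasi_prime[OF m.primeideal]) auto
    then show ?thesis using N unfolding quasi_prime_submodule_def by blast
  qed
  show ?thesis
  proof (rule cyclic_atI_colon[OF m.primeideal])
    fix z N assume z: "z \<in> carrier M" and N: "submodule N R M" "saturation R M m N \<subseteq> N"
    let ?S = "saturation R M m {r \<odot>\<^bsub>M\<^esub> z | r. r \<in> carrier R}"
    assume le: "colon R M ?S \<subseteq> colon R M N"
    have C: "submodule {r \<odot>\<^bsub>M\<^esub> z | r. r \<in> carrier R} R M" by (rule submodule_cyclic[OF R.oneideal z])
    have S: "submodule ?S R M" "saturation R M m ?S \<subseteq> ?S"
      using submodule_saturation[OF m.primeideal C] saturation_idem[OF m.primeideal] by auto
    have zS: "z \<in> ?S" using saturation_extensive[OF m.primeideal C] cyclic_self[OF z] by blast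
    have I: "submodule (N \<inter> ?S) R M" by (rule submodule_Int[OF N(1) S(1)])
    have Isat: "saturation R M m (N \<inter> ?S) \<subseteq> N \<inter> ?S"
      using saturation_mono[of "N \<inter> ?S" N m] saturation_mono[of "N \<inter> ?S" ?S m] N(2) S(2) by blast
    \<comment> \<open>Injectivity needs equal colon ideals; intersecting with \<open>?S\<close>
      turns the inclusion \<open>le\<close> into an equality.\<close>
    have ceq: "colon R M (N \<inter> ?S) = colon R M ?S"
      using le by (auto simp: colon_def)
    show "z \<in> N"
    \<comment> \<open>Quasi-prime submodules are proper. If \<open>z\<close> already generates
      \<open>M\<close> locally, the colon ideal alone forces \<open>N = M\<close>.\<close>
    proof (cases "?S = carrier M")
      case True
      then have "colon R M (N \<inter> ?S) = carrier R" using ceq colon_eq_carrier_iff[OF S(1)] by simp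
      then have "N \<inter> ?S = carrier M" using colon_eq_carrier_iff[OF I] by blast
      then show ?thesis using z by blast
    next
      case False
      then have "N \<inter> ?S \<noteq> carrier M"
        using ceq colon_eq_carrier_iff[OF S(1)] colon_eq_carrier_iff[OF I] by metis
      then have "N \<inter> ?S = ?S"
        using qp[OF I Isat] qp[OF S False] ceq assms(2) unfolding quasi_prime_embedding_iff by blast
      then show ?thesis using zS by blast
    qed
  qed
qed

text \<open>Every prime ideal lies in a maximal one, and the smaller ideal allows more
  denominators.\<close>

lemma (in module) cyclic_at_maximal_imp_prime:
  assumes "\<And>m. maximalideal m R \<Longrightarrow> cyclic_at R M m" and P: "primeideal P R"
  shows "cyclic_at R M P"
proof -
  interpret P: primeideal P R by fact
  obtain m where "maximalideal m R" "P \<subseteq> m"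
    using R.exists_maximalideal[OF P.is_ideal] P.I_notcarr by blast
  then show ?thesis using assms(1) cyclic_at_subideal by blast
qed

section \<open>Free and projective modules\<close>

lemma (in module) submodule_commI:
  assumes "H \<subseteq> carrier M" "\<zero>\<^bsub>M\<^esub> \<in> H" "\<And>x y. x \<in> H \<Longrightarrow> y \<in> H \<Longrightarrow> x \<oplus>\<^bsub>M\<^esub> y \<in> H"
    and l: "\<And>a x. a \<in> carrier R \<Longrightarrow> x \<in> H \<Longrightarrow> a \<odot>\<^bsub>M\<^esub> x \<in> H"
  shows "submodule H R M"
proof (rule submoduleI)
  show "\<ominus>\<^bsub>M\<^esub> x \<in> H" if "x \<in> H" for x
  proof -
    have "(\<ominus> \<one>) \<odot>\<^bsub>M\<^esub> x = \<ominus>\<^bsub>M\<^esub> x" using that assms(1) by (subst smult_l_minus) auto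
    then show ?thesis using l[OF _ that, of "\<ominus> \<one>"] by simp
  qed
qed (use assms in auto)

lemma (in module) submodule_finsum:
  assumes N: "submodule N R M" and "finite I" "\<And>i. i \<in> I \<Longrightarrow> f i \<in> N"
  shows "(\<Oplus>\<^bsub>M\<^esub>i\<in>I. f i) \<in> N"
  using assms(2,3)
proof (induction I)
  case empty
  then show ?case using submodule_zero[OF N] by simp
next
  case (insert i I)
  have "f \<in> I \<rightarrow> carrier M" "f i \<in> carrier M" using insert.prems submodule_subset[OF N] by auto
  then show ?case
    using insert submoduleE(5)[OF N] by simp
qed

lemma mod_homD:
  assumes "f \<in> mod_hom R M N"
  shows "x \<in> carrier M \<Longrightarrow> f x \<in> carrier N"
    and "x \<in> carrier M \<Longrightarrow> y \<in> carrier M \<Longrightarrow> f (x \<oplus>\<^bsub>M\<^esub> y) = f x \<oplus>\<^bsub>N\<^esub> f y"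
    and "r \<in> carrier R \<Longrightarrow> x \<in> carrier M \<Longrightarrow> f (r \<odot>\<^bsub>M\<^esub> x) = r \<odot>\<^bsub>N\<^esub> f x"
  using assms unfolding mod_hom_def by auto

lemma (in module) submodule_vimage:
  assumes "module R N" and f: "f \<in> mod_hom R M N" and L: "submodule L R N"
  shows "submodule {x \<in> carrier M. f x \<in> L} R M"
proof (rule submodule_commI)
  interpret N: module R N by fact
  note E = N.submoduleE[OF L] and h = mod_homD[OF f]
  have "f (\<zero> \<odot>\<^bsub>M\<^esub> \<zero>\<^bsub>M\<^esub>) = \<zero> \<odot>\<^bsub>N\<^esub> f \<zero>\<^bsub>M\<^esub>" using h(3) by blast
  then have "f \<zero>\<^bsub>M\<^esub> = \<zero>\<^bsub>N\<^esub>" using h(1) by simp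
  then show "\<zero>\<^bsub>M\<^esub> \<in> {x \<in> carrier M. f x \<in> L}" using N.submodule_zero[OF L] by simp
  show "x \<oplus>\<^bsub>M\<^esub> y \<in> {x \<in> carrier M. f x \<in> L}"
    if "x \<in> {x \<in> carrier M. f x \<in> L}" "y \<in> {x \<in> carrier M. f x \<in> L}" for x y
    using that h(2) E(5) by simp
  show "a \<odot>\<^bsub>M\<^esub> x \<in> {x \<in> carrier M. f x \<in> L}"
    if "a \<in> carrier R" "x \<in> {x \<in> carrier M. f x \<in> L}" for a x
    using that h(3) E(4) by simp
qed auto

lemma finsupp_simps:
  "\<zero>\<^bsub>finsupp_module R B\<^esub> = (\<lambda>_. \<zero>\<^bsub>R\<^esub>)"
  "(c \<oplus>\<^bsub>finsupp_module R B\<^esub> d) x = c x \<oplus>\<^bsub>R\<^esub> d x"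
  "(r \<odot>\<^bsub>finsupp_module R B\<^esub> c) x = r \<otimes>\<^bsub>R\<^esub> c x"
  by (simp_all add: finsupp_module_def)

lemma finsupp_carrierD:
  assumes "c \<in> carrier (finsupp_module R B)"
  shows "c x \<in> carrier R" "finite {x. c x \<noteq> \<zero>\<^bsub>R\<^esub>}" "{x. c x \<noteq> \<zero>\<^bsub>R\<^esub>} \<subseteq> B"
  using assms by (auto simp: finsupp_module_def)

context module
begin

abbreviation single :: "'c \<Rightarrow> 'c \<Rightarrow> 'a" where "single x \<equiv> (\<lambda>y. if y = x then \<one> else \<zero>)"

lemma single_in_finsupp:
  assumes "x \<in> B" shows "single x \<in> carrier (finsupp_module R B)"
proof -
  have "{y. single x y \<noteq> \<zero>} \<subseteq> {x}" by auto
  then have "finite {y. single x y \<noteq> \<zero>}" by (rule finite_subset) simp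
  then show ?thesis using assms by (auto simp: finsupp_module_def)
qed

lemma linear_extension_single:
  assumes "x \<in> B" "B \<subseteq> carrier M"
  shows "linear_extension R M id (single x) = x"
proof -
  have x: "x \<in> carrier M" using assms by blast
  have "linear_extension R M id (single x) = (\<Oplus>\<^bsub>M\<^esub>y\<in>{x}. single x y \<odot>\<^bsub>M\<^esub> id y)"
    using assms by (intro linear_extension_eq[OF module_axioms _ single_in_finsupp]) auto
  also have "\<dots> = x" using x by (subst M.finsum_insert) auto
  finally show ?thesis .
qed

text \<open>The image of the linear extension is a submodule containing \<open>B\<close>, by way of
  the unit vectors \<open>single b\<close>.\<close>

lemma linear_extension_surj:
  assumes B: "B \<subseteq> carrier M" and span: "module_span R M B = carrier M" and z: "z \<in> carrier M"
  obtains c where "c \<in> carrier (finsupp_module R B)" "linear_extension R M id c = z"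
proof -
  let ?F = "finsupp_module R B" and ?e = "linear_extension R M id"
  interpret F: module R ?F by (rule module_finsupp_module[OF R.is_cring])
  have "id \<in> B \<rightarrow> carrier M" using B by auto
  then have e: "?e \<in> mod_hom R ?F M" by (rule linear_extension_hom[OF module_axioms])
  note h = mod_homD[OF e]
  have "?e (\<zero> \<odot>\<^bsub>?F\<^esub> \<zero>\<^bsub>?F\<^esub>) = \<zero> \<odot>\<^bsub>M\<^esub> ?e \<zero>\<^bsub>?F\<^esub>" using h(3) by blast
  then have z0: "\<zero>\<^bsub>M\<^esub> = ?e \<zero>\<^bsub>?F\<^esub>" using h(1) by simp
  have "submodule (?e ` carrier ?F) R M"
  proof (rule submodule_commI)
    show "?e ` carrier ?F \<subseteq> carrier M" using h(1) by blast
    show "\<zero>\<^bsub>M\<^esub> \<in> ?e ` carrier ?F" using z0 F.zero_closed by (rule image_eqI)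
    show "x \<oplus>\<^bsub>M\<^esub> y \<in> ?e ` carrier ?F" if xy: "x \<in> ?e ` carrier ?F" "y \<in> ?e ` carrier ?F" for x y
    proof -
      obtain c d where "c \<in> carrier ?F" "d \<in> carrier ?F" "x = ?e c" "y = ?e d" using xy by blast
      then show ?thesis using h(2)[symmetric] F.a_closed by simp
    qed
    show "a \<odot>\<^bsub>M\<^esub> x \<in> ?e ` carrier ?F" if ax: "a \<in> carrier R" "x \<in> ?e ` carrier ?F" for a x
    proof -
      obtain c where "c \<in> carrier ?F" "x = ?e c" using ax by blast
      then show ?thesis using ax(1) h(3)[symmetric] F.smult_closed by simp
    qed
  qed
  moreover have "B \<subseteq> ?e ` carrier ?F"
  proof
    fix b assume b: "b \<in> B"
    show "b \<in> ?e ` carrier ?F"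
      using linear_extension_single[OF b B, symmetric] single_in_finsupp[OF b] by (rule image_eqI)
  qed
  ultimately have "carrier M \<subseteq> ?e ` carrier ?F" using span_least span by metis
  then show ?thesis using z that by blast
qed

text \<open>The difference of \<open>c\<close> and the unit vector at \<open>b\<close> is mapped to
  zero. Independence, applied to the support of this difference, shows that the support is
  empty.\<close>

lemma linearly_independent_coefficient:
  assumes B: "B \<subseteq> carrier M" and li: "linearly_independent R M B"
    and c: "c \<in> carrier (finsupp_module R B)" "linear_extension R M id c = b" and b: "b \<in> B"
  shows "c b = \<one>"
proof -
  let ?F = "finsupp_module R B" and ?e = "linear_extension R M id"
  interpret F: module R ?F by (rule module_finsupp_module[OF R.is_cring])
  have "id \<in> B \<rightarrow> carrier M" using B by auto
  then have e: "?e \<in> mod_hom R ?F M" by (rule linear_extension_hom[OF module_axioms])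
  define d where "d = c \<oplus>\<^bsub>?F\<^esub> (\<ominus> \<one>) \<odot>\<^bsub>?F\<^esub> single b"
  have s: "single b \<in> carrier ?F" by (rule single_in_finsupp[OF b])
  have d: "d \<in> carrier ?F" unfolding d_def using c(1) s by simp
  have bM: "b \<in> carrier M" using b B by blast
  have "?e d = ?e c \<oplus>\<^bsub>M\<^esub> ?e ((\<ominus> \<one>) \<odot>\<^bsub>?F\<^esub> single b)"
    unfolding d_def using c(1) s by (intro mod_homD(2)[OF e]) auto
  also have "?e ((\<ominus> \<one>) \<odot>\<^bsub>?F\<^esub> single b) = (\<ominus> \<one>) \<odot>\<^bsub>M\<^esub> ?e (single b)"
    using s by (intro mod_homD(3)[OF e]) auto
  also have "?e c \<oplus>\<^bsub>M\<^esub> (\<ominus> \<one>) \<odot>\<^bsub>M\<^esub> ?e (single b) = \<zero>\<^bsub>M\<^esub>"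
    unfolding c(2) linear_extension_single[OF b B] using bM by (simp add: smult_l_minus M.r_neg)
  finally have "(\<Oplus>\<^bsub>M\<^esub>x\<in>{x. d x \<noteq> \<zero>}. d x \<odot>\<^bsub>M\<^esub> x) = \<zero>\<^bsub>M\<^esub>" unfolding linear_extension_def by simp
  moreover have "d \<in> {x. d x \<noteq> \<zero>} \<rightarrow> carrier R" using finsupp_carrierD(1)[OF d] by blast
  ultimately have "\<forall>x \<in> {x. d x \<noteq> \<zero>}. d x = \<zero>"
    using li finsupp_carrierD(2,3)[OF d] unfolding linearly_independent_def by blast
  then have "d b = \<zero>" by blast
  then have "c b \<oplus> (\<ominus> \<one>) \<otimes> \<one> = \<zero>" by (simp add: d_def finsupp_simps)
  then have "c b \<ominus> \<one> = \<zero>" by (simp add: R.minus_eq)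
  then show ?thesis using R.r_right_minus_eq[OF finsupp_carrierD(1)[OF c(1)] R.one_closed] by blast
qed

text \<open>At a maximal ideal \<open>m\<close> each \<open>b\<close> in \<open>B\<close> defines a
  hyperplane \<open>?N b\<close> of the fibre. Uniqueness identifies all these hyperplanes, but
  \<open>?N a\<close> contains every basis element other than \<open>a\<close>. So \<open>B\<close>
  has at most one element.\<close>

lemma free_quasi_prime_embedding_imp_cyclic:
  assumes "free_module R M" "quasi_prime_embedding R M" "\<one> \<noteq> \<zero>"
  shows "cyclic_module R M"
proof -
  obtain B where B: "B \<subseteq> carrier M" and li: "linearly_independent R M B"
    and span: "module_span R M B = carrier M"
    using assms(1) unfolding free_module_def by blast
  let ?F = "finsupp_module R B" and ?e = "linear_extension R M id"
  interpret F: module R ?F by (rule module_finsupp_module[OF R.is_cring])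
  have "id \<in> B \<rightarrow> carrier M" using B by auto
  then have e: "?e \<in> mod_hom R ?F M" by (rule linear_extension_hom[OF module_axioms])
  note h = mod_homD[OF e]
  have "carrier R \<noteq> {\<zero>}" using assms(3) R.one_closed by blast
  then obtain m where m: "maximalideal m R" using R.exists_maximalideal[OF R.zeroideal] by blast
  interpret m: primeideal m R by (rule R.maximalideal_prime[OF m])
  \<comment> \<open>Some representation of the vector is required to have its coefficient at
    \<open>b\<close> in \<open>m\<close>; independence of \<open>B\<close> enters only in the proof
    that \<open>b\<close> is outside \<open>?N b\<close>.\<close>
  let ?N = "\<lambda>b. {?e c | c. c \<in> carrier ?F \<and> c b \<in> m}"
  have NI: "?e c \<in> ?N b" if "c \<in> carrier ?F" "c b \<in> m" for b c using that by blast
  have N: "submodule (?N b) R M" for b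
  proof (rule submodule_commI)
    show "?N b \<subseteq> carrier M" using h(1) by blast
    have "?e (\<zero> \<odot>\<^bsub>?F\<^esub> \<zero>\<^bsub>?F\<^esub>) = \<zero> \<odot>\<^bsub>M\<^esub> ?e \<zero>\<^bsub>?F\<^esub>" using h(3) by blast
    then have "?e \<zero>\<^bsub>?F\<^esub> = \<zero>\<^bsub>M\<^esub>" using h(1) by simp
    moreover have "?e \<zero>\<^bsub>?F\<^esub> \<in> ?N b"
      using F.zero_closed by (rule NI) (simp add: finsupp_simps m.zero_closed)
    ultimately show "\<zero>\<^bsub>M\<^esub> \<in> ?N b" by simp
    show "x \<oplus>\<^bsub>M\<^esub> y \<in> ?N b" if xy: "x \<in> ?N b" "y \<in> ?N b" for x y
    proof -
      obtain c d where c: "c \<in> carrier ?F" "c b \<in> m" "x = ?e c" "d \<in> carrier ?F" "d b \<in> m" "y = ?e d"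
        using xy by blast
      have "?e (c \<oplus>\<^bsub>?F\<^esub> d) \<in> ?N b" using c by (intro NI) (auto simp: finsupp_simps)
      then show ?thesis using c h(2) by simp
    qed
    show "a \<odot>\<^bsub>M\<^esub> x \<in> ?N b" if ax: "a \<in> carrier R" "x \<in> ?N b" for a x
    proof -
      obtain c where c: "c \<in> carrier ?F" "c b \<in> m" "x = ?e c" using ax by blast
      have "?e (a \<odot>\<^bsub>?F\<^esub> c) \<in> ?N b" using c ax(1) m.I_l_closed by (intro NI) (auto simp: finsupp_simps)
      then show ?thesis using c ax(1) h(3) by simp
    qed
  qed
  have mN: "m \<subseteq> colon R M (?N b)" for b
  proof
    fix p assume p: "p \<in> m"
    then have pc: "p \<in> carrier R" by (rule m.Icarr)
    have "p \<odot>\<^bsub>M\<^esub> z \<in> ?N b" if z: "z \<in> carrier M" for z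
    proof -
      obtain c where c: "c \<in> carrier ?F" "?e c = z" using z by (rule linear_extension_surj[OF B span])
      have "?e (p \<odot>\<^bsub>?F\<^esub> c) \<in> ?N b"
        using c p pc m.I_r_closed finsupp_carrierD(1)[OF c(1)] by (intro NI) (auto simp: finsupp_simps)
      then show ?thesis using c pc h(3) by simp
    qed
    then show "p \<in> colon R M (?N b)" using pc by (simp add: colon_def)
  qed
  have notin: "b \<notin> ?N b" if b: "b \<in> B" for b
  proof
    assume "b \<in> ?N b"
    then obtain c where c: "c \<in> carrier ?F" "c b \<in> m" "?e c = b" by blast
    then have "\<one> \<in> m" using linearly_independent_coefficient[OF B li c(1,3) b] by simp
    then show False using m.I_notcarr m.one_imp_carrier by blast
  qed
  have eq: "a = b" if ab: "a \<in> B" "b \<in> B" for a b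
  proof (rule ccontr)
    assume "a \<noteq> b"
    have "?N a = ?N b"
      using notin ab B
      by (intro prime_submodule_unique[OF assms(2) m.primeideal] N mN maximal_saturated[OF m]) blast+
    moreover have "?e (single b) \<in> ?N a"
      using single_in_finsupp[OF ab(2)] \<open>a \<noteq> b\<close> by (intro NI) auto
    then have "b \<in> ?N a" unfolding linear_extension_single[OF ab(2) B] .
    ultimately show False using notin[OF ab(2)] by simp
  qed
  obtain x where x: "x \<in> carrier M" "B \<subseteq> {x}"
  proof (cases "B = {}")
    case True
    \<comment> \<open>An empty basis spans the zero module, which zero generates.\<close>
    then show ?thesis using that[of "\<zero>\<^bsub>M\<^esub>"] by simp
  next
    case False
    then obtain b where "b \<in> B" by blast
    then show ?thesis using that[of b] B eq by blast
  qed
  have "B \<subseteq> {r \<odot>\<^bsub>M\<^esub> x | r. r \<in> carrier R}" using x(2) cyclic_self[OF x(1)] by blast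
  then have "carrier M \<subseteq> {r \<odot>\<^bsub>M\<^esub> x | r. r \<in> carrier R}"
    using span_least[OF submodule_cyclic[OF R.oneideal x(1)]] unfolding span[symmetric] by blast
  then show ?thesis by (rule cyclic_moduleI[OF x(1)])
qed

section \<open>Projective modules and dual bases\<close>

lemma saturated_vimage:
  assumes "module R N" and f: "f \<in> mod_hom R M N" and L: "saturation R N P L \<subseteq> L"
  shows "saturation R M P {x \<in> carrier M. f x \<in> L} \<subseteq> {x \<in> carrier M. f x \<in> L}"
proof
  interpret N: module R N by fact
  fix x assume "x \<in> saturation R M P {x \<in> carrier M. f x \<in> L}"
  then obtain u where u: "x \<in> carrier M" "u \<in> carrier R" "u \<notin> P" "f (u \<odot>\<^bsub>M\<^esub> x) \<in> L"
    by (auto elim: saturationE)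
  then have "f x \<in> saturation R N P L"
    using mod_homD[OF f] by (intro saturationI[of _ _ u]) auto
  then show "x \<in> {x \<in> carrier M. f x \<in> L}" using u(1) L by blast
qed

lemma colon_vimage:
  assumes f: "f \<in> mod_hom R M N" and "I \<subseteq> colon R N L"
  shows "I \<subseteq> colon R M {x \<in> carrier M. f x \<in> L}"
proof
  fix p assume "p \<in> I"
  then have "p \<in> carrier R" "\<forall>x \<in> carrier N. p \<odot>\<^bsub>N\<^esub> x \<in> L" using assms(2) by (auto simp: colon_def)
  then show "p \<in> colon R M {x \<in> carrier M. f x \<in> L}"
    using mod_homD[OF f] by (simp add: colon_def)
qed

text \<open>A projection whose coordinates all lie in \<open>P\<close> vanishes locally at \<open>P\<close>: the coordinates of a
  vector in its image generate an ideal \<open>A\<close> with \<open>A = P A\<close> up to saturation.\<close>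

lemma projection_locally_zero:
  assumes P: "primeideal P R"
    and s: "s \<in> mod_hom R M (finsupp_module R (carrier M))"
    and basis: "\<And>x. x \<in> carrier M \<Longrightarrow> linear_extension R M id (s x) = x"
    and g: "g \<in> mod_hom R M M" and t: "t \<in> carrier R" "t \<notin> P"
    and idem: "\<And>z. z \<in> carrier M \<Longrightarrow> g (g z) = t \<odot>\<^bsub>M\<^esub> g z"
    and coord: "\<And>z y. z \<in> carrier M \<Longrightarrow> s (g z) y \<in> P"
    and z: "z \<in> carrier M"
  shows "g z \<in> saturation R M P {\<zero>\<^bsub>M\<^esub>}"
proof -
  interpret P: primeideal P R by fact
  let ?A = "regular_module R"
  interpret A: module R ?A by (rule module_regular_module[OF R.is_cring])
  define w where "w = g z"
  have w: "w \<in> carrier M" unfolding w_def by (rule mod_homD(1)[OF g z])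
  have sw: "s w \<in> carrier (finsupp_module R (carrier M))" by (rule mod_homD(1)[OF s w])
  define I where "I = {x. s w x \<noteq> \<zero>}"
  have I: "finite I" "I \<subseteq> carrier M" unfolding I_def using finsupp_carrierD[OF sw] by auto
  let ?G = "s w ` I"
  have G: "?G \<subseteq> carrier ?A" using finsupp_carrierD(1)[OF sw] by auto
  \<comment> \<open>The ideal generated by the coordinates of \<open>w\<close>, treated as a module
    so that Nakayama's lemma applies to it with \<open>K = 0\<close>.\<close>
  define H where "H = module_span R ?A ?G"
  have H: "submodule H R ?A" unfolding H_def by (rule A.submodule_span[OF G])
  have GH: "?G \<subseteq> H" unfolding H_def by (rule A.span_extensive)
  have HR: "H \<subseteq> carrier R" using A.submodule_subset[OF H] by auto
  let ?H = "?A\<lparr>carrier := H\<rparr>"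
  interpret H: module R ?H by (rule submodule.submodule_is_module[OF H A.module_axioms])
  have toA: "submodule N R ?A" if N: "submodule N R ?H" for N
    using H.submoduleE(1,4,5)[OF N] H.submodule_zero[OF N] HR
    by (intro A.submodule_commI) auto
  have "carrier ?H \<subseteq> saturation R ?H P {\<zero>\<^bsub>?H\<^esub>}"
  proof (rule H.finitely_generated_Nakayama[OF P finite_imageI[OF I(1)] _ _ H.submodule_zero_set])
    show "?G \<subseteq> carrier ?H" using GH by simp
    show "\<zero>\<^bsub>?H\<^esub> \<in> {\<zero>\<^bsub>?H\<^esub>}" by simp
    have gen: "N = carrier ?H" if N: "submodule N R ?H" "?G \<subseteq> N" for N
      using A.span_least[OF toA[OF N(1)] N(2)] H.submoduleE(1)[OF N(1)] unfolding H_def by simp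
    then show "N = carrier ?H" if "submodule N R ?H" "?G \<subseteq> N" for N using that by blast
    fix N assume N: "submodule N R ?H" "saturation R ?H P N \<subseteq> N" "P \<subseteq> colon R ?H N"
    \<comment> \<open>Expanding \<open>w\<close> in its coordinates and applying \<open>g\<close>
      writes \<open>t (s w j)\<close> as a sum of products of \<open>s (g i) j\<close> and
      \<open>s w i\<close>. Each lies in \<open>P H \<subseteq> N\<close>, and \<open>t\<close> is
      removed because \<open>N\<close> is saturated.\<close>
    have "s w j \<in> N" if j: "j \<in> I" for j
    proof -
      let ?Z = "{x \<in> carrier M. s (g x) j \<in> N}"
      have hom: "(\<lambda>x. s (g x) j) \<in> mod_hom R M ?A"
        using mod_homD[OF s] mod_homD[OF g] finsupp_carrierD(1)[OF mod_homD(1)[OF s]]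
        unfolding mod_hom_def
        by (auto simp: finsupp_simps)
      have Z: "submodule ?Z R M" by (rule submodule_vimage[OF A.module_axioms hom toA[OF N(1)]])
      have "s w i \<odot>\<^bsub>M\<^esub> i \<in> ?Z" if i: "i \<in> I" for i
      proof -
        have iM: "i \<in> carrier M" using i I(2) by blast
        have c: "s w i \<in> carrier R" by (rule finsupp_carrierD(1)[OF sw])
        have "s (g i) j \<in> colon R ?H N" using coord[OF iM] N(3) by blast
        then have "s (g i) j \<otimes> s w i \<in> N" using i GH by (auto simp: colon_def)
        moreover have "s (g (s w i \<odot>\<^bsub>M\<^esub> i)) j = s (g i) j \<otimes> s w i"
          using mod_homD(3)[OF hom c iM] c P.Icarr[OF coord[OF iM]] by (simp add: R.m_comm)
        ultimately show ?thesis using c iM by simp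
      qed
      then have "(\<Oplus>\<^bsub>M\<^esub>i\<in>I. s w i \<odot>\<^bsub>M\<^esub> i) \<in> ?Z" by (rule submodule_finsum[OF Z I(1)])
      then have "w \<in> ?Z" using basis[OF w] unfolding linear_extension_def I_def by simp
      then have "s (g w) j \<in> N" by simp
      moreover have "s (g w) j = t \<otimes> s w j"
        unfolding w_def idem[OF z] using mod_homD(3)[OF s t(1) w] by (simp add: w_def finsupp_simps)
      ultimately have "s w j \<in> saturation R ?H P N"
        using t j GH by (intro saturationI[of _ _ t]) auto
      then show ?thesis using N(2) by blast
    qed
    then show "N = carrier ?H" using gen[OF N(1)] by blast
  qed
  then have "?G \<subseteq> saturation R ?H P {\<zero>\<^bsub>?H\<^esub>}" using GH by auto
  then obtain u where u: "u \<in> carrier R" "u \<notin> P" "\<forall>a \<in> ?G. u \<odot>\<^bsub>?H\<^esub> a \<in> {\<zero>\<^bsub>?H\<^esub>}"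
    using H.finite_subset_saturation[OF P H.submodule_zero_set finite_imageI[OF I(1)]] by blast
  \<comment> \<open>\<open>u\<close> kills every coordinate of \<open>w\<close>, hence every term of
    its expansion and \<open>w\<close> itself.\<close>
  let ?Z = "{x \<in> carrier M. \<forall>a \<in> {u}. a \<odot>\<^bsub>M\<^esub> x \<in> {\<zero>\<^bsub>M\<^esub>}}"
  have Z: "submodule ?Z R M" using u(1) by (intro submodule_colon_set submodule_zero_set) simp
  have "s w i \<odot>\<^bsub>M\<^esub> i \<in> ?Z" if i: "i \<in> I" for i
  proof -
    have iM: "i \<in> carrier M" using i I(2) by blast
    have c: "s w i \<in> carrier R" by (rule finsupp_carrierD(1)[OF sw])
    have "u \<odot>\<^bsub>M\<^esub> (s w i \<odot>\<^bsub>M\<^esub> i) = (u \<otimes> s w i) \<odot>\<^bsub>M\<^esub> i" using u(1) c iM by (simp add: smult_assoc1)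
    also have "u \<otimes> s w i = \<zero>" using u(3) i by simp
    finally show ?thesis using c iM by simp
  qed
  then have "(\<Oplus>\<^bsub>M\<^esub>i\<in>I. s w i \<odot>\<^bsub>M\<^esub> i) \<in> ?Z" by (rule submodule_finsum[OF Z I(1)])
  then have "w \<in> ?Z" using basis[OF w] unfolding linear_extension_def I_def by simp
  then show ?thesis using u(1,2) unfolding w_def by (intro saturationI[of _ _ u]) auto
qed

lemma projective_quasi_prime_embedding_imp_cyclic_at:
  assumes "projective_module R M" "quasi_prime_embedding R M" and P: "primeideal P R"
  shows "cyclic_at R M P"
proof -
  interpret P: primeideal P R by fact
  let ?F = "finsupp_module R (carrier M)" and ?e = "linear_extension R M id"
  have e: "?e \<in> mod_hom R ?F M" by (rule linear_extension_hom[OF module_axioms]) simp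
  have "?e ` carrier ?F = carrier M"
  proof
    show "?e ` carrier ?F \<subseteq> carrier M" using mod_homD(1)[OF e] by blast
    show "carrier M \<subseteq> ?e ` carrier ?F"
    proof
      fix x assume x: "x \<in> carrier M"
      show "x \<in> ?e ` carrier ?F"
        using linear_extension_single[OF x subset_refl, symmetric] single_in_finsupp[OF x]
        by (rule image_eqI)
    qed
  qed
  moreover have "id \<in> mod_hom R M M" by (auto simp: mod_hom_def)
  \<comment> \<open>The section is a dual basis: \<open>s x y\<close> is the coordinate of
    \<open>x\<close> at \<open>y\<close>, nonzero for only finitely many \<open>y\<close>.\<close>
  ultimately obtain s where s: "s \<in> mod_hom R M ?F"
    and basis': "\<forall>x \<in> carrier M. ?e (s x) = id x"
    using projective_module_lift[OF module_axioms assms(1) module_finsupp_module[OF R.is_cring]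
      module_axioms e] by blast
  have basis: "?e (s x) = x" if "x \<in> carrier M" for x using basis' that by simp
  have sc: "s x y \<in> carrier R" if "x \<in> carrier M" for x y
    by (rule finsupp_carrierD(1)[OF mod_homD(1)[OF s that]])
  have s_add: "s (x \<oplus>\<^bsub>M\<^esub> x') y = s x y \<oplus> s x' y" if "x \<in> carrier M" "x' \<in> carrier M" for x x' y
    using mod_homD(2)[OF s that] by (simp add: finsupp_simps)
  have s_smult: "s (r \<odot>\<^bsub>M\<^esub> x) y = r \<otimes> s x y" if "r \<in> carrier R" "x \<in> carrier M" for r x y
    using mod_homD(3)[OF s that] by (simp add: finsupp_simps)
  \<comment> \<open>It contains \<open>P M\<close> and is saturated because \<open>P\<close> is
    prime. So it is either \<open>M\<close> or the unique proper submodule at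
    \<open>P\<close>.\<close>
  let ?N = "{x \<in> carrier M. \<forall>y. s x y \<in> P}"
  have N: "submodule ?N R M"
  proof (rule submodule_commI)
    have "s (\<zero> \<odot>\<^bsub>M\<^esub> \<zero>\<^bsub>M\<^esub>) y = \<zero> \<otimes> s \<zero>\<^bsub>M\<^esub> y" for y by (rule s_smult) auto
    then have "s \<zero>\<^bsub>M\<^esub> y = \<zero>" for y using sc by simp
    then show "\<zero>\<^bsub>M\<^esub> \<in> ?N" by simp
  qed (auto simp: s_add s_smult P.I_l_closed)
  have Nsat: "saturation R M P ?N \<subseteq> ?N"
  proof
    fix x assume "x \<in> saturation R M P ?N"
    then obtain u where u: "x \<in> carrier M" "u \<in> carrier R" "u \<notin> P" "\<forall>y. s (u \<odot>\<^bsub>M\<^esub> x) y \<in> P"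
      by (auto elim: saturationE)
    have "s x y \<in> P" for y
      using P.I_prime[OF u(2) sc[OF u(1)]] u(3,4) s_smult[OF u(2,1)] by metis
    then show "x \<in> ?N" using u(1) by blast
  qed
  have PN: "P \<subseteq> colon R M ?N"
    using P.Icarr P.I_r_closed sc by (auto simp: colon_def s_smult)
  show ?thesis
  proof (cases "?N = carrier M")
    case True
    \<comment> \<open>All coordinates lie in \<open>P\<close>, so the identity serves as the
      projection, with \<open>t = 1\<close>, and \<open>M\<close> vanishes at
      \<open>P\<close>.\<close>
    have id: "id \<in> mod_hom R M M" by (auto simp: mod_hom_def)
    have "id z \<in> saturation R M P {\<zero>\<^bsub>M\<^esub>}" if "z \<in> carrier M" for z
      using True that P.I_notcarr P.one_imp_carrier
      by (intro projection_locally_zero[OF P s basis id R.one_closed]) auto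
    then have "carrier M \<subseteq> saturation R M P {\<zero>\<^bsub>M\<^esub>}" by auto
    also have "\<dots> \<subseteq> saturation R M P {r \<odot>\<^bsub>M\<^esub> \<zero>\<^bsub>M\<^esub> | r. r \<in> carrier R}"
      using cyclic_self[OF M.zero_closed] by (intro saturation_mono) blast
    finally have "carrier M \<subseteq> saturation R M P {r \<odot>\<^bsub>M\<^esub> \<zero>\<^bsub>M\<^esub> | r. r \<in> carrier R}" .
    then show ?thesis using M.zero_closed unfolding cyclic_at_def by blast
  next
    case False
    then obtain x where x: "x \<in> carrier M" "x \<notin> ?N" by blast
    then obtain y0 where y0: "s x y0 \<notin> P" by blast
    define t where "t = s x y0"
    have t: "t \<in> carrier R" "t \<notin> P" unfolding t_def using sc[OF x(1)] y0 by auto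
    \<comment> \<open>At \<open>P\<close>, this is \<open>t\<close> times the projection along
      \<open>x\<close> that annihilates the coordinate at \<open>y0\<close>. The factor
      \<open>t\<close> clears the denominator, which is why \<open>g g = t g\<close> takes the place
      of idempotence.\<close>
    define g where "g z = t \<odot>\<^bsub>M\<^esub> z \<oplus>\<^bsub>M\<^esub> (\<ominus> s z y0) \<odot>\<^bsub>M\<^esub> x" for z
    have g: "g \<in> mod_hom R M M"
      unfolding mod_hom_def
    proof (intro CollectI conjI ballI Pi_I)
      fix z assume z: "z \<in> carrier M"
      show "g z \<in> carrier M" unfolding g_def using t z x(1) sc by simp
      show "g (z \<oplus>\<^bsub>M\<^esub> z') = g z \<oplus>\<^bsub>M\<^esub> g z'" if z': "z' \<in> carrier M" for z'
        unfolding g_def using t z z' x(1) sc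
        by (simp add: s_add smult_r_distr smult_l_distr R.minus_add M.a_ac)
    next
      fix r z assume "r \<in> carrier R" "z \<in> carrier M"
      then show "g (r \<odot>\<^bsub>M\<^esub> z) = r \<odot>\<^bsub>M\<^esub> g z"
        unfolding g_def using t x(1) sc
        by (simp add: s_smult smult_r_distr R.m_comm R.r_minus R.l_minus flip: smult_assoc1)
    qed
    have gy0: "s (g z) y0 = \<zero>" if z: "z \<in> carrier M" for z
      unfolding g_def using t z x(1) sc
      by (simp add: s_add s_smult R.r_minus R.r_neg R.m_comm flip: t_def)
    have idem: "g (g z) = t \<odot>\<^bsub>M\<^esub> g z" if z: "z \<in> carrier M" for z
    proof -
      have "g (g z) = t \<odot>\<^bsub>M\<^esub> g z \<oplus>\<^bsub>M\<^esub> (\<ominus> s (g z) y0) \<odot>\<^bsub>M\<^esub> x" by (rule g_def)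
      then show ?thesis unfolding gy0[OF z] using t mod_homD(1)[OF g z] x(1) by simp
    qed
    \<comment> \<open>The preimage of \<open>?N\<close> under \<open>g\<close> contains
      \<open>x\<close>, but \<open>?N\<close> does not. Uniqueness forces the preimage to be
      \<open>M\<close>, so all coordinates of every \<open>g z\<close> lie in
      \<open>P\<close>.\<close>
    let ?N' = "{z \<in> carrier M. g z \<in> ?N}"
    have "g x = \<zero>\<^bsub>M\<^esub>"
      unfolding g_def using t x(1) by (simp add: smult_l_minus M.r_neg flip: t_def)
    then have xN': "x \<in> ?N'" using x(1) submodule_zero[OF N] by simp
    have "?N' = carrier M"
    proof (rule ccontr)
      assume "?N' \<noteq> carrier M"
      then have "?N' = ?N"
        by (intro prime_submodule_unique[OF assms(2) P] N Nsat PN False submodule_vimage[OF module_axioms g]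
            saturated_vimage[OF module_axioms g] colon_vimage[OF g])
      then show False using xN' x(2) by blast
    qed
    then have coord: "s (g z) y \<in> P" if "z \<in> carrier M" for z y using that by blast
    have "z \<in> saturation R M P {r \<odot>\<^bsub>M\<^esub> x | r. r \<in> carrier R}" if z: "z \<in> carrier M" for z
    proof -
      have "g z \<in> saturation R M P {\<zero>\<^bsub>M\<^esub>}"
        by (rule projection_locally_zero[OF P s basis g t idem coord z])
      then obtain u where u: "u \<in> carrier R" "u \<notin> P" "u \<odot>\<^bsub>M\<^esub> g z = \<zero>\<^bsub>M\<^esub>"
        by (auto elim: saturationE)
      have c: "s z y0 \<in> carrier R" by (rule sc[OF z])
      \<comment> \<open>Written out, \<open>u (g z) = 0\<close> says that \<open>u t z\<close> is a
        multiple of \<open>x\<close>.\<close>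
      have eq: "(u \<otimes> t) \<odot>\<^bsub>M\<^esub> z \<oplus>\<^bsub>M\<^esub> \<ominus>\<^bsub>M\<^esub> ((u \<otimes> s z y0) \<odot>\<^bsub>M\<^esub> x) = \<zero>\<^bsub>M\<^esub>"
        using u t c z x(1) unfolding g_def
        by (simp add: smult_r_distr smult_l_minus smult_r_minus smult_assoc1)
      have "(u \<otimes> t) \<odot>\<^bsub>M\<^esub> z = (u \<otimes> s z y0) \<odot>\<^bsub>M\<^esub> x"
        using M.minus_equality[OF eq] u(1) t(1) c z x(1) by simp
      moreover have "u \<otimes> t \<notin> P" using P.I_prime[OF u(1) t(1)] u(2) t(2) by blast
      moreover have "u \<otimes> t \<in> carrier R" "u \<otimes> s z y0 \<in> carrier R" using u t c by auto
      ultimately show ?thesis using z by (intro saturationI[of _ _ "u \<otimes> t"]) blast+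
    qed
    then show ?thesis using x(1) unfolding cyclic_at_def by blast
  qed
qed

end

theorem theorem2p24:
  fixes R :: "('a, 'r) ring_scheme" and M :: "('a, 'b, 'm) module_scheme" and S :: "'a set"
  assumes "module R M"
    and "\<one>\<^bsub>R\<^esub> \<noteq> \<zero>\<^bsub>R\<^esub>"
    and "submonoid S R"
  shows
    "(Laskerian_module R M \<and> quasi_prime_embedding R M \<longrightarrow>
        (\<forall>N. quasi_prime_submodule N R M \<longrightarrow> primary_submodule N R M)) \<and>
     (serial_ring R \<longrightarrow> (multiplication_module R M \<longleftrightarrow> quasi_prime_embedding R M)) \<and>
     (quasi_prime_embedding R M \<longrightarrow>
        quasi_prime_embedding (localized_ring R S) (localized_module R S M)) \<and>
     (free_module R M \<longrightarrow> (quasi_prime_embedding R M \<longleftrightarrow> cyclic_module R M)) \<and>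
     (projective_module R M \<and> quasi_prime_embedding R M \<longrightarrow> locally_cyclic_module R M) \<and>
     (arithmetical_ring R \<and> quasi_prime_embedding R M \<longrightarrow> locally_cyclic_module R M) \<and>
     (semilocal_ring R \<and> arithmetical_ring R \<longrightarrow>
        (cyclic_module R M \<longleftrightarrow> quasi_prime_embedding R M)) \<and>
     (finitely_generated_module R M \<longrightarrow>
        (locally_cyclic_module R M \<longleftrightarrow> multiplication_module R M) \<and>
        (multiplication_module R M \<longleftrightarrow> quasi_prime_embedding R M)) \<and>
     (Dedekind_domain R \<and> \<not> faithful_module R M \<and> quasi_prime_embedding R M \<longrightarrow>
        cyclic_module R M)"
proof -
  interpret module R M by fact
  interpret L: localization R M S by (intro localization.intro module_axioms assms(3))
  have cyclic: "cyclic_module R M \<Longrightarrow> quasi_prime_embedding R M"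
    by (intro multiplication_imp_quasi_prime_embedding cyclic_imp_multiplication)
  have arithmetical: "cyclic_at R M m"
    if "arithmetical_ring R" "quasi_prime_embedding R M" "maximalideal m R" for m
    using that by (rule arithmetical_imp_cyclic_at_maximal)
  show ?thesis
  proof (intro conjI impI allI iffI; (elim conjE)?)
    show "primary_submodule N R M"
      if "Laskerian_module R M" "quasi_prime_embedding R M" "quasi_prime_submodule N R M" for N
      using that by (rule Laskerian_quasi_prime_imp_primary)
    show "quasi_prime_embedding R M" if "multiplication_module R M"
      using that by (rule multiplication_imp_quasi_prime_embedding)
    then show "quasi_prime_embedding R M" if "multiplication_module R M" using that .
    show "multiplication_module R M" if "serial_ring R" "quasi_prime_embedding R M"
      using that by (rule serial_quasi_prime_embedding_imp_multiplication)
    show "quasi_prime_embedding (localized_ring R S) (localized_module R S M)"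
      if "quasi_prime_embedding R M"
      using that by (rule L.quasi_prime_embedding_localized)
    show "cyclic_module R M" if "free_module R M" "quasi_prime_embedding R M"
      using that assms(2) by (rule free_quasi_prime_embedding_imp_cyclic)
    show "quasi_prime_embedding R M" if "cyclic_module R M" using that by (rule cyclic)
    then show "quasi_prime_embedding R M" if "cyclic_module R M" using that .
    show "locally_cyclic_module R M" if "projective_module R M" "quasi_prime_embedding R M"
      using that projective_quasi_prime_embedding_imp_cyclic_at locally_cyclic_iff by blast
    show "locally_cyclic_module R M" if "arithmetical_ring R" "quasi_prime_embedding R M"
      using cyclic_at_maximal_imp_prime[OF arithmetical[OF that]] locally_cyclic_iff by blast
    show "cyclic_module R M"
      if "quasi_prime_embedding R M" "semilocal_ring R" "arithmetical_ring R"
      using that(2,1) arithmetical[OF that(3,1)] by (rule semilocal_locally_cyclic_imp_cyclic)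
    show mult: "multiplication_module R M"
      if "finitely_generated_module R M" "locally_cyclic_module R M"
      using that(1)
    proof (rule finitely_generated_locally_cyclic_imp_multiplication)
      show "cyclic_at R M m" if "maximalideal m R" for m
        using \<open>locally_cyclic_module R M\<close> R.maximalideal_prime[OF that] locally_cyclic_iff by blast
    qed
    show "locally_cyclic_module R M" if "multiplication_module R M"
      using that multiplication_imp_cyclic_at locally_cyclic_iff by blast
    \<comment> \<open>The implication passes through local cyclicity and uses finite generation
      twice, for Nakayama's lemma and for a common denominator.\<close>
    show "multiplication_module R M"
      if "finitely_generated_module R M" "quasi_prime_embedding R M"
      using mult that finitely_generated_imp_cyclic_at locally_cyclic_iff by blast
    show "cyclic_module R M"
      if "Dedekind_domain R" "\<not> faithful_module R M" "quasi_prime_embedding R M"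
      using that by (rule Dedekind_nonfaithful_imp_cyclic)
  qed
qed

end
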